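(* Let $G=(V,E)$ be an unweighted graph with $n$ vertices and $m$ edges, $\epsilon\in(0,1]$, and suppose $m>2\rho n$ where $\rho=\frac{1014\ln n}{0.38\epsilon^2}$. Run the algorithm described in the context, producing sets $X_i,F_i,Y_i$ and output $G_\epsilon$. Let $K$ be the largest index $i$ for which $F_i\neq\emptyset$, let $S=\big(\bigcup_{i=0}^K 2^iF_i\big)\cup 2^KY_K$ and $G_S=(V,S)$. Then $G_\epsilon\in(1\pm\epsilon/3)G_S$ with probability at least $1-4/n$.
   Context: A cut is a partition of $V$ into two nonempty parts; its weight in a weighted graph is the total weight of edges crossing it. For weighted graphs $H,G$ on the same vertex set and $\delta>0$, $H\in(1\pm\delta)G$ means every cut has weight in $H$ between $(1-\delta)$ and $(1+\delta)$ times its weight in $G$. For a set $Z$ of unweighted edges and $c>0$, $cZ$ denotes the edges of $Z$ each with weight $c$. Nagamochi–Ibaraki (NI) forests of a multigraph $H$: edge-disjoint forests $T_1,T_2,\ldots$ partitioning $E(H)$ produced by the Nagamochi–Ibaraki scan-first procedure, where $T_j$ is a maximal spanning forest of $H$ minus $T_1\cup\cdots\cup T_{j-1}$, with the property that for every edge $(u,v)\in T_j$, $u$ and $v$ are $j$-edge-connected in $T_1\cup\cdots\cup T_j$. Contracting an edge set merges endpoints, discards resulting self-loops and keeps parallel edges, each surviving edge identified with its original edge. The algorithm (case $m>2\rho n$): compute NI forests $T_1,T_2,\ldots$ of $G$; set $X_0=E$, $F_0=\bigcup_{1\le j\le 2\rho}T_j$, $Y_0=X_0\setminus F_0$; add each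 edge of $F_0$ to $G_\epsilon$ with weight 1; $i=0$. Loop: if $|Y_i|\le 2\rho n$, add each edge of $Y_i$ to $G_\epsilon$ with weight $2^i$ and go to the final phase. Otherwise let $X_{i+1}$ contain each edge of $Y_i$ independently with probability $1/2$; increase $i$ by 1; let $k_i=\rho\cdot2^{i+1}$ and $G_c=(V_c,E_c)=(V,X_i)$; while $|E_c|>2k_i|V_c|$, compute NI forests $T_1,\ldots,T_{k_i+1}$ of $G_c$ and contract all edges of $T_{k_i+1}$; then set $F_i=E_c$ (as a subset of $X_i$), $Y_i=X_i\setminus F_i$, and repeat the loop. Final phase: for each $i\ge1$ and $e\in F_i$, let $p_e=\min\!\big(\frac{3}{169\cdot2^{2i-9}},1\big)$, draw $r_e\sim\mathrm{Binomial}(2^i,p_e)$ independently, and if $r_e>0$ add $e$ to $G_\epsilon$ with weight $r_e/p_e$. *)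

theory Defs
  imports
    "HOL-Probability.Probability"
    "HOL-Library.While_Combinator"
begin

section \<open>Multigraphs\<close>

record ('a, 'e) multigraph =
  verts :: "'a set"
  edges :: "'e set"
  ends :: "'e \<Rightarrow> 'a set"

definition finite_multigraph :: "('a, 'e) multigraph \<Rightarrow> bool" where
  "finite_multigraph H \<longleftrightarrow> finite (verts H) \<and> finite (edges H) \<and>
     (\<forall>e\<in>edges H. ends H e \<subseteq> verts H \<and> card (ends H e) = 2)"

fun walk :: "('a, 'e) multigraph \<Rightarrow> 'e set \<Rightarrow> 'a \<Rightarrow> 'e list \<Rightarrow> 'a \<Rightarrow> bool" where
  "walk H D u [] v \<longleftrightarrow> u = v \<and> u \<in> verts H"
| "walk H D u (e # es) v \<longleftrightarrow>
     u \<in> verts H \<and> e \<in> D \<and> (\<exists>w. ends H e = {u, w} \<and> walk H D w es v)"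

definition connected_by :: "('a, 'e) multigraph \<Rightarrow> 'e set \<Rightarrow> 'a \<Rightarrow> 'a \<Rightarrow> bool" where
  "connected_by H D u v \<longleftrightarrow> (\<exists>es. walk H D u es v)"

definition edge_connected :: "('a, 'e) multigraph \<Rightarrow> 'e set \<Rightarrow> nat \<Rightarrow> 'a \<Rightarrow> 'a \<Rightarrow> bool" where
  "edge_connected H D k u v \<longleftrightarrow>
     (\<forall>C. C \<subseteq> D \<and> finite C \<and> card C < k \<longrightarrow> connected_by H (D - C) u v)"

text \<open>Acyclicity: a nonempty closed trail exists if and only if a cycle exists (two parallel
  edges form a cycle of length two).\<close>

definition forest :: "('a, 'e) multigraph \<Rightarrow> 'e set \<Rightarrow> bool" where
  "forest H D \<longleftrightarrow> \<not> (\<exists>u es. es \<noteq> [] \<and> distinct es \<and> walk H D u es u)"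

definition maximal_spanning_forest :: "('a, 'e) multigraph \<Rightarrow> 'e set \<Rightarrow> 'e set \<Rightarrow> bool" where
  "maximal_spanning_forest H D T \<longleftrightarrow>
     T \<subseteq> D \<and> forest H T \<and> (\<forall>T'. T \<subset> T' \<and> T' \<subseteq> D \<longrightarrow> \<not> forest H T')"

text \<open>Forests are indexed from 1 and are empty from some index on; \<open>T 0\<close> is irrelevant.\<close>

definition NI_forests :: "('a, 'e) multigraph \<Rightarrow> (nat \<Rightarrow> 'e set) \<Rightarrow> bool" where
  "NI_forests H T \<longleftrightarrow>
     (\<forall>i\<ge>1. \<forall>j\<ge>1. i \<noteq> j \<longrightarrow> T i \<inter> T j = {}) \<and>
     (\<Union>j\<in>{1..}. T j) = edges H \<and>
     (\<forall>j\<ge>1. maximal_spanning_forest H (edges H - (\<Union>i\<in>{1..<j}. T i)) (T j)) \<and>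
     (\<forall>j\<ge>1. \<forall>e\<in>T j. \<forall>u v. ends H e = {u, v} \<longrightarrow>
        edge_connected H (\<Union>i\<in>{1..j}. T i) j u v)"

text \<open>A subroutine computing NI forests; it embodies all tie-breaking choices.\<close>

definition NI_subroutine :: "(('a, 'e) multigraph \<Rightarrow> nat \<Rightarrow> 'e set) \<Rightarrow> bool" where
  "NI_subroutine ni \<longleftrightarrow> (\<forall>H. finite_multigraph H \<longrightarrow> NI_forests H (ni H))"

text \<open>Vertices of contracted graphs are sets of original vertices, merged by union; edges
  keep their identity as edges \<open>{u, v}\<close> of the original graph.\<close>

definition singleton_graph :: "'v set \<Rightarrow> 'v set set \<Rightarrow> ('v set, 'v set) multigraph" where
  "singleton_graph V X =
     \<lparr>verts = (\<lambda>v. {v}) ` V, edges = X, ends = (\<lambda>e. (\<lambda>v. {v}) ` e)\<rparr>"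

definition merged :: "('v set, 'e) multigraph \<Rightarrow> 'e set \<Rightarrow> 'v set \<Rightarrow> 'v set" where
  "merged H T a = \<Union> {b \<in> verts H. connected_by H T a b}"

definition contract :: "('v set, 'e) multigraph \<Rightarrow> 'e set \<Rightarrow> ('v set, 'e) multigraph" where
  "contract H T =
     \<lparr>verts = merged H T ` verts H,
      edges = {e \<in> edges H. card (merged H T ` ends H e) = 2},
      ends = (\<lambda>e. merged H T ` ends H e)\<rparr>"

section \<open>The sparsification algorithm\<close>

definition rho :: "nat \<Rightarrow> real \<Rightarrow> real" where
  "rho n \<epsilon> = 1014 * ln (real n) / (0.38 * \<epsilon>\<^sup>2)"

text \<open>The threshold \<open>k\<close> need not be an integer. The forest contracted is the one of the
  largest index \<open>j \<le> k + 1\<close>.\<close>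

definition contraction_phase ::
  "(('v set, 'v set) multigraph \<Rightarrow> nat \<Rightarrow> 'v set set) \<Rightarrow> real
    \<Rightarrow> ('v set, 'v set) multigraph \<Rightarrow> ('v set, 'v set) multigraph" where
  "contraction_phase ni k =
     while (\<lambda>H. real (card (edges H)) > 2 * k * real (card (verts H)))
           (\<lambda>H. contract H (ni H (nat \<lfloor>k\<rfloor> + 1)))"

definition random_half :: "'e set \<Rightarrow> 'e set pmf" where
  "random_half Y =
     map_pmf (\<lambda>b. {e \<in> Y. b e}) (Pi_pmf Y False (\<lambda>_. bernoulli_pmf (1/2)))"

text \<open>A run records the current index \<open>i\<close> and the sets \<open>X\<^sub>j\<close>, \<open>F\<^sub>j\<close>, \<open>Y\<^sub>j\<close> for
  \<open>j \<le> i\<close>; entries at larger indices are empty.\<close>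

record 'v run =
  idx :: nat
  Xs :: "nat \<Rightarrow> 'v set set"
  Fs :: "nat \<Rightarrow> 'v set set"
  Ys :: "nat \<Rightarrow> 'v set set"

definition initial_run ::
  "(('v set, 'v set) multigraph \<Rightarrow> nat \<Rightarrow> 'v set set) \<Rightarrow> 'v set \<Rightarrow> 'v set set \<Rightarrow> real
    \<Rightarrow> 'v run" where
  "initial_run ni V E \<rho> =
     (let F\<^sub>0 = (\<Union>j\<in>{j. 1 \<le> j \<and> real j \<le> 2 * \<rho>}. ni (singleton_graph V E) j) in
      \<lparr>idx = 0, Xs = (\<lambda>_. {})(0 := E), Fs = (\<lambda>_. {})(0 := F\<^sub>0),
       Ys = (\<lambda>_. {})(0 := E - F\<^sub>0)\<rparr>)"

definition next_run ::
  "(('v set, 'v set) multigraph \<Rightarrow> nat \<Rightarrow> 'v set set) \<Rightarrow> 'v set \<Rightarrow> real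
    \<Rightarrow> 'v run \<Rightarrow> 'v set set \<Rightarrow> 'v run" where
  "next_run ni V \<rho> r X =
     (let i = Suc (idx r);
          k = \<rho> * 2 ^ (i + 1);
          F = edges (contraction_phase ni k (singleton_graph V X)) in
      \<lparr>idx = i, Xs = (Xs r)(i := X), Fs = (Fs r)(i := F), Ys = (Ys r)(i := X - F)\<rparr>)"

partial_function (spmf) sampling_loop ::
  "(('v set, 'v set) multigraph \<Rightarrow> nat \<Rightarrow> 'v set set) \<Rightarrow> 'v set \<Rightarrow> real
    \<Rightarrow> 'v run \<Rightarrow> 'v run spmf" where
  "sampling_loop ni V \<rho> r =
     (if real (card (Ys r (idx r))) \<le> 2 * \<rho> * real (card V) then return_spmf r
      else bind_spmf (spmf_of_pmf (random_half (Ys r (idx r))))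
             (\<lambda>X. sampling_loop ni V \<rho> (next_run ni V \<rho> r X)))"

definition sample_prob :: "nat \<Rightarrow> real" where
  "sample_prob i = min (3 / (169 * 2 powi (2 * int i - 9))) 1"

definition draws :: "'v run \<Rightarrow> (nat \<times> 'v set \<Rightarrow> nat) pmf" where
  "draws r = Pi_pmf (SIGMA i:{1..idx r}. Fs r i) 0
     (\<lambda>(i, e). binomial_pmf (2 ^ i) (sample_prob i))"

text \<open>A weighted graph on \<open>V\<close> is given by its edge weights, 0 meaning that the edge is
  absent.\<close>

type_synonym 'v weighting = "'v set \<Rightarrow> real"

definition scaled :: "real \<Rightarrow> 'v set set \<Rightarrow> 'v weighting" where
  "scaled c Z e = (if e \<in> Z then c else 0)"

definition output_graph :: "'v run \<Rightarrow> (nat \<times> 'v set \<Rightarrow> nat) \<Rightarrow> 'v weighting" where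
  "output_graph r d e =
     scaled 1 (Fs r 0) e + scaled (2 ^ idx r) (Ys r (idx r)) e +
     (\<Sum>i\<in>{1..idx r}. if e \<in> Fs r i \<and> d (i, e) > 0
        then real (d (i, e)) / sample_prob i else 0)"

definition sparsify ::
  "(('v set, 'v set) multigraph \<Rightarrow> nat \<Rightarrow> 'v set set) \<Rightarrow> 'v set \<Rightarrow> 'v set set \<Rightarrow> real
    \<Rightarrow> ('v run \<times> 'v weighting) spmf" where
  "sparsify ni V E \<epsilon> =
     (let \<rho> = rho (card V) \<epsilon> in
      bind_spmf (sampling_loop ni V \<rho> (initial_run ni V E \<rho>))
        (\<lambda>r. map_spmf (\<lambda>d. (r, output_graph r d)) (spmf_of_pmf (draws r))))"

section \<open>Cuts and the intermediate graph\<close>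

definition simple_graph :: "'v set \<Rightarrow> 'v set set \<Rightarrow> bool" where
  "simple_graph V E \<longleftrightarrow> finite V \<and> (\<forall>e\<in>E. e \<subseteq> V \<and> card e = 2)"

definition cut_weight :: "'v set \<Rightarrow> 'v weighting \<Rightarrow> 'v set \<Rightarrow> real" where
  "cut_weight V w A =
     (\<Sum>e | e \<subseteq> V \<and> card e = 2 \<and> e \<inter> A \<noteq> {} \<and> e \<inter> (V - A) \<noteq> {}. w e)"

definition cut_approx :: "'v set \<Rightarrow> real \<Rightarrow> 'v weighting \<Rightarrow> 'v weighting \<Rightarrow> bool" where
  "cut_approx V \<delta> h g \<longleftrightarrow>
     (\<forall>A. A \<subseteq> V \<and> A \<noteq> {} \<and> V - A \<noteq> {} \<longrightarrow>
        (1 - \<delta>) * cut_weight V g A \<le> cut_weight V h A \<and>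
        cut_weight V h A \<le> (1 + \<delta>) * cut_weight V g A)"

definition top_index :: "'v run \<Rightarrow> nat" where
  "top_index r = Max {i. i \<le> idx r \<and> Fs r i \<noteq> {}}"

text \<open>The sets united here are pairwise disjoint, so adding weights is the union of weighted
  edge sets.\<close>

definition graph_S :: "'v run \<Rightarrow> 'v weighting" where
  "graph_S r e =
     (let K = top_index r in
      (\<Sum>i\<in>{0..K}. scaled (2 ^ i) (Fs r i) e) + scaled (2 ^ K) (Ys r K) e)"

end

theory Submission
  imports Defs
begin

text \<open>
  Write \<open>k i = \<rho> * 2 ^ (i + 1)\<close>. A cut of \<open>(V, X\<^sub>i)\<close> that crosses an edge of \<open>Y\<^sub>i\<close> has at least
  \<open>k i\<close> edges, because the contractions never split a smaller cut.

  Cut counting: if every cut crossing \<open>Y \<subseteq> X\<close> has at least \<open>k\<close> edges in \<open>X\<close>, then the cuts with at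
  most \<open>\<alpha> k\<close> edges in \<open>X\<close> have at most \<open>e n\<^bsup>2\<alpha>\<^esup>\<close> different intersections with \<open>Y\<close>. To see this,
  let the weight of an edge be the number of chosen cuts that contain it. The primal-dual argument
  for Steiner forests yields a set \<open>F\<close> of at most \<open>n\<close> edges that meets all cuts crossing \<open>Y\<close> and
  has weight at most \<open>2 / k\<close> times the total weight, so an average chosen cut meets \<open>F\<close> in at most
  \<open>2 \<alpha>\<close> edges. Since a cut's trace on \<open>F\<close> determines its trace on \<open>Y\<close>, Jensen's inequality
  bounds the number of traces.

  Chernoff bounds and a union bound over projections show that, with failure probability \<open>O(n\<^bsup>-3\<^esup>)\<close> per round,
  \<open>2 X\<^bsub>i+1\<^esub>\<close> approximates \<open>Y\<^sub>i\<close> on every cut up to \<open>\<delta> i\<close> times the cut in \<open>X\<^sub>i\<close>, where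
  \<open>\<delta> i\<close> decays geometrically. On such runs \<open>F\<^sub>i\<close> is heavy in
  \<open>U i = F\<^bsub>i-1\<^esub> \<union> \<dots> \<union> F\<^sub>K \<union> Y\<^sub>K\<close>, and the same union bound controls the binomial draws on \<open>F\<^sub>i\<close> up to
  \<open>\<epsilon> / 25\<close> times the cut in \<open>2\<^sup>i U i\<close>. These cuts sum to at most four times the cut in \<open>G\<^sub>S\<close>.
  Since the loop may go on after index \<open>K\<close>, the rounds from \<open>K\<close> on contribute an additional error
  of at most \<open>13/45 (3/4)\<^sup>K \<epsilon>\<close>; for \<open>K < 2\<close> the draws are exact.
\<close>

section \<open>Small edge sets that meet all separating cuts, by the primal-dual method\<close>

section \<open>Weighted Steiner forests\<close>

text \<open>Endpoints are given by two maps instead of two-element sets, so that contraction is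
  composition with a vertex map and edges that become loops cross nothing.\<close>

definition crossing :: "('e \<Rightarrow> 'a) \<Rightarrow> ('e \<Rightarrow> 'a) \<Rightarrow> 'e set \<Rightarrow> 'a set \<Rightarrow> 'e set" where
  "crossing a b F A = {e \<in> F. (a e \<in> A) \<noteq> (b e \<in> A)}"

definition separates :: "('a \<times> 'a) set \<Rightarrow> 'a set \<Rightarrow> bool" where
  "separates R A \<longleftrightarrow> (\<exists>(u, v)\<in>R. (u \<in> A) \<noteq> (v \<in> A))"

lemma of_nat_card_filter:
  "finite A \<Longrightarrow> of_nat (card {x \<in> A. P x}) = (\<Sum>x\<in>A. if P x then 1 else 0)"
  by (simp add: sum.If_cases Collect_conj_eq)

lemma card_filter: "finite A \<Longrightarrow> card {x \<in> A. P x} = (\<Sum>x\<in>A. if P x then 1 else 0)"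
  using of_nat_card_filter[of A P, where ?'b = nat] by simp

lemma crossing_subset: "crossing a b F A \<subseteq> F"
  by (auto simp: crossing_def)

lemma finite_crossing: "finite F \<Longrightarrow> finite (crossing a b F A)"
  by (auto simp: crossing_def)

text \<open>Cuts form a vector space over the field with two elements. This linearity replaces cycle
  arguments in the counting below.\<close>

lemma crossing_sym_diff:
  "crossing a b F (sym_diff A B) = sym_diff (crossing a b F A) (crossing a b F B)"
  by (auto simp: crossing_def)

text \<open>The condition \<open>single\<close> is acyclicity in terms of cuts: each edge is a cut
  by itself. By linearity all subsets of \<open>F\<close> are then cuts. A cut depends only on the
  part of \<open>A\<close> among the non-isolated vertices, so \<open>2 ^ card F\<close> is at most
  2 to the number of these vertices.\<close>

lemma card_le_card_nonisolated:
  assumes "finite V" "finite F" and V: "\<And>e. e \<in> F \<Longrightarrow> a e \<in> V \<and> b e \<in> V"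
    and single: "\<And>e. e \<in> F \<Longrightarrow> \<exists>A. crossing a b F A = {e}"
  shows "card F \<le> card {v \<in> V. crossing a b F {v} \<noteq> {}}"
proof -
  define S where "S = {v \<in> V. crossing a b F {v} \<noteq> {}}"
  have finS: "finite S" using assms(1) by (simp add: S_def)
  have cutS: "crossing a b F (A \<inter> S) = crossing a b F A" for A
  proof -
    have "a e \<in> S \<and> b e \<in> S" if "e \<in> F" "a e \<noteq> b e" for e
      using V[OF that(1)] that by (auto simp: crossing_def S_def)
    then show ?thesis by (force simp: crossing_def)
  qed
  have "D \<in> (\<lambda>A. crossing a b F A) ` Pow S" if "D \<subseteq> F" for D
  proof -
    have "finite D" using that assms(2) finite_subset by blast
    then have "\<exists>A\<subseteq>S. crossing a b F A = D" using that
    proof (induction D)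
      case empty
      show ?case by (rule exI[of _ "{}"]) (auto simp: crossing_def)
    next
      case (insert e D)
      then obtain A where A: "A \<subseteq> S" "crossing a b F A = D" by auto
      obtain B where B: "crossing a b F B = {e}" using single insert by blast
      have "crossing a b F (sym_diff A (B \<inter> S)) = sym_diff D {e}"
        unfolding crossing_sym_diff cutS A(2) B ..
      also have "\<dots> = insert e D" using insert by auto
      finally show ?case using A(1) by (intro exI[of _ "sym_diff A (B \<inter> S)"]) auto
    qed
    then show ?thesis by auto
  qed
  then have "Pow F \<subseteq> (\<lambda>A. crossing a b F A) ` Pow S" by auto
  then have "card (Pow F) \<le> card (Pow S)"
    using finS by (meson finite_Pow_iff surj_card_le)
  then show ?thesis
    using finS assms(2) unfolding S_def[symmetric] by (simp add: card_Pow)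
qed

text \<open>Handshake lemma; loops are excluded because they cross no singleton cut.\<close>

lemma sum_card_cut_singletons:
  assumes "finite V" "finite F" and V: "\<And>e. e \<in> F \<Longrightarrow> a e \<in> V \<and> b e \<in> V \<and> a e \<noteq> b e"
  shows "(\<Sum>v\<in>V. card (crossing a b F {v})) = 2 * card F"
proof -
  have "(\<Sum>v\<in>V. card (crossing a b F {v})) = (\<Sum>v\<in>V. \<Sum>e\<in>F. if (a e = v) \<noteq> (b e = v) then 1 else 0)"
    using assms(2) by (intro sum.cong refl) (simp add: crossing_def card_filter)
  also have "\<dots> = (\<Sum>e\<in>F. \<Sum>v\<in>V. if (a e = v) \<noteq> (b e = v) then 1 else 0)"
    by (rule sum.swap)
  also have "\<dots> = (\<Sum>e\<in>F. 2)"
  proof (intro sum.cong refl)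
    fix e assume e: "e \<in> F"
    have "(\<Sum>v\<in>V. if (a e = v) \<noteq> (b e = v) then 1 else 0) = card {v\<in>V. (a e = v) \<noteq> (b e = v)}"
      using assms(1) by (simp add: card_filter)
    also have "{v\<in>V. (a e = v) \<noteq> (b e = v)} = {a e, b e}" using V[OF e] by auto
    finally show "(\<Sum>v\<in>V. if (a e = v) \<noteq> (b e = v) then 1 else 0) = (2::nat)" using V[OF e] by simp
  qed
  finally show ?thesis by simp
qed

text \<open>In a pruned forest the active vertices have average degree at most 2. Inactive
  non-isolated vertices have degree at least 2, because an inactive leaf could be pruned, while the
  total degree is \<open>2 * card F\<close>, at most twice the number of non-isolated
  vertices.\<close>

lemma sum_card_cut_active_le:
  fixes R :: "('a \<times> 'a) set"
  defines "act \<equiv> {v. separates R {v}}"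
  assumes "finite V" "finite F" and V: "\<And>e. e \<in> F \<Longrightarrow> a e \<in> V \<and> b e \<in> V"
    and single: "\<And>e. e \<in> F \<Longrightarrow> \<exists>A. separates R A \<and> crossing a b F A = {e}"
    and hits: "\<And>A. separates R A \<Longrightarrow> crossing a b F A \<noteq> {}"
    and act: "act \<subseteq> V"
  shows "(\<Sum>v\<in>act. card (crossing a b F {v})) \<le> 2 * card act"
proof -
  define S where "S = {v \<in> V. crossing a b F {v} \<noteq> {}}"
  have act_S: "act \<subseteq> S" using hits act by (auto simp: S_def act_def)
  have fin: "finite S" using assms(2) by (simp add: S_def)
  have noloop: "a e \<noteq> b e" if e: "e \<in> F" for e
  proof -
    obtain A where "crossing a b F A = {e}" using single[OF e] by blast
    then have "e \<in> crossing a b F A" by simp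
    then show ?thesis by (auto simp: crossing_def)
  qed
  have two: "2 \<le> card (crossing a b F {v})" if v: "v \<in> S - act" for v
  proof (rule ccontr)
    assume "\<not> ?thesis"
    moreover have "card (crossing a b F {v}) \<noteq> 0"
      using v finite_crossing[OF assms(3), of a b "{v}"] by (simp add: S_def)
    ultimately have "card (crossing a b F {v}) = 1" by linarith
    then obtain e where e: "crossing a b F {v} = {e}" by (auto simp: card_1_singleton_iff)
    then have "e \<in> F" using crossing_subset[of a b F "{v}"] by auto
    then obtain A where A: "separates R A" "crossing a b F A = {e}" using single by blast
    \<comment> \<open>Moving the inactive leaf \<open>v\<close> across \<open>A\<close> removes
      \<open>e\<close> from the cut and keeps it separating, since no pair of \<open>R\<close> joins
      \<open>v\<close> to another vertex.\<close>
    have "crossing a b F (sym_diff A {v}) = {}" unfolding crossing_sym_diff e A(2) by auto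
    moreover have "separates R (sym_diff A {v})"
      using A(1) v unfolding act_def separates_def by fastforce
    ultimately show False using hits by blast
  qed
  have "2 * card F = (\<Sum>v\<in>V. card (crossing a b F {v}))"
    using sum_card_cut_singletons[of V F a b] assms(2,3) V noloop by simp
  also have "\<dots> = (\<Sum>v\<in>S. card (crossing a b F {v}))"
    using assms(2) by (intro sum.mono_neutral_right) (auto simp: S_def)
  also have "\<dots> = (\<Sum>v\<in>act. card (crossing a b F {v})) + (\<Sum>v\<in>S - act. card (crossing a b F {v}))"
    using act_S fin by (metis add.commute sum.subset_diff)
  finally have 1: "2 * card F = (\<Sum>v\<in>act. card (crossing a b F {v})) + (\<Sum>v\<in>S - act. card (crossing a b F {v}))" .
  have "(\<Sum>v\<in>S - act. 2) \<le> (\<Sum>v\<in>S - act. card (crossing a b F {v}))"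
    using two by (intro sum_mono) auto
  then have 2: "2 * card (S - act) \<le> (\<Sum>v\<in>S - act. card (crossing a b F {v}))" by simp
  have "card F \<le> card S"
    unfolding S_def using single by (intro card_le_card_nonisolated assms(2,3) V) blast+
  moreover have "card S = card act + card (S - act)"
    using act_S fin by (metis card_Diff_subset card_mono finite_subset le_add_diff_inverse)
  ultimately show ?thesis using 1 2 by linarith
qed

text \<open>The reverse-delete step of the primal-dual method: in an inclusion-minimal hitting set
  each edge has a private separating cut, since otherwise it could be dropped.\<close>

lemma exists_minimal_hitting:
  assumes "finite F" and hits: "\<And>A. separates R A \<Longrightarrow> crossing a b F A \<noteq> {}"
  obtains G where "G \<subseteq> F" "\<And>A. separates R A \<Longrightarrow> crossing a b G A \<noteq> {}"
    "\<And>e. e \<in> G \<Longrightarrow> \<exists>A. separates R A \<and> crossing a b G A = {e}"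
proof -
  define \<F> where "\<F> = {G. G \<subseteq> F \<and> (\<forall>A. separates R A \<longrightarrow> crossing a b G A \<noteq> {})}"
  have "finite \<F>" using assms(1) by (simp add: \<F>_def)
  moreover have "\<F> \<noteq> {}" using hits by (auto simp: \<F>_def)
  ultimately obtain G where G: "G \<in> \<F>" "\<And>G'. G' \<in> \<F> \<Longrightarrow> G' \<subseteq> G \<Longrightarrow> G = G'"
    using finite_has_minimal[of \<F>] by metis
  have "\<exists>A. separates R A \<and> crossing a b G A = {e}" if e: "e \<in> G" for e
  proof -
    have "G - {e} \<notin> \<F>" using G(2)[of "G - {e}"] e by auto
    then obtain A where A: "separates R A" "crossing a b (G - {e}) A = {}"
      using G(1) unfolding \<F>_def by auto
    moreover have "crossing a b G A \<noteq> {}" using G(1) A(1) by (auto simp: \<F>_def)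
    ultimately have "crossing a b G A = {e}" by (auto simp: crossing_def)
    then show ?thesis using A(1) by blast
  qed
  moreover have "G \<subseteq> F" "\<And>A. separates R A \<Longrightarrow> crossing a b G A \<noteq> {}"
    using G(1) by (auto simp: \<F>_def)
  ultimately show ?thesis using that[of G] by blast
qed

text \<open>Induction on the number of vertices. All active vertices, those whose singleton
  separates a pair, raise their dual variables at the same rate until an edge becomes tight; this
  edge is contracted, and the solution for the residual weights is extended by it and pruned. For
  this phase the solution pays at most \<open>2 * \<delta> * card act\<close> by the degree bound,
  and the total weight of \<open>E\<close> drops by at least \<open>\<delta> * k * card act\<close>,
  which gives the ratio \<open>2 / k\<close>.\<close>

lemma steiner_forest:
  fixes a b :: "'e \<Rightarrow> 'a" and k :: real and w :: "'e \<Rightarrow> real"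
  assumes "finite V" "finite E" and "\<And>e. e \<in> E \<Longrightarrow> a e \<in> V \<and> b e \<in> V"
    and "R \<subseteq> V \<times> V" and "k > 0"
    and "\<And>A. separates R A \<Longrightarrow> k \<le> card (crossing a b E A)"
    and "\<And>e. e \<in> E \<Longrightarrow> 0 \<le> w e"
  shows "\<exists>F\<subseteq>E. (\<forall>A. separates R A \<longrightarrow> crossing a b F A \<noteq> {}) \<and> card F \<le> card V \<and>
           sum w F \<le> 2 / k * sum w E"
  using assms
proof (induction "card V" arbitrary: V a b R w rule: less_induct)
  case less
  note finV = less.prems(1) and finE = less.prems(2) and ends = less.prems(3)
    and R = less.prems(4) and heavy = less.prems(6) and w = less.prems(7)
  define act where "act = {v. separates R {v}}"
  have actV: "act \<subseteq> V" using R by (auto simp: act_def separates_def)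
  have finact: "finite act" using actV finV finite_subset by blast
  show ?case
  proof (cases "act = {}")
    case True
    have "\<not> separates R A" for A
    proof
      assume "separates R A"
      then obtain u v where "(u, v) \<in> R" "u \<noteq> v" by (auto simp: separates_def)
      then have "u \<in> act" by (auto simp: act_def separates_def intro!: bexI[of _ "(u, v)"])
      with True show False by simp
    qed
    moreover have "0 \<le> sum w E" using w by (rule sum_nonneg)
    ultimately show ?thesis using \<open>k > 0\<close> by (intro exI[of _ "{}"]) auto
  next
    case False
    \<comment> \<open>The rate at which the weight of an edge of \<open>E\<close> is used up: the
      number of its ends that are active, or 0 for a loop.\<close>
    define N where "N e = real (card {v\<in>act. e \<in> crossing a b E {v}})" for e
    define C where "C = {e\<in>E. N e > 0}"
    have cut_C: "crossing a b E {v} \<subseteq> C" if "v \<in> act" for v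
      using that finact by (auto simp: C_def N_def crossing_def card_gt_0_iff)
    obtain v where "v \<in> act" using False by blast
    then have "card (crossing a b E {v}) > 0"
      using heavy[of "{v}"] \<open>k > 0\<close> by (auto simp: act_def intro!: Nat.gr0I)
    then have "C \<noteq> {}" using cut_C[OF \<open>v \<in> act\<close>] by auto
    moreover have finC: "finite C" using finE by (simp add: C_def)
    \<comment> \<open>The least ratio identifies the first edge to become tight, so that the
      residual weights \<open>w'\<close> stay nonnegative and vanish on \<open>e0\<close>.\<close>
    ultimately obtain e0 where e0: "e0 \<in> C" "\<And>e. e \<in> C \<Longrightarrow> w e0 / N e0 \<le> w e / N e"
      using arg_min_if_finite(1)[of C "\<lambda>e. w e / N e"] arg_min_least[of C _ "\<lambda>e. w e / N e"] by blast
    define \<delta> where "\<delta> = w e0 / N e0"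
    define w' where "w' e = w e - \<delta> * N e" for e
    have N0: "N e \<ge> 0" for e by (simp add: N_def)
    have \<delta>0: "\<delta> \<ge> 0" using w e0(1) by (simp add: \<delta>_def C_def)
    have w'0: "0 \<le> w' e" if "e \<in> E" for e
    proof (cases "N e > 0")
      case True
      then have "\<delta> \<le> w e / N e" using e0(2)[of e] that unfolding \<delta>_def C_def by auto
      then show ?thesis using True by (simp add: w'_def field_simps)
    next
      case False
      then have "N e = 0" using N0[of e] by linarith
      then show ?thesis using w[OF that] by (simp add: w'_def)
    qed
    have w'e0: "w' e0 = 0" using e0(1) by (simp add: w'_def \<delta>_def C_def)
    have e0E: "e0 \<in> E" using e0(1) by (simp add: C_def)
    define x where "x = a e0"
    define y where "y = b e0"
    have "{v\<in>act. e0 \<in> crossing a b E {v}} \<noteq> {}"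
      using e0(1) unfolding C_def N_def by (metis (mono_tags, lifting) card.empty less_irrefl mem_Collect_eq of_nat_0)
    then have xy: "x \<noteq> y" by (auto simp: crossing_def x_def y_def)
    have xyV: "x \<in> V" "y \<in> V" using ends[OF e0E] by (auto simp: x_def y_def)
    \<comment> \<open>Contraction of \<open>e0\<close> sends its end \<open>y\<close> to
      \<open>x\<close>. Cuts of the contracted graph correspond to preimages under
      \<open>\<phi>\<close> and so inherit the bound \<open>k\<close>.\<close>
    define \<phi> where "\<phi> v = (if v = y then x else v)" for v
    have \<phi>V: "\<phi> v \<in> V - {y}" if "v \<in> V" for v
      using that xyV xy by (simp add: \<phi>_def)
    define R' where "R' = map_prod \<phi> \<phi> ` R"
    have card': "card (V - {y}) < card V" using xyV finV by (meson card_Diff1_less)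
    have sep': "separates R' A \<longleftrightarrow> separates R (\<phi> -` A)" for A
      by (simp add: R'_def separates_def case_prod_beta)
    have crossing': "crossing (\<phi> \<circ> a) (\<phi> \<circ> b) F A = crossing a b F (\<phi> -` A)" for F A
      by (auto simp: crossing_def)
    have "\<exists>F\<subseteq>E. (\<forall>A. separates R' A \<longrightarrow> crossing (\<phi> \<circ> a) (\<phi> \<circ> b) F A \<noteq> {}) \<and> card F \<le> card (V - {y}) \<and>
           sum w' F \<le> 2 / k * sum w' E"
    proof (rule less.hyps[OF card'])
      show "finite (V - {y})" "finite E" "k > 0" using finV finE \<open>k > 0\<close> by auto
      show "(\<phi> \<circ> a) e \<in> V - {y} \<and> (\<phi> \<circ> b) e \<in> V - {y}" if "e \<in> E" for e
        using ends[OF that] \<phi>V by simp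
      show "R' \<subseteq> (V - {y}) \<times> (V - {y})"
        unfolding R'_def using R \<phi>V by (force simp: map_prod_def)
      show "k \<le> card (crossing (\<phi> \<circ> a) (\<phi> \<circ> b) E A)" if "separates R' A" for A
        using heavy[of "\<phi> -` A"] that by (simp only: sep' crossing')
      show "0 \<le> w' e" if "e \<in> E" for e using w'0[OF that] .
    qed
    then obtain F' where F': "F' \<subseteq> E"
      "\<forall>A. separates R (\<phi> -` A) \<longrightarrow> crossing a b F' (\<phi> -` A) \<noteq> {}"
      "sum w' F' \<le> 2 / k * sum w' E"
      unfolding sep' crossing' by (elim exE conjE)
    define F where "F = insert e0 F'"
    have finF: "finite F" using F'(1) finE by (auto simp: F_def intro: finite_subset)
    \<comment> \<open>A cut that splits \<open>x\<close> from \<open>y\<close> is hit by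
      \<open>e0\<close>; any other is its own preimage under \<open>\<phi>\<close> and is hit by
      \<open>F'\<close>.\<close>
    have hitsF: "crossing a b F A \<noteq> {}" if "separates R A" for A
    proof (cases "(x \<in> A) = (y \<in> A)")
      case True
      then have "\<phi> -` A = A" by (auto simp: \<phi>_def split: if_splits)
      then have "crossing a b F' A \<noteq> {}" using F'(2)[rule_format, of A] that by simp
      then show ?thesis by (auto simp: crossing_def F_def)
    next
      case False
      then show ?thesis by (auto simp: crossing_def F_def x_def y_def)
    qed
    obtain G where G: "G \<subseteq> F" "\<And>A. separates R A \<Longrightarrow> crossing a b G A \<noteq> {}"
      "\<And>e. e \<in> G \<Longrightarrow> \<exists>A. separates R A \<and> crossing a b G A = {e}"
      using exists_minimal_hitting[OF finF hitsF] by blast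
    have GE: "G \<subseteq> E" using G(1) F'(1) e0E by (auto simp: F_def)
    have finG: "finite G" using GE finE finite_subset by blast
    have cardG: "card G \<le> card V"
    proof -
      have "card G \<le> card {v \<in> V. crossing a b G {v} \<noteq> {}}"
        using G(3) GE ends by (intro card_le_card_nonisolated finV finG) blast+
      also have "\<dots> \<le> card V" using finV by (intro card_mono) auto
      finally show ?thesis .
    qed
    have sumN: "(\<Sum>e\<in>H. N e) = (\<Sum>v\<in>act. real (card (crossing a b H {v})))" if "H \<subseteq> E" for H
    proof -
      have finH: "finite H" using that finE finite_subset by blast
      have "(\<Sum>e\<in>H. N e) = (\<Sum>e\<in>H. \<Sum>v\<in>act. if e \<in> crossing a b E {v} then 1 else 0)"
        using finact by (simp add: N_def of_nat_card_filter)
      also have "\<dots> = (\<Sum>v\<in>act. \<Sum>e\<in>H. if e \<in> crossing a b E {v} then 1 else 0)"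
        by (rule sum.swap)
      also have "\<dots> = (\<Sum>v\<in>act. real (card {e\<in>H. e \<in> crossing a b E {v}}))"
        using finH by (simp add: of_nat_card_filter)
      also have "\<dots> = (\<Sum>v\<in>act. real (card (crossing a b H {v})))"
        using that by (intro sum.cong refl arg_cong[where f = "\<lambda>x. real (card x)"]) (auto simp: crossing_def)
      finally show ?thesis .
    qed
    have sumw: "sum w H = sum w' H + \<delta> * (\<Sum>v\<in>act. real (card (crossing a b H {v})))" if "H \<subseteq> E" for H
      using sumN[OF that] by (simp add: w'_def sum_subtractf flip: sum_distrib_left)
    have "sum w' G \<le> sum w' F"
      using G(1) finF F'(1) e0E w'0 by (intro sum_mono2) (auto simp: F_def)
    \<comment> \<open>The edge \<open>e0\<close> is tight, so adding it back costs nothing in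
      residual weight.\<close>
    also have "\<dots> \<le> sum w' F'"
      unfolding F_def using finE F'(1) w'e0 by (cases "e0 \<in> F'") (auto simp: insert_absorb finite_subset)
    finally have 1: "sum w' G \<le> 2 / k * sum w' E" using F'(3) by linarith
    have "(\<Sum>v\<in>act. card (crossing a b G {v})) \<le> 2 * card act"
      unfolding act_def
    proof (rule sum_card_cut_active_le[OF finV finG])
      show "{v. separates R {v}} \<subseteq> V" using actV act_def by simp
      show "a e \<in> V \<and> b e \<in> V" if "e \<in> G" for e using ends that GE by blast
    qed (fact G)+
    then have "real (\<Sum>v\<in>act. card (crossing a b G {v})) \<le> real (2 * card act)"
      by (rule of_nat_mono)
    then have 2: "(\<Sum>v\<in>act. real (card (crossing a b G {v}))) \<le> 2 * real (card act)"
      by simp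
    have "(\<Sum>v\<in>act. k) \<le> (\<Sum>v\<in>act. real (card (crossing a b E {v})))"
      using heavy by (intro sum_mono) (auto simp: act_def)
    then have 3: "card act * k \<le> (\<Sum>v\<in>act. real (card (crossing a b E {v})))" by simp
    have "sum w G \<le> 2 / k * sum w' E + \<delta> * (2 * real (card act))"
      using sumw[OF GE] 1 mult_left_mono[OF 2 \<delta>0] by linarith
    also have "\<dots> = 2 / k * (sum w' E + \<delta> * (card act * k))"
      using \<open>k > 0\<close> by (simp add: field_simps)
    also have "\<dots> \<le> 2 / k * sum w E"
      using sumw[of E] mult_left_mono[OF 3 \<delta>0] \<open>k > 0\<close> by (intro mult_left_mono) auto
    finally have "sum w G \<le> 2 / k * sum w E" .
    then show ?thesis using GE G(2) cardG by blast
  qed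
qed

section \<open>Counting cuts by their traces on an edge set, and the resulting union bound\<close>

section \<open>Counting cut projections\<close>

definition cut_edges :: "'v set set \<Rightarrow> 'v set \<Rightarrow> 'v set set" where
  "cut_edges Z A = {e \<in> Z. e \<inter> A \<noteq> {} \<and> e - A \<noteq> {}}"

lemma finite_cut_edges: "finite Z \<Longrightarrow> finite (cut_edges Z A)"
  by (auto simp: cut_edges_def)

lemma cut_edges_Un: "cut_edges (Y \<union> Z) A = cut_edges Y A \<union> cut_edges Z A"
  by (auto simp: cut_edges_def)

lemma cut_edges_mono: "Y \<subseteq> Z \<Longrightarrow> cut_edges Y A \<subseteq> cut_edges Z A"
  by (auto simp: cut_edges_def)

lemma sum_powers_Pow:
  fixes q :: real
  assumes "finite F"
  shows "(\<Sum>D\<in>Pow F. q ^ card D) = (1 + q) ^ card F"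
  using assms
proof (induction F)
  case (insert x F)
  have fin: "finite D" if "D \<subseteq> F" for D using that insert(1) finite_subset by blast
  have "(\<Sum>D\<in>Pow (insert x F). q ^ card D) =
      (\<Sum>D\<in>Pow F. q ^ card D) + (\<Sum>D\<in>insert x ` Pow F. q ^ card D)"
    unfolding Pow_insert using insert by (intro sum.union_disjoint) auto
  also have "(\<Sum>D\<in>insert x ` Pow F. q ^ card D) = (\<Sum>D\<in>Pow F. q * q ^ card D)"
  proof (subst sum.reindex)
    show "inj_on (insert x) (Pow F)" using insert(2) by (auto simp: inj_on_def) 
    show "sum ((\<lambda>D. q ^ card D) \<circ> insert x) (Pow F) = (\<Sum>D\<in>Pow F. q * q ^ card D)"
    proof (intro sum.cong refl)
      fix D assume "D \<in> Pow F"
      then have "finite D" "x \<notin> D" using insert(2) fin by auto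
      then show "((\<lambda>D. q ^ card D) \<circ> insert x) D = q * q ^ card D" by simp
    qed
  qed
  also have "\<dots> = q * (1 + q) ^ card F" using insert.IH by (simp flip: sum_distrib_left)
  finally show ?case using insert by (simp add: algebra_simps)
qed simp

text \<open>Each trace on \<open>Y\<close> is represented by one small cut, and the hitting set
  \<open>F\<close> is built for the weight that counts the representatives through an edge. The
  traces on \<open>F\<close> are then distinct and have at most \<open>2 * \<alpha>\<close> edges on
  average. Giving a trace with \<open>x\<close> edges the value \<open>n\<close> to the power
  \<open>-x\<close> bounds the sum over all traces by \<open>(1 + 1 / n) ^ n\<close>, at most
  \<open>exp 1\<close>, while by convexity an average trace contributes at least \<open>n\<close> to
  the power \<open>-2 * \<alpha>\<close>.\<close>

theorem card_cut_projections_le: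
  fixes V :: "'v set" and k \<alpha> :: real
  assumes "finite V" "V \<noteq> {}" and X: "\<And>e. e \<in> X \<Longrightarrow> e \<subseteq> V \<and> card e = 2" and "Y \<subseteq> X"
    and "k > 0" and heavy: "\<And>A. cut_edges Y A \<noteq> {} \<Longrightarrow> k \<le> card (cut_edges X A)"
  shows "real (card {P. \<exists>A. P = cut_edges Y A \<and> real (card (cut_edges X A)) \<le> \<alpha> * k}) \<le>
           exp 1 * real (card V) powr (2 * \<alpha>)"
proof -
  define n where "n = real (card V)"
  have n1: "n \<ge> 1" using assms(1,2) by (simp add: n_def Suc_leI card_gt_0_iff)
  have "X \<subseteq> Pow V" using X by auto
  then have finX: "finite X" using assms(1) finite_subset by blast
  then have finY: "finite Y" using \<open>Y \<subseteq> X\<close> finite_subset by blast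
  \<comment> \<open>An arbitrary orientation supplies the endpoint maps that
    \<open>steiner_forest\<close> works with.\<close>
  have "\<exists>f. \<forall>e\<in>X. e = {fst (f e), snd (f e)}"
  proof (intro bchoice ballI)
    fix e assume "e \<in> X"
    then show "\<exists>p. e = {fst p, snd p}" using X[of e] by (auto simp: card_2_iff)
  qed
  then obtain f where f: "\<And>e. e \<in> X \<Longrightarrow> e = {fst (f e), snd (f e)}" by blast
  define a where "a e = fst (f e)" for e
  define b where "b e = snd (f e)" for e
  have mem: "e \<inter> A \<noteq> {} \<and> e - A \<noteq> {} \<longleftrightarrow> (a e \<in> A) \<noteq> (b e \<in> A)" if "e \<in> X" for e A
  proof -
    have "e = {a e, b e}" using f[OF that] by (simp add: a_def b_def)
    then show ?thesis by (metis Diff_iff Int_iff ex_in_conv insert_iff)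
  qed
  have cut_edges: "cut_edges Z A = crossing a b Z A" if "Z \<subseteq> X" for Z A
    unfolding cut_edges_def crossing_def using mem that by blast
  \<comment> \<open>With the edges of \<open>Y\<close> as demand pairs, a set separates exactly if
    it cuts an edge of \<open>Y\<close>.\<close>
  define R where "R = (\<lambda>e. (a e, b e)) ` Y"
  have sep: "separates R A \<longleftrightarrow> crossing a b Y A \<noteq> {}" for A
    by (auto simp: R_def separates_def crossing_def)
  have endsV: "a e \<in> V \<and> b e \<in> V" if "e \<in> X" for e
    using X[OF that] f[OF that] unfolding a_def b_def by (metis insert_subset)
  define \<P> where "\<P> = {P. \<exists>A. P = cut_edges Y A \<and> real (card (cut_edges X A)) \<le> \<alpha> * k}"
  have "\<P> \<subseteq> Pow Y" by (auto simp: \<P>_def cut_edges_def)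
  then have finP: "finite \<P>" using finY finite_subset by blast
  have "\<exists>C. \<forall>P\<in>\<P>. P = cut_edges Y (C P) \<and> real (card (cut_edges X (C P))) \<le> \<alpha> * k"
    by (intro bchoice) (auto simp: \<P>_def)
  then obtain C where C: "\<And>P. P \<in> \<P> \<Longrightarrow> cut_edges Y (C P) = P"
    "\<And>P. P \<in> \<P> \<Longrightarrow> real (card (cut_edges X (C P))) \<le> \<alpha> * k" by metis
  define w where "w e = real (card {P\<in>\<P>. e \<in> cut_edges X (C P)})" for e
  have "\<exists>F\<subseteq>X. (\<forall>A. separates R A \<longrightarrow> crossing a b F A \<noteq> {}) \<and> card F \<le> card V \<and>
           sum w F \<le> 2 / k * sum w X"
  proof (rule steiner_forest)
    show "R \<subseteq> V \<times> V" using endsV \<open>Y \<subseteq> X\<close> by (auto simp: R_def)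
    show "k \<le> card (crossing a b X A)" if "separates R A" for A
      using that heavy[of A] unfolding sep by (simp add: cut_edges \<open>Y \<subseteq> X\<close>)
  qed (use endsV \<open>k > 0\<close> finX assms(1) in \<open>auto simp: w_def\<close>)
  then obtain F where F: "F \<subseteq> X" "\<And>A. separates R A \<Longrightarrow> crossing a b F A \<noteq> {}"
    "card F \<le> card V" "sum w F \<le> 2 / k * sum w X" by blast
  have finF: "finite F" using F(1) finX finite_subset by blast
  define x where "x P = card (cut_edges F (C P))" for P
  have sumw: "sum w H = (\<Sum>P\<in>\<P>. real (card (cut_edges H (C P))))" if "H \<subseteq> X" for H
  proof -
    have finH: "finite H" using that finX finite_subset by blast
    have "sum w H = (\<Sum>e\<in>H. \<Sum>P\<in>\<P>. if e \<in> cut_edges X (C P) then 1 else 0)"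
      unfolding w_def using finP by (simp add: of_nat_card_filter)
    also have "\<dots> = (\<Sum>P\<in>\<P>. \<Sum>e\<in>H. if e \<in> cut_edges X (C P) then 1 else 0)"
      by (rule sum.swap)
    also have "\<dots> = (\<Sum>P\<in>\<P>. real (card {e\<in>H. e \<in> cut_edges X (C P)}))"
      using finH by (simp add: of_nat_card_filter)
    also have "\<dots> = (\<Sum>P\<in>\<P>. real (card (cut_edges H (C P))))"
      using that by (intro sum.cong refl arg_cong[where f = "\<lambda>x. real (card x)"]) (auto simp: cut_edges_def)
    finally show ?thesis .
  qed
  define N where "N = real (card \<P>)"
  have "sum w X \<le> (\<Sum>P\<in>\<P>. \<alpha> * k)"
    unfolding sumw[OF order_refl] using C(2) by (rule sum_mono)
  then have "2 / k * sum w X \<le> 2 / k * (N * (\<alpha> * k))"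
    using \<open>k > 0\<close> by (intro mult_left_mono) (auto simp: N_def)
  then have "(\<Sum>P\<in>\<P>. real (x P)) \<le> 2 / k * (N * (\<alpha> * k))"
    using F(4) sumw[OF F(1)] by (simp add: x_def)
  then have sumx: "(\<Sum>P\<in>\<P>. real (x P)) \<le> 2 * \<alpha> * N"
    using \<open>k > 0\<close> by (simp add: field_simps)
  have inj: "inj_on (\<lambda>P. cut_edges F (C P)) \<P>"
  proof (rule inj_onI)
    \<comment> \<open>By linearity the symmetric difference of the two representatives cuts no edge
      of \<open>F\<close>. As \<open>F\<close> meets every cut that crosses \<open>Y\<close>, it
      cuts no edge of \<open>Y\<close> either.\<close>
    fix P Q assume PQ: "P \<in> \<P>" "Q \<in> \<P>" "cut_edges F (C P) = cut_edges F (C Q)"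
    have "crossing a b F (sym_diff (C P) (C Q)) = {}"
      unfolding crossing_sym_diff using PQ(3) by (simp add: cut_edges[OF F(1)])
    then have "crossing a b Y (sym_diff (C P) (C Q)) = {}" using F(2) sep by blast
    then have "cut_edges Y (C P) = cut_edges Y (C Q)" unfolding crossing_sym_diff cut_edges[OF \<open>Y \<subseteq> X\<close>] by blast
    then show "P = Q" using C(1) PQ by simp
  qed
  have "(\<Sum>P\<in>\<P>. (1 / n) ^ x P) = (\<Sum>D\<in>(\<lambda>P. cut_edges F (C P)) ` \<P>. (1 / n) ^ card D)"
    using inj by (simp add: sum.reindex x_def)
  also have "\<dots> \<le> (\<Sum>D\<in>Pow F. (1 / n) ^ card D)"
    using finF n1 by (intro sum_mono2) (auto simp: cut_edges_def)
  also have "\<dots> = (1 + 1 / n) ^ card F" by (rule sum_powers_Pow[OF finF])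
  also have "\<dots> \<le> (1 + 1 / n) ^ card V"
    using F(3) n1 by (intro power_increasing) auto
  also have "\<dots> \<le> exp (1 / n) ^ card V"
    using n1 by (intro power_mono exp_ge_add_one_self) auto
  also have "\<dots> = exp 1" using n1 by (simp add: n_def flip: exp_of_nat_mult)
  finally have upper: "(\<Sum>P\<in>\<P>. (1 / n) ^ x P) \<le> exp 1" .
  \<comment> \<open>Jensen's inequality for \<open>t \<mapsto> n powr (-t)\<close>, through the tangent at \<open>2 * \<alpha>\<close>\<close>
  have tangent: "n powr (- (2 * \<alpha>)) * (1 - ln n * (real (x P) - 2 * \<alpha>)) \<le> (1 / n) ^ x P" for P
  proof -
    have "(1 / n) ^ x P = n powr (- real (x P))"
      using n1 by (simp add: powr_minus powr_realpow power_one_over inverse_eq_divide)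
    also have "\<dots> = n powr (- (2 * \<alpha>)) * exp (- (ln n * (real (x P) - 2 * \<alpha>)))"
      using n1 by (simp add: powr_def algebra_simps flip: exp_add)
    finally show ?thesis
      using exp_ge_add_one_self[of "- (ln n * (real (x P) - 2 * \<alpha>))"]
      by (simp add: mult_left_mono)
  qed
  \<comment> \<open>Summed over all traces, the linear term of the tangent has a favourable sign,
    because the average of \<open>x\<close> is at most \<open>2 * \<alpha>\<close>.\<close>
  have "n powr (- (2 * \<alpha>)) * N \<le> n powr (- (2 * \<alpha>)) * (N - ln n * ((\<Sum>P\<in>\<P>. real (x P)) - 2 * \<alpha> * N))"
  proof (rule mult_left_mono)
    have "ln n * ((\<Sum>P\<in>\<P>. real (x P)) - 2 * \<alpha> * N) \<le> 0"
      using sumx n1 by (intro mult_nonneg_nonpos) auto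
    then show "N \<le> N - ln n * ((\<Sum>P\<in>\<P>. real (x P)) - 2 * \<alpha> * N)" by linarith
  qed simp
  also have "\<dots> = (\<Sum>P\<in>\<P>. n powr (- (2 * \<alpha>)) * (1 - ln n * (real (x P) - 2 * \<alpha>)))"
    by (simp add: N_def sum_subtractf mult.commute[of _ "2 * \<alpha>"] flip: sum_distrib_left)
  also have "\<dots> \<le> (\<Sum>P\<in>\<P>. (1 / n) ^ x P)" by (intro sum_mono tangent)
  finally have "n powr (- (2 * \<alpha>)) * N \<le> exp 1" using upper by linarith
  then show ?thesis
    using n1 unfolding N_def \<P>_def n_def by (simp add: powr_minus field_simps)
qed

text \<open>The deviation \<open>dev\<close> depends only on the trace on \<open>Y\<close>, so it
  suffices to treat one cut per trace, one with fewest edges in \<open>X\<close>. Traces whose cut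
  has between \<open>j * k\<close> and \<open>(j + 1) * k\<close> edges number at most
  \<open>exp 1 * n ^ (2 * j + 2)\<close> and fail with probability at most
  \<open>2 / n ^ (7 * j)\<close> each; the sum over \<open>j \<ge> 1\<close> is a geometric series
  of order \<open>1 / n ^ 3\<close>. \<open>M\<close> and \<open>dev\<close> are kept abstract to
  serve both sampling steps of the algorithm.\<close>

theorem cut_union_bound:
  fixes V :: "'v set" and k c :: real and M :: "'b pmf" and dev :: "'v set set \<Rightarrow> 'b \<Rightarrow> real"
  assumes "finite V" and n2: "card V \<ge> 2" and X: "\<And>e. e \<in> X \<Longrightarrow> e \<subseteq> V \<and> card e = 2"
    and "Y \<subseteq> X" and "k > 0" and heavy: "\<And>A. cut_edges Y A \<noteq> {} \<Longrightarrow> k \<le> card (cut_edges X A)" and "c \<ge> 0"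
    and tail: "\<And>P s. P \<subseteq> Y \<Longrightarrow> real (card P) \<le> s \<Longrightarrow>
      measure_pmf.prob M {\<omega>. dev P \<omega> > c * s} \<le> 2 * exp (- (7 * ln (card V) / k) * s)"
  shows "measure_pmf.prob M {\<omega>. \<exists>A. cut_edges Y A \<noteq> {} \<and> dev (cut_edges Y A) \<omega> > c * card (cut_edges X A)} \<le>
           8 / real (card V) ^ 3"
proof -
  define n where "n = real (card V)"
  have n2': "n \<ge> 2" using n2 by (simp add: n_def)
  have "X \<subseteq> Pow V" using X by auto
  then have finX: "finite X" using assms(1) finite_subset by blast
  then have finY: "finite Y" using \<open>Y \<subseteq> X\<close> finite_subset by blast
  define \<P> where "\<P> = {P. \<exists>A. P = cut_edges Y A \<and> P \<noteq> {}}"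
  have P_Pow: "\<P> \<subseteq> Pow Y" by (auto simp: \<P>_def cut_edges_def)
  then have finP: "finite \<P>" using finY finite_subset by blast
  have "\<exists>C. \<forall>P\<in>\<P>. cut_edges Y (C P) = P \<and> (\<forall>A. cut_edges Y A = P \<longrightarrow> card (cut_edges X (C P)) \<le> card (cut_edges X A))"
  proof (intro bchoice ballI)
    fix P assume "P \<in> \<P>"
    then obtain A where "cut_edges Y A = P" by (auto simp: \<P>_def)
    then show "\<exists>B. cut_edges Y B = P \<and> (\<forall>A. cut_edges Y A = P \<longrightarrow> card (cut_edges X B) \<le> card (cut_edges X A))"
      using ex_has_least_nat[of "\<lambda>A. cut_edges Y A = P" A "\<lambda>A. card (cut_edges X A)"] by blast
  qed
  then obtain C where C: "\<And>P. P \<in> \<P> \<Longrightarrow> cut_edges Y (C P) = P"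
    "\<And>P A. P \<in> \<P> \<Longrightarrow> cut_edges Y A = P \<Longrightarrow> card (cut_edges X (C P)) \<le> card (cut_edges X A)" by metis
  define s where "s P = real (card (cut_edges X (C P)))" for P
  \<comment> \<open>Rounding down only weakens the tail bound, and \<open>j P\<close> is at least 1
    because a cut crossing \<open>Y\<close> has at least \<open>k\<close> edges.\<close>
  define j where "j P = nat \<lfloor>s P / k\<rfloor>" for P
  have sk: "s P / k \<ge> 1" if "P \<in> \<P>" for P
    using heavy[of "C P"] C(1)[OF that] that \<open>k > 0\<close> by (simp add: s_def \<P>_def)
  have j1: "1 \<le> j P" "real (j P) \<le> s P / k" "s P / k \<le> real (j P) + 1" if "P \<in> \<P>" for P
    using sk[OF that] unfolding j_def by linarith+
  define J where "J = Max (j ` \<P>)"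
  have sub: "{\<omega>. \<exists>A. cut_edges Y A \<noteq> {} \<and> dev (cut_edges Y A) \<omega> > c * card (cut_edges X A)} \<subseteq> (\<Union>P\<in>\<P>. {\<omega>. dev P \<omega> > c * s P})"
  proof
    fix \<omega> assume "\<omega> \<in> {\<omega>. \<exists>A. cut_edges Y A \<noteq> {} \<and> dev (cut_edges Y A) \<omega> > c * card (cut_edges X A)}"
    then obtain A where A: "cut_edges Y A \<noteq> {}" "dev (cut_edges Y A) \<omega> > c * card (cut_edges X A)" by blast
    then have P: "cut_edges Y A \<in> \<P>" by (auto simp: \<P>_def)
    have "c * s (cut_edges Y A) \<le> c * card (cut_edges X A)"
      using C(2)[OF P refl] \<open>c \<ge> 0\<close> by (intro mult_left_mono) (auto simp: s_def)
    then show "\<omega> \<in> (\<Union>P\<in>\<P>. {\<omega>. dev P \<omega> > c * s P})" using A(2) P by force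
  qed
  have "measure_pmf.prob M {\<omega>. \<exists>A. cut_edges Y A \<noteq> {} \<and> dev (cut_edges Y A) \<omega> > c * card (cut_edges X A)} \<le>
      measure_pmf.prob M (\<Union>P\<in>\<P>. {\<omega>. dev P \<omega> > c * s P})"
    using sub by (intro measure_pmf.finite_measure_mono) auto
  also have "\<dots> \<le> (\<Sum>P\<in>\<P>. measure_pmf.prob M {\<omega>. dev P \<omega> > c * s P})"
    by (intro measure_pmf.finite_measure_subadditive_finite finP) auto
  also have "\<dots> \<le> (\<Sum>P\<in>\<P>. 2 * (1 / n ^ 7) ^ j P)"
  proof (intro sum_mono)
    fix P assume P: "P \<in> \<P>"
    have "card P \<le> card (cut_edges X (C P))"
      using finite_cut_edges[OF finX] cut_edges_mono[OF \<open>Y \<subseteq> X\<close>] C(1)[OF P] by (metis card_mono)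
    then have "measure_pmf.prob M {\<omega>. dev P \<omega> > c * s P} \<le> 2 * exp (- (7 * ln n / k) * s P)"
      unfolding n_def using P P_Pow by (intro tail) (auto simp: s_def)
    also have "exp (- (7 * ln n / k) * s P) \<le> exp (- (7 * ln n) * j P)"
    proof -
      have "7 * ln n * j P \<le> 7 * ln n * (s P / k)"
        using j1(2)[OF P] n2' by (intro mult_left_mono) auto
      then show ?thesis by simp
    qed
    also have "\<dots> = (1 / n ^ 7) ^ j P"
    proof -
      have "exp (- (7 * ln n) * j P) = exp (- (7 * ln n)) ^ j P"
        by (metis exp_of_nat2_mult)
      also have "exp (- (7 * ln n)) = 1 / n ^ 7"
        using n2' exp_of_nat_mult[of 7 "ln n"] by (simp add: exp_minus inverse_eq_divide)
      finally show ?thesis .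
    qed
    finally show "measure_pmf.prob M {\<omega>. dev P \<omega> > c * s P} \<le> 2 * (1 / n ^ 7) ^ j P" by simp
  qed
  also have "\<dots> = (\<Sum>i\<in>{1..J}. \<Sum>P\<in>{P\<in>\<P>. j P = i}. 2 * (1 / n ^ 7) ^ j P)"
  proof (rule sum.group[symmetric])
    show "j ` \<P> \<subseteq> {1..J}"
    proof
      fix i assume "i \<in> j ` \<P>"
      then show "i \<in> {1..J}" using j1(1) finP unfolding J_def by (auto intro: Max_ge)
    qed
  qed (use finP in auto)
  also have "\<dots> \<le> (\<Sum>i\<in>{1..J}. 2 * exp 1 * n ^ 2 * (1 / n ^ 5) ^ i)"
  proof (intro sum_mono)
    fix i
    \<comment> \<open>Rounding costs one unit here: class \<open>i\<close> only guarantees size at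
      most \<open>(i + 1) * k\<close>.\<close>
    have sub: "{P\<in>\<P>. j P = i} \<subseteq> {P. \<exists>A. P = cut_edges Y A \<and> real (card (cut_edges X A)) \<le> real (i + 1) * k}"
    proof safe
      fix P assume P: "P \<in> \<P>" "i = j P"
      have "real (card (cut_edges X (C P))) \<le> real (j P + 1) * k"
        using j1(3)[OF P(1)] \<open>k > 0\<close> by (simp add: s_def field_simps)
      then show "\<exists>A. P = cut_edges Y A \<and> real (card (cut_edges X A)) \<le> real (j P + 1) * k"
        using C(1)[OF P(1)] by metis
    qed
    have "finite {P. \<exists>A. P = cut_edges Y A \<and> real (card (cut_edges X A)) \<le> real (i + 1) * k}"
      by (rule finite_subset[of _ "Pow Y"]) (auto simp: cut_edges_def finY)
    from card_mono[OF this sub]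
    have "real (card {P\<in>\<P>. j P = i}) \<le> exp 1 * n powr (2 * real (i + 1))"
      unfolding n_def
      by (rule order_trans[OF of_nat_mono card_cut_projections_le[OF assms(1) _ X \<open>Y \<subseteq> X\<close> \<open>k > 0\<close> heavy]])
         (use n2 in auto)
    also have "n powr (2 * real (i + 1)) = n ^ (2 * i + 2)"
    proof -
      have "2 * real (i + 1) = real (2 * i + 2)" by simp
      then show ?thesis using n2' by (simp only: powr_realpow)
    qed
    finally have card_le: "real (card {P\<in>\<P>. j P = i}) \<le> exp 1 * n ^ (2 * i + 2)" .
    have "(\<Sum>P\<in>{P\<in>\<P>. j P = i}. 2 * (1 / n ^ 7) ^ j P) = real (card {P\<in>\<P>. j P = i}) * (2 * (1 / n ^ 7) ^ i)"
      by simp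
    also have "\<dots> \<le> exp 1 * n ^ (2 * i + 2) * (2 * (1 / n ^ 7) ^ i)"
      using card_le n2' by (intro mult_right_mono) auto
    also have "\<dots> = 2 * exp 1 * n ^ 2 * (n ^ 2 * (1 / n ^ 7)) ^ i"
      by (simp only: power_mult_distrib power_add power_mult) (simp only: mult_ac)
    also have "n ^ 2 * (1 / n ^ 7) = 1 / n ^ 5"
      using n2' by (simp add: field_simps flip: power_add)
    finally show "(\<Sum>P\<in>{P\<in>\<P>. j P = i}. 2 * (1 / n ^ 7) ^ j P) \<le> 2 * exp 1 * n ^ 2 * (1 / n ^ 5) ^ i" .
  qed
  also have "\<dots> = 2 * exp 1 * n ^ 2 * (\<Sum>i\<in>{1..J}. (1 / n ^ 5) ^ i)"
    by (simp add: sum_distrib_left)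
  also have "\<dots> \<le> 2 * 3 * n ^ 2 * (32 / 31 * (1 / n ^ 5))"
  proof -
    define q where "q = 1 / n ^ 5"
    have "2 ^ 5 \<le> n ^ 5" using n2' by (intro power_mono) auto
    then have q: "0 \<le> q" "q \<le> 1 / 32" using n2' by (auto simp: q_def divide_simps)
    \<comment> \<open>As \<open>q\<close> is at most 1/32, \<open>1 / (1 - q)\<close> is at most
      32/31. The factor \<open>1 - q ^ J\<close> makes the induction go through.\<close>
    have "(\<Sum>i\<in>{1..J}. q ^ i) \<le> 32 / 31 * q * (1 - q ^ J)"
    proof (induction J)
      case (Suc J)
      have "q ^ Suc J \<le> 32 / 31 * q * (q ^ J - q ^ Suc J)"
      proof -
        have "q ^ Suc J * (31 / 32) \<le> q ^ Suc J * (1 - q)"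
          using q by (intro mult_left_mono) auto
        then show ?thesis by (simp add: algebra_simps)
      qed
      then show ?case using Suc by (simp add: algebra_simps)
    qed simp
    also have "\<dots> \<le> 32 / 31 * q * 1" using q by (intro mult_left_mono) auto
    finally have "(\<Sum>i\<in>{1..J}. q ^ i) \<le> 32 / 31 * q" by simp
    moreover have "exp 1 \<le> (3::real)" by (rule exp_le)
    ultimately show ?thesis
      unfolding q_def[symmetric] using n2' q
      by (intro mult_mono) (auto intro!: sum_nonneg)
  qed
  also have "\<dots> \<le> 8 / n ^ 3"
    using n2' by (simp add: divide_simps flip: power_add)
  finally show ?thesis by (simp add: n_def)
qed

section \<open>Chernoff bounds for sums of independent variables with a common variance
  proxy\<close>

section \<open>Tail bounds\<close>

text \<open>Taylor's formula with remainder: \<open>exp t\<close> is at most 1.11 for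
  \<open>t \<le> 1 / 10\<close>, and half of 1.12 is the constant 0.56 of the moment bounds
  below.\<close>

lemma exp_le_quadratic:
  fixes x :: real
  assumes "\<bar>x\<bar> \<le> 1 / 10"
  shows "exp x \<le> 1 + x + 0.56 * x\<^sup>2"
proof -
  obtain t where t: "\<bar>t\<bar> \<le> \<bar>x\<bar>" "exp x = (\<Sum>m<2. x ^ m / fact m) + (exp t / fact 2) * x ^ 2"
    using Maclaurin_exp_le[of x 2] by blast
  have "t \<le> 1 / 10" using t(1) assms by linarith
  then have "exp t \<le> exp (1 / 10)" by simp
  also have "exp (1 / 10 :: real) \<le> 1 + 1 / 10 + (1 / 10)\<^sup>2" by (rule exp_bound) auto
  finally have "exp t * x\<^sup>2 \<le> 1.12 * x\<^sup>2" by (intro mult_right_mono) (auto simp: power2_eq_square)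
  then show ?thesis using t(2) by (simp add: numeral_2_eq_2)
qed

text \<open>Chernoff's method. The number \<open>v\<close> is a variance proxy per coordinate, and
  \<open>l = d / 1.12\<close> minimises \<open>0.56 * v * l^2 - l * d * v\<close>, with minimum
  \<open>- d^2 * v / 2.24\<close>; \<open>d \<le> 0.112\<close> means \<open>l \<le> 1 / 10\<close>,
  the range of the moment bounds. Since \<open>s\<close> may exceed \<open>card Q\<close>,
  deviations can be measured against a larger cut.\<close>

lemma Pi_pmf_upper_tail:
  fixes \<xi> :: "'a \<Rightarrow> 'b \<Rightarrow> real" and p :: "'a \<Rightarrow> 'b pmf"
  assumes "finite A" "Q \<subseteq> A" and fin: "\<And>x. x \<in> Q \<Longrightarrow> finite (set_pmf (p x))"
    and d: "0 \<le> v" "0 < d" "d \<le> 0.112" and s: "real (card Q) \<le> s"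
    and mgf: "\<And>x. x \<in> Q \<Longrightarrow>
      measure_pmf.expectation (p x) (\<lambda>y. exp (d / 1.12 * \<xi> x y)) \<le> exp (0.56 * v * (d / 1.12)\<^sup>2)"
  shows "measure_pmf.prob (Pi_pmf A dflt p) {\<omega>. (\<Sum>x\<in>Q. \<xi> x (\<omega> x)) > d * v * s} \<le> exp (- (d\<^sup>2 * v / 2.24) * s)"
proof -
  define l where "l = d / 1.12"
  have l: "l > 0" using d by (simp add: l_def)
  have finQ: "finite Q" using assms(1,2) finite_subset by blast
  \<comment> \<open>Coordinates outside \<open>Q\<close> get the factor 1, so that the expectation
    factorises over all of \<open>A\<close>.\<close>
  define g where "g x y = (if x \<in> Q then exp (l * \<xi> x y) else 1)" for x y
  have g: "exp (l * (\<Sum>x\<in>Q. \<xi> x (\<omega> x))) = (\<Prod>x\<in>A. g x (\<omega> x))" for \<omega>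
  proof -
    have "exp (l * (\<Sum>x\<in>Q. \<xi> x (\<omega> x))) = (\<Prod>x\<in>Q. exp (l * \<xi> x (\<omega> x)))"
      using finQ by (simp add: sum_distrib_left exp_sum)
    also have "\<dots> = (\<Prod>x\<in>A. g x (\<omega> x))"
      using assms(1,2) by (intro prod.mono_neutral_cong_left) (auto simp: g_def)
    finally show ?thesis .
  qed
  have int: "integrable (measure_pmf (p x)) (g x)" if "x \<in> A" for x
  proof (cases "x \<in> Q")
    case True
    then show ?thesis using fin by (intro integrable_measure_pmf_finite)
  qed (simp add: g_def[abs_def])
  have intP: "integrable (measure_pmf (Pi_pmf A dflt p)) (\<lambda>\<omega>. exp (l * (\<Sum>x\<in>Q. \<xi> x (\<omega> x))))"
    unfolding g using int by (intro integrable_prod_Pi_pmf assms(1))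
  have "measure_pmf.expectation (Pi_pmf A dflt p) (\<lambda>\<omega>. exp (l * (\<Sum>x\<in>Q. \<xi> x (\<omega> x)))) =
      (\<Prod>x\<in>A. measure_pmf.expectation (p x) (g x))"
    unfolding g by (rule expectation_prod_Pi_pmf[OF assms(1) int]) (auto simp: g_def)
  also have "\<dots> = (\<Prod>x\<in>Q. measure_pmf.expectation (p x) (\<lambda>y. exp (l * \<xi> x y)))"
    using assms(1,2) by (intro prod.mono_neutral_cong_right) (auto simp: g_def[abs_def])
  also have "\<dots> \<le> (\<Prod>x\<in>Q. exp (0.56 * v * l\<^sup>2))"
    using mgf by (intro prod_mono conjI integral_nonneg_AE) (auto simp: l_def)
  also have "\<dots> = exp (0.56 * v * l\<^sup>2 * card Q)"
    by (simp flip: exp_of_nat2_mult)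
  also have "\<dots> \<le> exp (0.56 * v * l\<^sup>2 * s)"
    using s d by (simp only: exp_le_cancel_iff) (intro mult_left_mono, auto)
  finally have E: "measure_pmf.expectation (Pi_pmf A dflt p) (\<lambda>\<omega>. exp (l * (\<Sum>x\<in>Q. \<xi> x (\<omega> x)))) \<le> exp (0.56 * v * l\<^sup>2 * s)" .
  have "measure_pmf.prob (Pi_pmf A dflt p) {\<omega>. (\<Sum>x\<in>Q. \<xi> x (\<omega> x)) > d * v * s} \<le>
      measure_pmf.prob (Pi_pmf A dflt p) {\<omega> \<in> UNIV. (\<Sum>x\<in>Q. \<xi> x (\<omega> x)) \<ge> d * v * s}"
    by (intro measure_pmf.finite_measure_mono) auto
  also have "\<dots> \<le> exp (- l * (d * v * s)) * (\<integral>\<omega>\<in>UNIV. exp (l * (\<Sum>x\<in>Q. \<xi> x (\<omega> x))) \<partial>measure_pmf (Pi_pmf A dflt p))"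
    using intP l by (intro measure_pmf.Chernoff_ineq_ge) (auto simp: set_integrable_def)
  also have "\<dots> = exp (- l * (d * v * s)) * measure_pmf.expectation (Pi_pmf A dflt p) (\<lambda>\<omega>. exp (l * (\<Sum>x\<in>Q. \<xi> x (\<omega> x))))"
    by (simp add: set_lebesgue_integral_def)
  also have "\<dots> \<le> exp (- l * (d * v * s)) * exp (0.56 * v * l\<^sup>2 * s)"
    by (intro mult_left_mono E) auto
  also have "\<dots> = exp (- (d\<^sup>2 * v / 2.24) * s)"
    by (simp add: l_def power2_eq_square field_simps flip: exp_add)
  finally show ?thesis .
qed

lemma Pi_pmf_two_sided_tail:
  fixes \<xi> :: "'a \<Rightarrow> 'b \<Rightarrow> real" and p :: "'a \<Rightarrow> 'b pmf"
  assumes "finite A" "Q \<subseteq> A" and fin: "\<And>x. x \<in> Q \<Longrightarrow> finite (set_pmf (p x))"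
    and d: "0 \<le> v" "0 < d" "d \<le> 0.112" and s: "real (card Q) \<le> s"
    and mgf: "\<And>x l. x \<in> Q \<Longrightarrow> \<bar>l\<bar> \<le> 1 / 10 \<Longrightarrow>
      measure_pmf.expectation (p x) (\<lambda>y. exp (l * \<xi> x y)) \<le> exp (0.56 * v * l\<^sup>2)"
  shows "measure_pmf.prob (Pi_pmf A dflt p) {\<omega>. \<bar>\<Sum>x\<in>Q. \<xi> x (\<omega> x)\<bar> > d * v * s} \<le> 2 * exp (- (d\<^sup>2 * v / 2.24) * s)"
proof -
  let ?M = "Pi_pmf A dflt p"
  have up: "measure_pmf.prob ?M {\<omega>. (\<Sum>x\<in>Q. \<xi> x (\<omega> x)) > d * v * s} \<le> exp (- (d\<^sup>2 * v / 2.24) * s)"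
    using d mgf by (intro Pi_pmf_upper_tail assms) auto
  have lo: "measure_pmf.prob ?M {\<omega>. (\<Sum>x\<in>Q. - \<xi> x (\<omega> x)) > d * v * s} \<le> exp (- (d\<^sup>2 * v / 2.24) * s)"
    using d mgf[where l = "- (d / 1.12)"] by (intro Pi_pmf_upper_tail assms) auto
  have "measure_pmf.prob ?M {\<omega>. \<bar>\<Sum>x\<in>Q. \<xi> x (\<omega> x)\<bar> > d * v * s} \<le>
     measure_pmf.prob ?M ({\<omega>. (\<Sum>x\<in>Q. \<xi> x (\<omega> x)) > d * v * s} \<union> {\<omega>. (\<Sum>x\<in>Q. - \<xi> x (\<omega> x)) > d * v * s})"
    by (intro measure_pmf.finite_measure_mono) (auto simp: sum_negf)
  also have "\<dots> \<le> measure_pmf.prob ?M {\<omega>. (\<Sum>x\<in>Q. \<xi> x (\<omega> x)) > d * v * s} +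
      measure_pmf.prob ?M {\<omega>. (\<Sum>x\<in>Q. - \<xi> x (\<omega> x)) > d * v * s}"
    by (rule measure_Un_le) auto
  finally show ?thesis using up lo by linarith
qed

text \<open>The linear terms of the two exponentials cancel. The factor 1 is the variance proxy
  \<open>v\<close> in the tail bound.\<close>

lemma mgf_fair_sign:
  fixes l :: real
  assumes "\<bar>l\<bar> \<le> 1 / 10"
  shows "measure_pmf.expectation (bernoulli_pmf (1/2)) (\<lambda>b. exp (l * (2 * of_bool b - 1))) \<le> exp (0.56 * 1 * l\<^sup>2)"
proof -
  have "measure_pmf.expectation (bernoulli_pmf (1/2)) (\<lambda>b. exp (l * (2 * of_bool b - 1))) = (exp l + exp (- l)) / 2"
    by (subst integral_bernoulli_pmf) auto
  also have "\<dots> \<le> 1 + 0.56 * l\<^sup>2"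
    using exp_le_quadratic[of l] exp_le_quadratic[of "-l"] assms by simp
  also have "\<dots> \<le> exp (0.56 * l\<^sup>2)" by (rule exp_ge_add_one_self)
  finally show ?thesis by simp
qed

text \<open>The binomial theorem gives \<open>(1 + p * (exp l - 1)) ^ N\<close>; the centring
  removes the linear term and leaves the variance proxy \<open>v = p * N\<close>.\<close>

lemma mgf_centered_binomial:
  fixes l p :: real
  assumes "\<bar>l\<bar> \<le> 1 / 10" "0 \<le> p" "p \<le> 1"
  shows "measure_pmf.expectation (binomial_pmf N p) (\<lambda>r. exp (l * (real r - p * N))) \<le> exp (0.56 * (p * N) * l\<^sup>2)"
proof -
  have "measure_pmf.expectation (binomial_pmf N p) (\<lambda>r. exp (l * (real r - p * N))) =
     (\<Sum>k\<le>N. real (N choose k) * p ^ k * (1 - p) ^ (N - k) * exp (l * (real k - p * N)))"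
    using assms by (subst expectation_binomial_pmf') auto
  also have "\<dots> = (\<Sum>k\<le>N. real (N choose k) * (p * exp l) ^ k * (1 - p) ^ (N - k)) * exp (- l * p * N)"
    unfolding sum_distrib_right
    by (intro sum.cong refl)
       (simp add: power_mult_distrib right_diff_distrib exp_diff exp_minus mult_ac divide_inverse flip: exp_of_nat2_mult)
  also have "(\<Sum>k\<le>N. real (N choose k) * (p * exp l) ^ k * (1 - p) ^ (N - k)) = (p * exp l + (1 - p)) ^ N"
    by (rule binomial_ring[symmetric])
  also have "p * exp l + (1 - p) = 1 + p * (exp l - 1)" by (simp add: algebra_simps)
  also have "(1 + p * (exp l - 1)) ^ N \<le> exp (p * (l + 0.56 * l\<^sup>2)) ^ N"
  proof (rule power_mono)
    have "p * (exp l - 1) \<le> p * (l + 0.56 * l\<^sup>2)"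
      using exp_le_quadratic[OF assms(1)] assms(2) by (intro mult_left_mono) auto
    then show "1 + p * (exp l - 1) \<le> exp (p * (l + 0.56 * l\<^sup>2))"
      using exp_ge_add_one_self[of "p * (l + 0.56 * l\<^sup>2)"] by linarith
    have "0 \<le> (1 - p) + p * exp l" using assms by simp
    then show "0 \<le> 1 + p * (exp l - 1)" by (simp add: algebra_simps)
  qed
  also have "exp (p * (l + 0.56 * l\<^sup>2)) ^ N = exp (p * (l + 0.56 * l\<^sup>2) * N)"
    by (simp flip: exp_of_nat2_mult)
  finally have "measure_pmf.expectation (binomial_pmf N p) (\<lambda>r. exp (l * (real r - p * N))) \<le>
     exp (p * (l + 0.56 * l\<^sup>2) * N) * exp (- l * p * N)" by simp
  also have "\<dots> = exp (0.56 * (p * N) * l\<^sup>2)" by (simp add: algebra_simps flip: exp_add)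
  finally show ?thesis .
qed

section \<open>Heavy edges and contraction\<close>

text \<open>The counterpart of \<open>cut_edges\<close> for multigraphs; in contracted graphs
  \<open>B\<close> is a set of blocks.\<close>

definition block_cut :: "('a, 'e) multigraph \<Rightarrow> 'e set \<Rightarrow> 'a set \<Rightarrow> 'e set" where
  "block_cut H D B = {e \<in> D. ends H e \<inter> B \<noteq> {} \<and> ends H e - B \<noteq> {}}"

section \<open>Walks, trails and edge connectivity\<close>

lemma walk_mono: "walk H D u es v \<Longrightarrow> D \<subseteq> D' \<Longrightarrow> walk H D' u es v"
  by (induction H D u es v rule: walk.induct) auto

lemma walk_verts: "walk H D u es v \<Longrightarrow> u \<in> verts H \<and> v \<in> verts H"
  by (induction H D u es v rule: walk.induct) auto

lemma walk_append: "walk H D u es v \<Longrightarrow> walk H D v fs w \<Longrightarrow> walk H D u (es @ fs) w"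
  by (induction H D u es v rule: walk.induct) auto

lemma walk_edges: "walk H D u es v \<Longrightarrow> set es \<subseteq> D"
  by (induction H D u es v rule: walk.induct) auto

lemma walk_rev: "walk H D u es v \<Longrightarrow> walk H D v (rev es) u"
proof (induction H D u es v rule: walk.induct)
  case (2 H D u e es v)
  then obtain w where w: "u \<in> verts H" "e \<in> D" "ends H e = {u, w}" "walk H D w es v" by auto
  moreover have "w \<in> verts H" using walk_verts[OF w(4)] by blast
  moreover have "ends H e = {w, u}" using w(3) by blast
  ultimately have "walk H D w [e] u" by simp
  then show ?case using walk_append[OF "2.IH"[OF w(4)]] by simp
qed auto

lemma walk_split: "walk H D u (es @ e # fs) v \<Longrightarrow> \<exists>x y. ends H e = {x, y} \<and> walk H D y fs v"
proof (induction es arbitrary: u)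
  case Nil
  then show ?case by auto
next
  case (Cons a es)
  then obtain w where "walk H D w (es @ e # fs) v" by auto
  then show ?case by (rule Cons.IH)
qed

text \<open>If the first edge \<open>e\<close> recurs in the trail found for the rest, the part
  between is cut out: the recurrence arrives at \<open>u\<close>, where everything before is
  dropped, or at \<open>w\<close>, where \<open>e\<close> followed by the remainder
  suffices.\<close>

lemma walk_distinct:
  assumes "walk H D u es v"
  shows "\<exists>fs. distinct fs \<and> set fs \<subseteq> set es \<and> walk H D u fs v"
  using assms
proof (induction es arbitrary: u)
  case Nil
  then show ?case by (intro exI[of _ "[]"]) auto
next
  case (Cons e es)
  then obtain w where w: "u \<in> verts H" "e \<in> D" "ends H e = {u, w}" "walk H D w es v" by auto
  from Cons.IH[OF w(4)] obtain fs where fs: "distinct fs" "set fs \<subseteq> set es" "walk H D w fs v" by blast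
  show ?case
  proof (cases "e \<in> set fs")
    case False
    then show ?thesis using fs w by (intro exI[of _ "e # fs"]) auto
  next
    case True
    then obtain xs ys where xy: "fs = xs @ e # ys" by (meson split_list)
    then obtain x y where y: "ends H e = {x, y}" "walk H D y ys v"
      using fs(3) walk_split by metis
    then consider "y = u" | "y = w" using w(3) by (auto simp: doubleton_eq_iff)
    then show ?thesis
    proof cases
      case 1
      then show ?thesis using y fs xy by (intro exI[of _ ys]) auto
    next
      case 2
      then show ?thesis using y fs xy w by (intro exI[of _ "e # ys"]) auto
    qed
  qed
qed

lemma walk_leaves:
  "walk H D u es v \<Longrightarrow> u \<in> B \<Longrightarrow> v \<notin> B \<Longrightarrow> \<exists>e\<in>D. \<exists>x\<in>B. \<exists>y. y \<notin> B \<and> ends H e = {x, y}"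
proof (induction H D u es v rule: walk.induct)
  case (2 H D u e es v)
  then obtain w where w: "e \<in> D" "ends H e = {u, w}" "walk H D w es v" by auto
  then show ?case using 2 by (cases "w \<in> B") auto
qed auto

text \<open>The easy half of Menger's theorem: fewer than \<open>j\<close> cut edges could be
  removed, and a walk avoiding them cannot leave \<open>B\<close>.\<close>

lemma edge_connected_card_cut:
  assumes "edge_connected H D j u v" "finite E" "D \<subseteq> E" "u \<in> B" "v \<notin> B"
  shows "j \<le> card (block_cut H E B)"
proof (rule ccontr)
  assume "\<not> ?thesis"
  moreover have sub: "block_cut H D B \<subseteq> block_cut H E B" "finite (block_cut H E B)"
    using assms by (auto simp: block_cut_def)
  ultimately have "card (block_cut H D B) < j" using card_mono[OF sub(2,1)] by linarith
  moreover have "finite (block_cut H D B)" using sub finite_subset by blast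
  moreover have "block_cut H D B \<subseteq> D" by (auto simp: block_cut_def)
  ultimately obtain es where "walk H (D - block_cut H D B) u es v"
    using assms(1) unfolding edge_connected_def connected_by_def by blast
  from walk_leaves[OF this assms(4,5)] show False by (auto simp: block_cut_def)
qed

section \<open>Sizes of forests and properties of NI forests\<close>

lemma ends_pair:
  assumes "finite_multigraph H" "e \<in> edges H"
  obtains x y where "ends H e = {x, y}" "x \<noteq> y" "x \<in> verts H" "y \<in> verts H"
proof -
  have "card (ends H e) = 2" "ends H e \<subseteq> verts H"
    using assms by (auto simp: finite_multigraph_def)
  then show ?thesis using that by (auto simp: card_2_iff)
qed

text \<open>Deleting an edge of a forest disconnects its ends, so each edge is a cut of the forest
  by itself and \<open>card_le_card_nonisolated\<close> applies.\<close>

lemma forest_card_le: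
  assumes H: "finite_multigraph H" and "T \<subseteq> edges H" and "forest H T"
  shows "card T \<le> card (verts H)"
proof -
  have fin: "finite (verts H)" "finite T"
    using H \<open>T \<subseteq> edges H\<close> by (auto simp: finite_multigraph_def intro: finite_subset)
  have "\<forall>e\<in>T. \<exists>p. ends H e = {fst p, snd p} \<and> fst p \<in> verts H \<and> snd p \<in> verts H"
  proof
    fix e assume "e \<in> T"
    then have "e \<in> edges H" using \<open>T \<subseteq> edges H\<close> by blast
    then show "\<exists>p. ends H e = {fst p, snd p} \<and> fst p \<in> verts H \<and> snd p \<in> verts H"
      by (rule ends_pair[OF H]) auto
  qed
  then obtain f where f: "\<And>e. e \<in> T \<Longrightarrow> ends H e = {fst (f e), snd (f e)} \<and> fst (f e) \<in> verts H \<and> snd (f e) \<in> verts H"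
    by metis
  define a where "a e = fst (f e)" for e
  define b where "b e = snd (f e)" for e
  have ab: "ends H e = {a e, b e}" "a e \<in> verts H" "b e \<in> verts H" if "e \<in> T" for e
    using f[OF that] by (auto simp: a_def b_def)
  have "\<exists>A. crossing a b T A = {e}" if e: "e \<in> T" for e
  proof -
    define A where "A = {x. connected_by H (T - {e}) (a e) x}"
    have step: "y \<in> A" if xy: "x \<in> A" "g \<in> T" "g \<noteq> e" "ends H g = {x, y}" for g x y
    proof -
      obtain es where es: "walk H (T - {e}) (a e) es x" using xy(1) by (auto simp: A_def connected_by_def)
      have "walk H (T - {e}) x [g] y" using xy walk_verts[OF es] ab[OF xy(2)] by auto
      from walk_append[OF es this] show ?thesis by (auto simp: A_def connected_by_def)
    qed
    have "a e \<in> A" using ab[OF e] by (auto simp: A_def connected_by_def intro: exI[of _ "[]"])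
    \<comment> \<open>Otherwise a trail between the ends of \<open>e\<close> that avoids
      \<open>e\<close>, closed up by \<open>e\<close>, contradicts acyclicity.\<close>
    moreover have "b e \<notin> A"
    proof
      assume "b e \<in> A"
      then obtain es where "walk H (T - {e}) (a e) es (b e)" by (auto simp: A_def connected_by_def)
      then obtain fs where fs: "distinct fs" "walk H (T - {e}) (a e) fs (b e)"
        using walk_distinct[of H "T - {e}" "a e" es "b e"] by blast
      have "e \<notin> set fs" using walk_edges[OF fs(2)] by auto
      moreover have "walk H T (b e) (e # fs) (b e)"
        using walk_mono[OF fs(2), of T] ab[OF e] e by (auto simp: insert_commute)
      ultimately have "\<exists>u es. es \<noteq> [] \<and> distinct es \<and> walk H T u es u"
        using fs(1) by (intro exI[of _ "b e"] exI[of _ "e # fs"]) auto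
      then show False using \<open>forest H T\<close> by (simp add: forest_def)
    qed
    moreover have "(a g \<in> A) = (b g \<in> A)" if "g \<in> T" "g \<noteq> e" for g
      using step[of "a g" g "b g"] step[of "b g" g "a g"] ab[OF that(1)] that by (auto simp: insert_commute)
    ultimately have "crossing a b T A = {e}" using e by (auto simp: crossing_def)
    then show ?thesis by blast
  qed
  then have "card T \<le> card {v \<in> verts H. crossing a b T {v} \<noteq> {}}"
    using ab by (intro card_le_card_nonisolated fin) auto
  also have "\<dots> \<le> card (verts H)" using fin by (intro card_mono) auto
  finally show ?thesis .
qed

lemma NI_forests_subset:
  assumes "NI_forests H T" "1 \<le> j" shows "T j \<subseteq> edges H"
proof -
  have "(\<Union>j\<in>{1..}. T j) = edges H" using assms(1) unfolding NI_forests_def by blast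
  then show ?thesis using assms(2) by auto
qed

lemma NI_forests_maximal:
  "NI_forests H T \<Longrightarrow> 1 \<le> j \<Longrightarrow>
    maximal_spanning_forest H (edges H - (\<Union>i\<in>{1..<j}. T i)) (T j)"
  by (simp add: NI_forests_def)

lemma NI_forests_edge_connected:
  "NI_forests H T \<Longrightarrow> 1 \<le> j \<Longrightarrow> e \<in> T j \<Longrightarrow> ends H e = {u, v} \<Longrightarrow>
    edge_connected H (\<Union>i\<in>{1..j}. T i) j u v"
  by (simp add: NI_forests_def)

text \<open>A single edge has two different ends and so is a forest; the empty forest is maximal
  only if no edge is left.\<close>

lemma NI_forest_empty:
  assumes H: "finite_multigraph H" and NI: "NI_forests H T" and "1 \<le> j" "T j = {}"
  shows "edges H = (\<Union>i\<in>{1..<j}. T i)"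
proof -
  have "e \<in> (\<Union>i\<in>{1..<j}. T i)" if e: "e \<in> edges H" for e
  proof (rule ccontr)
    assume "e \<notin> (\<Union>i\<in>{1..<j}. T i)"
    moreover have "maximal_spanning_forest H (edges H - (\<Union>i\<in>{1..<j}. T i)) (T j)"
      by (rule NI_forests_maximal[OF NI \<open>1 \<le> j\<close>])
    ultimately have "\<not> forest H {e}"
      using e \<open>T j = {}\<close> by (auto simp: maximal_spanning_forest_def)
    then obtain u es where es: "es \<noteq> []" "distinct es" "walk H {e} u es u"
      unfolding forest_def by blast
    then have "set es \<subseteq> {e}" using walk_edges by metis
    then have "es = [e]" using es(1,2) by (cases es; cases "tl es") auto
    then have "ends H e = {u}" using es(3) by auto
    moreover have "card (ends H e) = 2" using H e by (auto simp: finite_multigraph_def)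
    ultimately show False by simp
  qed
  moreover have "(\<Union>i\<in>{1..<j}. T i) \<subseteq> edges H"
    by (intro UN_least NI_forests_subset[OF NI]) simp
  ultimately show ?thesis by blast
qed

text \<open>Ensures that each contraction step merges something. If this forest were empty, the
  \<open>nat \<lfloor>k\<rfloor>\<close> forests before it would hold all edges, at most
  \<open>k * card (verts H)\<close> of them.\<close>

lemma NI_forest_nonempty:
  assumes H: "finite_multigraph H" and NI: "NI_forests H T" and "0 \<le> k"
    and big: "real (card (edges H)) > 2 * k * real (card (verts H))"
  shows "T (nat \<lfloor>k\<rfloor> + 1) \<noteq> {}"
proof
  assume "T (nat \<lfloor>k\<rfloor> + 1) = {}"
  then have "edges H = (\<Union>i\<in>{1..<nat \<lfloor>k\<rfloor> + 1}. T i)"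
    using NI_forest_empty[OF H NI] by simp
  then have "card (edges H) \<le> (\<Sum>i\<in>{1..<nat \<lfloor>k\<rfloor> + 1}. card (T i))"
    by (metis card_UN_le finite_atLeastLessThan)
  also have "\<dots> \<le> (\<Sum>i\<in>{1..<nat \<lfloor>k\<rfloor> + 1}. card (verts H))"
  proof (intro sum_mono)
    fix i assume "i \<in> {1..<nat \<lfloor>k\<rfloor> + 1}"
    then have i: "1 \<le> i" by simp
    then have "forest H (T i)"
      using NI_forests_maximal[OF NI i] by (simp add: maximal_spanning_forest_def)
    then show "card (T i) \<le> card (verts H)"
      using forest_card_le[OF H NI_forests_subset[OF NI i]] by blast
  qed
  also have "\<dots> = nat \<lfloor>k\<rfloor> * card (verts H)" by simp
  finally have "real (card (edges H)) \<le> real (nat \<lfloor>k\<rfloor>) * card (verts H)"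
    by (metis of_nat_le_iff of_nat_mult)
  also have "\<dots> \<le> k * card (verts H)" using \<open>0 \<le> k\<close> by (intro mult_right_mono) linarith+
  also have "\<dots> \<le> 2 * k * card (verts H)" using \<open>0 \<le> k\<close> by (intro mult_right_mono) auto
  finally show False using big by simp
qed

section \<open>Contractions and the cuts they preserve\<close>

text \<open>The blocks of a contraction of \<open>(V, X)\<close> partition \<open>V\<close>, and no cut of \<open>(V, X)\<close> with
  fewer than \<open>k\<close> edges splits a block.\<close>

definition contraction_of :: "'v set \<Rightarrow> 'v set set \<Rightarrow> real \<Rightarrow> ('v set, 'v set) multigraph \<Rightarrow> bool" where
  "contraction_of V X k H \<longleftrightarrow>
     (\<forall>b\<in>verts H. b \<noteq> {}) \<and> (\<forall>b\<in>verts H. \<forall>c\<in>verts H. b \<inter> c \<noteq> {} \<longrightarrow> b = c) \<and> \<Union>(verts H) = V \<and>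
     edges H \<subseteq> X \<and>
     (\<forall>e\<in>edges H. ends H e = {b \<in> verts H. b \<inter> e \<noteq> {}} \<and> card (ends H e) = 2) \<and>
     (\<forall>e\<in>X - edges H. \<exists>b\<in>verts H. e \<subseteq> b) \<and>
     (\<forall>A. real (card (cut_edges X A)) < k \<longrightarrow> (\<forall>b\<in>verts H. b \<subseteq> A \<or> b \<inter> A = {}))"

lemma contraction_ofD:
  assumes "contraction_of V X k H"
  shows "b \<in> verts H \<Longrightarrow> b \<noteq> {}"
    and "b \<in> verts H \<Longrightarrow> c \<in> verts H \<Longrightarrow> x \<in> b \<Longrightarrow> x \<in> c \<Longrightarrow> b = c"
    and "\<Union>(verts H) = V"
    and "edges H \<subseteq> X"
    and "e \<in> edges H \<Longrightarrow> ends H e = {b \<in> verts H. b \<inter> e \<noteq> {}}"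
    and "e \<in> edges H \<Longrightarrow> card (ends H e) = 2"
    and "e \<in> X \<Longrightarrow> e \<notin> edges H \<Longrightarrow> \<exists>b\<in>verts H. e \<subseteq> b"
    and "real (card (cut_edges X A)) < k \<Longrightarrow> b \<in> verts H \<Longrightarrow> b \<subseteq> A \<or> b \<inter> A = {}"
proof -
  note C = assms[unfolded contraction_of_def]
  show "b \<in> verts H \<Longrightarrow> b \<noteq> {}" using C[THEN conjunct1] by blast
  show "b \<in> verts H \<Longrightarrow> c \<in> verts H \<Longrightarrow> x \<in> b \<Longrightarrow> x \<in> c \<Longrightarrow> b = c" using C[THEN conjunct2, THEN conjunct1] by blast
  show "\<Union>(verts H) = V" using C[THEN conjunct2, THEN conjunct2, THEN conjunct1] .
  show "edges H \<subseteq> X" using C[THEN conjunct2, THEN conjunct2, THEN conjunct2, THEN conjunct1] .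
  show "e \<in> edges H \<Longrightarrow> ends H e = {b \<in> verts H. b \<inter> e \<noteq> {}}" using C[THEN conjunct2, THEN conjunct2, THEN conjunct2, THEN conjunct2, THEN conjunct1] by simp
  show "e \<in> edges H \<Longrightarrow> card (ends H e) = 2" using C[THEN conjunct2, THEN conjunct2, THEN conjunct2, THEN conjunct2, THEN conjunct1] by blast
  show "e \<in> X \<Longrightarrow> e \<notin> edges H \<Longrightarrow> \<exists>b\<in>verts H. e \<subseteq> b" using C[THEN conjunct2, THEN conjunct2, THEN conjunct2, THEN conjunct2, THEN conjunct2, THEN conjunct1] by simp
  show "real (card (cut_edges X A)) < k \<Longrightarrow> b \<in> verts H \<Longrightarrow> b \<subseteq> A \<or> b \<inter> A = {}"
    using C[THEN conjunct2, THEN conjunct2, THEN conjunct2, THEN conjunct2, THEN conjunct2, THEN conjunct2] by simp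
qed

text \<open>When \<open>A\<close> splits no block, an edge between a block inside \<open>A\<close>
  and a block outside has its ends on both sides of \<open>A\<close>, so a cut of the contracted
  graph is no larger than the cut of \<open>(V, X)\<close> it comes from.\<close>

lemma card_block_cut_le:
  assumes "finite X" "edges H \<subseteq> X" "\<And>e. e \<in> edges H \<Longrightarrow> ends H e = {b \<in> verts H. b \<inter> e \<noteq> {}}"
    and "\<And>b. b \<in> verts H \<Longrightarrow> b \<subseteq> A \<or> b \<inter> A = {}"
  shows "card (block_cut H (edges H) {b \<in> verts H. b \<subseteq> A}) \<le> card (cut_edges X A)"
proof (rule card_mono)
  show "finite (cut_edges X A)" using assms(1) by (rule finite_cut_edges)
  show "block_cut H (edges H) {b \<in> verts H. b \<subseteq> A} \<subseteq> cut_edges X A"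
  proof
    fix e assume e: "e \<in> block_cut H (edges H) {b \<in> verts H. b \<subseteq> A}"
    then have eH: "e \<in> edges H" by (simp add: block_cut_def)
    have ee: "ends H e \<inter> {b \<in> verts H. b \<subseteq> A} \<noteq> {}" "ends H e - {b \<in> verts H. b \<subseteq> A} \<noteq> {}"
      using e by (simp_all add: block_cut_def)
    obtain b where b: "b \<in> ends H e" "b \<subseteq> A" using ee(1) by auto
    obtain c where c: "c \<in> ends H e" "c \<in> verts H" "\<not> c \<subseteq> A"
      using ee(2) assms(3)[OF eH] by auto
    have "c \<inter> A = {}" using assms(4)[OF c(2)] c(3) by simp
    moreover have "b \<inter> e \<noteq> {}" "c \<inter> e \<noteq> {}" using b(1) c(1) assms(3)[OF eH] by simp_all
    ultimately have "e \<inter> A \<noteq> {}" "e - A \<noteq> {}" using b(2) by blast+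
    then show "e \<in> cut_edges X A" using eH assms(2) by (auto simp: cut_edges_def)
  qed
qed

lemma finite_contraction:
  assumes "finite V" "finite X" "contraction_of V X k H"
  shows "finite_multigraph H"
proof -
  have "verts H \<subseteq> Pow V" using contraction_ofD(3)[OF assms(3)] by blast
  then have "finite (verts H)" using assms(1) finite_subset by blast
  moreover have "finite (edges H)" using contraction_ofD(4)[OF assms(3)] assms(2) finite_subset by blast
  moreover have "ends H e \<subseteq> verts H \<and> card (ends H e) = 2" if "e \<in> edges H" for e
  proof -
    have "ends H e = {b \<in> verts H. b \<inter> e \<noteq> {}}" "card (ends H e) = 2"
      using contraction_ofD(5,6)[OF assms(3) that] by auto
    then show ?thesis by auto
  qed
  ultimately show ?thesis by (simp add: finite_multigraph_def)
qed

lemma contraction_of_singleton_graph: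
  assumes "\<And>e. e \<in> X \<Longrightarrow> e \<subseteq> V \<and> card e = 2"
  shows "contraction_of V X k (singleton_graph V X)"
proof -
  have "(\<lambda>v. {v}) ` e = {b \<in> (\<lambda>v. {v}) ` V. b \<inter> e \<noteq> {}} \<and> card ((\<lambda>v. {v}) ` e) = 2" if "e \<in> X" for e
  proof
    show "(\<lambda>v. {v}) ` e = {b \<in> (\<lambda>v. {v}) ` V. b \<inter> e \<noteq> {}}" using assms[OF that] by auto
    show "card ((\<lambda>v. {v}) ` e) = 2" using assms[OF that] by (simp add: card_image)
  qed
  then show ?thesis
    unfolding contraction_of_def singleton_graph_def multigraph.simps by (intro conjI) blast+
qed

context
  fixes H :: "('v set, 'v set) multigraph" and T :: "'v set set" and V X k
  assumes H: "contraction_of V X k H" and finV: "finite V" and finX: "finite X"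
    and XV: "\<And>e. e \<in> X \<Longrightarrow> e \<subseteq> V" and T: "T \<subseteq> edges H"
begin

private abbreviation "con \<equiv> connected_by H T"
private abbreviation "m \<equiv> merged H T"

lemma con_refl: "a \<in> verts H \<Longrightarrow> con a a"
  unfolding connected_by_def by (rule exI[of _ "[]"]) simp

lemma con_trans: "con a b \<Longrightarrow> con b c \<Longrightarrow> con a c"
  unfolding connected_by_def using walk_append by metis

lemma con_sym: "con a b \<Longrightarrow> con b a"
  unfolding connected_by_def using walk_rev by metis

lemma block_disjoint: "b \<in> verts H \<Longrightarrow> c \<in> verts H \<Longrightarrow> x \<in> b \<Longrightarrow> x \<in> c \<Longrightarrow> b = c"
  using contraction_ofD(2)[OF H] .

lemma merged_mem: "x \<in> m a \<longleftrightarrow> (\<exists>b\<in>verts H. con a b \<and> x \<in> b)"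
  by (auto simp: merged_def)

lemma merged_eq: "con a b \<Longrightarrow> m a = m b"
  unfolding merged_def using con_trans con_sym by metis

lemma merged_meet: "x \<in> m a \<Longrightarrow> x \<in> m b \<Longrightarrow> m a = m b"
  unfolding merged_mem using block_disjoint con_trans con_sym merged_eq by metis

lemma subset_merged: "a \<in> verts H \<Longrightarrow> a \<subseteq> m a"
  using merged_mem con_refl by blast

text \<open>A cut with fewer than \<open>k\<close> edges splits no old block. An edge of
  \<open>T\<close> cannot cross it either, because its ends are \<open>j\<close>-edge-connected with
  \<open>j \<ge> k\<close>. Walks in \<open>T\<close> thus stay on one side, and no merged block is
  split.\<close>

lemma contraction_of_contract:
  assumes ec: "\<And>e u v. e \<in> T \<Longrightarrow> ends H e = {u, v} \<Longrightarrow> \<exists>D\<subseteq>edges H. \<exists>j. k \<le> real j \<and> edge_connected H D j u v"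
  shows "contraction_of V X k (contract H T)"
proof -
  note Hd = contraction_ofD[OF H]
  note ends = Hd(5,6)
  have 1: "\<forall>b\<in>m ` verts H. b \<noteq> {}" using subset_merged Hd(1) by blast
  have 2: "\<forall>b\<in>m ` verts H. \<forall>c\<in>m ` verts H. b \<inter> c \<noteq> {} \<longrightarrow> b = c" using merged_meet by blast
  have 3: "\<Union>(m ` verts H) = V"
  proof
    show "\<Union>(m ` verts H) \<subseteq> V" using Hd(3) merged_mem by blast
    show "V \<subseteq> \<Union>(m ` verts H)" using Hd(3) subset_merged by blast
  qed
  have 4: "m ` ends H e = {b \<in> m ` verts H. b \<inter> e \<noteq> {}}" if e: "e \<in> edges H" for e
  proof
    show "m ` ends H e \<subseteq> {b \<in> m ` verts H. b \<inter> e \<noteq> {}}"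
      using ends(1)[OF e] subset_merged by blast
    show "{b \<in> m ` verts H. b \<inter> e \<noteq> {}} \<subseteq> m ` ends H e"
    proof
      fix b assume "b \<in> {b \<in> m ` verts H. b \<inter> e \<noteq> {}}"
      then obtain a x where a: "b = m a" "x \<in> m a" "x \<in> e" by blast
      then obtain c where c: "c \<in> verts H" "con a c" "x \<in> c" using merged_mem by blast
      then have "c \<in> ends H e" using ends(1)[OF e] a(3) by blast
      then show "b \<in> m ` ends H e" using a(1) merged_eq[OF c(2)] by blast
    qed
  qed
  \<comment> \<open>An edge leaves the graph now, when its ends are merged, or had left before; in
    both cases it lies inside one block.\<close>
  have 5: "\<exists>b\<in>m ` verts H. e \<subseteq> b" if e: "e \<in> X" "e \<in> edges H \<longrightarrow> card (m ` ends H e) \<noteq> 2" for e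
  proof (cases "e \<in> edges H")
    case True
    obtain p q where pq: "ends H e = {p, q}" "p \<in> verts H" "q \<in> verts H"
      using ends_pair[OF finite_contraction[OF finV finX H] True] by metis
    then have eq: "m p = m q" using e(2) True by (auto simp: card_2_iff split: if_splits)
    have "e \<subseteq> m p"
    proof
      fix x assume x: "x \<in> e"
      have "e \<subseteq> V" by (rule XV[OF e(1)])
      then obtain b where b: "b \<in> verts H" "x \<in> b" using Hd(3) x by blast
      then have "b \<in> {p, q}" using ends(1)[OF True] pq(1) x by blast
      then show "x \<in> m p" using b subset_merged eq by blast
    qed
    then show ?thesis using pq(2) by blast
  next
    case False
    then obtain b where "b \<in> verts H" "e \<subseteq> b" using Hd(7) e(1) by blast
    then show ?thesis using subset_merged by blast
  qed
  have 6: "b \<subseteq> A \<or> b \<inter> A = {}" if A: "real (card (cut_edges X A)) < k" and b: "b \<in> m ` verts H" for A b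
  proof -
    have split: "c \<subseteq> A \<or> c \<inter> A = {}" if "c \<in> verts H" for c using Hd(8)[OF A that] .
    have side: "c \<subseteq> A" if ac: "a \<subseteq> A" "con a c" "c \<in> verts H" "a \<in> verts H" for a c
    proof (rule ccontr)
      assume "\<not> c \<subseteq> A"
      define B where "B = {b \<in> verts H. b \<subseteq> A}"
      have B: "a \<in> B" "c \<notin> B" using ac \<open>\<not> c \<subseteq> A\<close> by (simp_all add: B_def)
      obtain es where es: "walk H T a es c" using ac(2) by (auto simp: connected_by_def)
      obtain e x y where e: "e \<in> T" "x \<in> B" "y \<notin> B" "ends H e = {x, y}"
        using walk_leaves[OF es B] by (elim bexE exE conjE)
      obtain D j where D: "D \<subseteq> edges H" "k \<le> real j" "edge_connected H D j x y" using ec[OF e(1,4)] by blast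
      have "finite (edges H)" using finite_contraction[OF finV finX H] by (simp add: finite_multigraph_def)
      from edge_connected_card_cut[OF D(3) this D(1) e(2,3)]
      have "j \<le> card (block_cut H (edges H) B)" .
      also have "\<dots> \<le> card (cut_edges X A)" unfolding B_def by (intro card_block_cut_le finX Hd(4) ends(1) split)
      finally show False using A D(2) by linarith
    qed
    obtain a where a: "a \<in> verts H" "b = m a" using b by blast
    show ?thesis
    proof (cases "a \<subseteq> A")
      case True
      then have "m a \<subseteq> A" using side[OF True _ _ a(1)] merged_mem by blast
      then show ?thesis using a by blast
    next
      case False
      have "c \<inter> A = {}" if "c \<in> verts H" "con a c" for c
        using split[OF that(1)] side[OF _ con_sym[OF that(2)] a(1) that(1)] False by blast
      then have "m a \<inter> A = {}" using merged_mem by blast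
      then show ?thesis using a by blast
    qed
  qed
  show ?thesis
    unfolding contraction_of_def contract_def multigraph.simps
  proof (intro conjI)
    show "{e \<in> edges H. card (m ` ends H e) = 2} \<subseteq> X" using Hd(4) by blast
    show "\<forall>e\<in>{e \<in> edges H. card (m ` ends H e) = 2}.
        m ` ends H e = {b \<in> m ` verts H. b \<inter> e \<noteq> {}} \<and> card (m ` ends H e) = 2"
      by (intro ballI conjI 4) simp_all
    show "\<forall>e\<in>X - {e \<in> edges H. card (m ` ends H e) = 2}. \<exists>b\<in>m ` verts H. e \<subseteq> b"
      using 5 by simp
    show "\<forall>A. real (card (cut_edges X A)) < k \<longrightarrow> (\<forall>b\<in>m ` verts H. b \<subseteq> A \<or> b \<inter> A = {})"
      using 6 by blast
  qed (fact 1 2 3)+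
qed

lemma card_verts_contract:
  assumes "T \<noteq> {}"
  shows "card (verts (contract H T)) < card (verts H)"
proof -
  have fin: "finite_multigraph H" by (rule finite_contraction[OF finV finX H])
  obtain e where e: "e \<in> T" "e \<in> edges H" using assms T by blast
  obtain p q where pq: "ends H e = {p, q}" "p \<noteq> q" "p \<in> verts H" "q \<in> verts H"
    using ends_pair[OF fin e(2)] by metis
  have "walk H T p [e] q" using e pq by auto
  then have "m p = m q" unfolding connected_by_def using merged_eq connected_by_def by metis
  then have "\<not> inj_on m (verts H)" using inj_onD[of m "verts H" p q] pq(2-4) by blast
  moreover have "finite (verts H)" using fin by (simp add: finite_multigraph_def)
  ultimately have "card (m ` verts H) < card (verts H)"
    by (metis card_image_le eq_card_imp_inj_on le_neq_implies_less)
  then show ?thesis by (simp add: contract_def)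
qed

end

text \<open>The loop preserves \<open>contraction_of\<close>, and the number of blocks decreases,
  which gives termination.\<close>

lemma contraction_phase_contraction_of:
  assumes ni: "NI_subroutine ni" and "finite V" and X: "\<And>e. e \<in> X \<Longrightarrow> e \<subseteq> V \<and> card e = 2" and "0 \<le> k"
  shows "contraction_of V X k (contraction_phase ni k (singleton_graph V X))"
  unfolding contraction_phase_def
proof (rule while_rule[where P = "contraction_of V X k" and r = "Wellfounded.measure (\<lambda>H. card (verts H))"])
  have "X \<subseteq> Pow V" using X by auto
  then have finX: "finite X" using assms(2) finite_subset by blast
  have XV: "\<And>e. e \<in> X \<Longrightarrow> e \<subseteq> V" using X by blast
  show "contraction_of V X k (singleton_graph V X)" using X by (rule contraction_of_singleton_graph)
  fix H assume H: "contraction_of V X k H" and big: "real (card (edges H)) > 2 * k * real (card (verts H))"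
  have fin: "finite_multigraph H" by (rule finite_contraction[OF assms(2) finX H])
  then have NI: "NI_forests H (ni H)" using ni by (simp add: NI_subroutine_def)
  \<comment> \<open>This index exceeds \<open>k\<close> even when \<open>k\<close> is not an
    integer, so the edges of the forest join vertices of edge connectivity at least
    \<open>k\<close>.\<close>
  define j where "j = nat \<lfloor>k\<rfloor> + 1"
  have j: "1 \<le> j" "k \<le> real j" unfolding j_def by linarith+
  have sub: "ni H j \<subseteq> edges H" using NI_forests_subset[OF NI j(1)] .
  have sub': "(\<Union>i\<in>{1..j}. ni H i) \<subseteq> edges H" by (intro UN_least NI_forests_subset[OF NI]) simp
  have "\<exists>D\<subseteq>edges H. \<exists>j. k \<le> real j \<and> edge_connected H D j u v" if "e \<in> ni H j" "ends H e = {u, v}" for e u v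
  proof -
    have "edge_connected H (\<Union>i\<in>{1..j}. ni H i) j u v"
      by (rule NI_forests_edge_connected[OF NI j(1) that])
    then show ?thesis using sub' j(2) by blast
  qed
  then show "contraction_of V X k (contract H (ni H (nat \<lfloor>k\<rfloor> + 1)))"
    unfolding j_def[symmetric] by (intro contraction_of_contract[OF H assms(2) finX XV sub])
  show "(contract H (ni H (nat \<lfloor>k\<rfloor> + 1)), H) \<in> Wellfounded.measure (\<lambda>H. card (verts H))"
    using card_verts_contract[OF H assms(2) finX XV sub] NI_forest_nonempty[OF fin NI \<open>0 \<le> k\<close> big]
    by (simp add: j_def)
qed auto

lemma contraction_phase_subset:
  assumes "NI_subroutine ni" "finite V" "\<And>e. e \<in> X \<Longrightarrow> e \<subseteq> V \<and> card e = 2" "0 \<le> k"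
  shows "edges (contraction_phase ni k (singleton_graph V X)) \<subseteq> X"
  by (rule contraction_ofD(4)[OF contraction_phase_contraction_of[OF assms]])

text \<open>An edge outside the final graph lies inside a block, and cuts with fewer than
  \<open>k\<close> edges split no block.\<close>

lemma contraction_phase_heavy:
  assumes "NI_subroutine ni" "finite V" "\<And>e. e \<in> X \<Longrightarrow> e \<subseteq> V \<and> card e = 2" "0 \<le> k"
    and "cut_edges (X - edges (contraction_phase ni k (singleton_graph V X))) A \<noteq> {}"
  shows "k \<le> card (cut_edges X A)"
proof (rule ccontr)
  define H where "H = contraction_phase ni k (singleton_graph V X)"
  have H: "contraction_of V X k H"
    unfolding H_def by (rule contraction_phase_contraction_of[OF assms(1-4)])
  assume "\<not> k \<le> card (cut_edges X A)"
  then have "real (card (cut_edges X A)) < k" by simp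
  then have split: "b \<subseteq> A \<or> b \<inter> A = {}" if "b \<in> verts H" for b
    using contraction_ofD(8)[OF H _ that] by blast
  obtain e where e: "e \<in> X - edges H" "e \<inter> A \<noteq> {}" "e - A \<noteq> {}"
    using assms(5) by (auto simp: H_def cut_edges_def)
  then obtain b where "b \<in> verts H" "e \<subseteq> b" using contraction_ofD(7)[OF H] by blast
  then show False using split e by blast
qed

text \<open>The loop guard fails at once. The contrapositive is what counts: a nonempty rest forces
  many edges, which bounds the number of rounds.\<close>

lemma contraction_phase_trivial:
  assumes "finite V" "real (card X) \<le> 2 * k * real (card V)"
  shows "edges (contraction_phase ni k (singleton_graph V X)) = X"
proof -
  have "card ((\<lambda>v. {v}) ` V) = card V" by (simp add: card_image)
  then show ?thesis
    using assms unfolding contraction_phase_def by (subst while_unfold) (simp add: singleton_graph_def)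
qed

text \<open>Round 0 involves no contraction: an edge outside the first forests lies in a forest of
  index above \<open>k\<close>, and its ends have at least that edge connectivity.\<close>

lemma NI_forest_heavy:
  assumes "NI_subroutine ni" "finite V" and X: "\<And>e. e \<in> X \<Longrightarrow> e \<subseteq> V \<and> card e = 2"
    and "cut_edges (X - (\<Union>j\<in>{j. 1 \<le> j \<and> real j \<le> k}. ni (singleton_graph V X) j)) A \<noteq> {}"
  shows "k \<le> card (cut_edges X A)"
proof -
  let ?H = "singleton_graph V X"
  have "X \<subseteq> Pow V" using X by auto
  then have finX: "finite X" using assms(2) finite_subset by blast
  have H: "contraction_of V X k ?H" using X by (rule contraction_of_singleton_graph)
  have fin: "finite_multigraph ?H" by (rule finite_contraction[OF assms(2) finX H])
  then have NI: "NI_forests ?H (ni ?H)" using assms(1) by (simp add: NI_subroutine_def)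
  obtain e where e: "e \<in> X" "e \<inter> A \<noteq> {}" "e - A \<noteq> {}" "\<And>j. 1 \<le> j \<Longrightarrow> real j \<le> k \<Longrightarrow> e \<notin> ni ?H j"
    using assms(4) by (auto simp: cut_edges_def)
  have "edges ?H = X" by (simp add: singleton_graph_def)
  moreover have "(\<Union>j\<in>{1..}. ni ?H j) = edges ?H" using NI unfolding NI_forests_def by blast
  ultimately obtain j where j: "1 \<le> j" "e \<in> ni ?H j" using e(1) by (metis UN_E atLeast_iff)
  then have kj: "k \<le> real j" using e(4) by force
  obtain x y where xy: "x \<in> e" "x \<in> A" "y \<in> e" "y \<notin> A" using e by blast
  have "card e = 2" using X e(1) by blast
  then have "e = {x, y}" using xy by (metis card_2_iff insertE insert_commute singletonD)
  then have "ends ?H e = {{x}, {y}}" by (simp add: singleton_graph_def)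
  then have ec: "edge_connected ?H (\<Union>i\<in>{1..j}. ni ?H i) j {x} {y}"
    by (rule NI_forests_edge_connected[OF NI j])
  have "j \<le> card (block_cut ?H (edges ?H) {b \<in> verts ?H. b \<subseteq> A})"
  proof (rule edge_connected_card_cut[OF ec])
    show "finite (edges ?H)" using finX by (simp add: singleton_graph_def)
    show "(\<Union>i\<in>{1..j}. ni ?H i) \<subseteq> edges ?H" by (intro UN_least NI_forests_subset[OF NI]) simp
    show "{x} \<in> {b \<in> verts ?H. b \<subseteq> A}" using xy X[OF e(1)] by (auto simp: singleton_graph_def)
    show "{y} \<notin> {b \<in> verts ?H. b \<subseteq> A}" using xy by auto
  qed
  also have "\<dots> \<le> card (cut_edges X A)"
    by (intro card_block_cut_le finX contraction_ofD(4,5)[OF H]) (auto simp: singleton_graph_def)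
  finally show ?thesis using kj by linarith
qed

text \<open>Nonemptiness makes \<open>top_index\<close> the maximum of a nonempty set.\<close>

lemma NI_initial_nonempty:
  assumes "NI_subroutine ni" "finite V" and X: "\<And>e. e \<in> X \<Longrightarrow> e \<subseteq> V \<and> card e = 2"
    and "X \<noteq> {}" "1 \<le> k"
  shows "(\<Union>j\<in>{j. 1 \<le> j \<and> real j \<le> k}. ni (singleton_graph V X) j) \<noteq> {}"
    and "(\<Union>j\<in>{j. 1 \<le> j \<and> real j \<le> k}. ni (singleton_graph V X) j) \<subseteq> X"
proof -
  let ?H = "singleton_graph V X"
  have "X \<subseteq> Pow V" using X by auto
  then have finX: "finite X" using assms(2) finite_subset by blast
  have H: "contraction_of V X k ?H" using X by (rule contraction_of_singleton_graph)
  have fin: "finite_multigraph ?H" by (rule finite_contraction[OF assms(2) finX H])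
  then have NI: "NI_forests ?H (ni ?H)" using assms(1) by (simp add: NI_subroutine_def)
  have ed: "edges ?H = X" by (simp add: singleton_graph_def)
  have "ni ?H 1 \<noteq> {}" using NI_forest_empty[OF fin NI, of 1] assms(4) ed by auto
  then show "(\<Union>j\<in>{j. 1 \<le> j \<and> real j \<le> k}. ni ?H j) \<noteq> {}" using assms(5) by force
  show "(\<Union>j\<in>{j. 1 \<le> j \<and> real j \<le> k}. ni ?H j) \<subseteq> X"
  proof (rule UN_least)
    fix j assume "j \<in> {j. 1 \<le> j \<and> real j \<le> k}"
    then show "ni ?H j \<subseteq> X" using NI_forests_subset[OF NI, of j] ed by simp
  qed
qed

section \<open>The run of the algorithm\<close>

text \<open>Two-stage union bound: the second stage has to be controlled only for outcomes of the
  first that are possible and not in \<open>Bad\<close>.\<close>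

lemma prob_bind_pmf_le:
  fixes p :: "'a pmf" and f :: "'a \<Rightarrow> 'b pmf"
  assumes "measure_pmf.prob p Bad \<le> \<alpha>" "0 \<le> \<beta>"
    and "\<And>x. x \<in> set_pmf p \<Longrightarrow> x \<notin> Bad \<Longrightarrow> measure_pmf.prob (f x) B \<le> \<beta>"
  shows "measure_pmf.prob (bind_pmf p f) B \<le> \<alpha> + \<beta>"
proof -
  have "ennreal (measure_pmf.prob (bind_pmf p f) B) = (\<integral>\<^sup>+ x. emeasure (measure_pmf (f x)) B \<partial>measure_pmf p)"
    by (simp add: emeasure_bind_pmf flip: measure_pmf.emeasure_eq_measure)
  also have "\<dots> \<le> (\<integral>\<^sup>+ x. indicator Bad x + ennreal \<beta> \<partial>measure_pmf p)"
  proof (rule nn_integral_mono_AE, rule AE_pmfI)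
    fix x assume x: "x \<in> set_pmf p"
    show "emeasure (measure_pmf (f x)) B \<le> indicator Bad x + ennreal \<beta>"
    proof (cases "x \<in> Bad")
      case True
      then have "emeasure (measure_pmf (f x)) B \<le> indicator Bad x"
        by (simp add: measure_pmf.emeasure_le_1)
      then show ?thesis by (simp add: add_increasing2)
    next
      case False
      then show ?thesis using assms(3)[OF x] by (simp add: measure_pmf.emeasure_eq_measure ennreal_leI)
    qed
  qed
  also have "\<dots> = emeasure (measure_pmf p) Bad + ennreal \<beta>"
    by (subst nn_integral_add) auto
  also have "\<dots> = ennreal (measure_pmf.prob p Bad + \<beta>)"
    using assms(2) by (simp add: measure_pmf.emeasure_eq_measure ennreal_plus)
  finally have "measure_pmf.prob (bind_pmf p f) B \<le> measure_pmf.prob p Bad + \<beta>"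
    using assms(2) by (subst (asm) ennreal_le_iff) auto
  then show ?thesis using assms(1) by linarith
qed

section \<open>Invariants of a run, termination, and accuracy of the halving steps\<close>

locale dense_graph =
  fixes V :: "'v set" and E :: "'v set set" and \<epsilon> \<rho> :: real
    and ni :: "('v set, 'v set) multigraph \<Rightarrow> nat \<Rightarrow> 'v set set"
  assumes simple: "simple_graph V E" and eps: "0 < \<epsilon>" "\<epsilon> \<le> 1"
    and rho: "\<rho> = rho (card V) \<epsilon>" and dense: "real (card E) > 2 * \<rho> * real (card V)"
    and ni: "NI_subroutine ni"
begin

text \<open>The rate 3/4 is a compromise: the square of \<open>\<delta> i\<close> times
  \<open>k i\<close> still grows, like \<open>(9 / 8) ^ i\<close>, so one tail bound serves every
  round, while the errors of all rounds sum to at most \<open>2 / 9 * \<epsilon>\<close>.\<close>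

definition \<delta> :: "nat \<Rightarrow> real" where "\<delta> i = \<epsilon> / 18 * (3 / 4) ^ i"

text \<open>For \<open>i = 0\<close> this is \<open>2 * \<rho>\<close>, the bound on the forest
  index in the initial step.\<close>

definition k :: "nat \<Rightarrow> real" where "k i = \<rho> * 2 ^ (i + 1)"

text \<open>Collects what holds on every possible run, as opposed to \<open>faithful_run\<close>,
  which holds with high probability. The bounds by \<open>card V\<close> yield termination and the
  number of events in the union bounds.\<close>

definition valid_run :: "'v run \<Rightarrow> bool" where
  "valid_run r \<longleftrightarrow> idx r \<le> card V \<and> Fs r 0 \<noteq> {} \<and>
     (\<forall>i\<le>idx r. Xs r i \<subseteq> E \<and> Fs r i \<subseteq> Xs r i \<and> Ys r i = Xs r i - Fs r i \<and>
        (\<forall>A. cut_edges (Ys r i) A \<noteq> {} \<longrightarrow> k i \<le> card (cut_edges (Xs r i) A)) \<and> (Ys r i \<noteq> {} \<longrightarrow> i < card V)) \<and>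
     (\<forall>i<idx r. Xs r (Suc i) \<subseteq> Ys r i)"

lemma valid_runD:
  assumes "valid_run r"
  shows "idx r \<le> card V" and "Fs r 0 \<noteq> {}"
    and "i \<le> idx r \<Longrightarrow> Xs r i \<subseteq> E"
    and "i \<le> idx r \<Longrightarrow> Fs r i \<subseteq> Xs r i"
    and "i \<le> idx r \<Longrightarrow> Ys r i = Xs r i - Fs r i"
    and "i \<le> idx r \<Longrightarrow> cut_edges (Ys r i) A \<noteq> {} \<Longrightarrow> k i \<le> card (cut_edges (Xs r i) A)"
    and "i \<le> idx r \<Longrightarrow> Ys r i \<noteq> {} \<Longrightarrow> i < card V"
    and "i < idx r \<Longrightarrow> Xs r (Suc i) \<subseteq> Ys r i"
proof -
  note r = assms[unfolded valid_run_def]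
  show "i < idx r \<Longrightarrow> Xs r (Suc i) \<subseteq> Ys r i"
    using r[THEN conjunct2, THEN conjunct2, THEN conjunct2] by blast
qed (use assms in \<open>simp_all add: valid_run_def\<close>)

text \<open>The error is relative to the cut in \<open>X\<close>, which is known to be at least
  \<open>k i\<close> whenever \<open>Y\<close> is cut; the cut in \<open>Y\<close> alone may be
  small.\<close>

definition faithful_sample :: "nat \<Rightarrow> 'v set set \<Rightarrow> 'v set set \<Rightarrow> 'v set set \<Rightarrow> bool" where
  "faithful_sample i X Y Z \<longleftrightarrow>
     (\<forall>A. \<bar>2 * real (card (cut_edges Z A)) - card (cut_edges Y A)\<bar> \<le> \<delta> i * card (cut_edges X A))"

definition faithful_run :: "'v run \<Rightarrow> bool" where
  "faithful_run r \<longleftrightarrow> (\<forall>i<idx r. faithful_sample i (Xs r i) (Ys r i) (Xs r (Suc i)))"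

lemma finite_V: "finite V" and edge: "e \<in> E \<Longrightarrow> e \<subseteq> V \<and> card e = 2"
  using simple by (auto simp: simple_graph_def)

lemma finite_E: "finite E"
  using finite_V edge by (metis Pow_iff finite_Pow_iff finite_subset subsetI)

lemma card_E: "card E \<le> card V choose 2"
proof -
  have "E \<subseteq> {e. e \<subseteq> V \<and> card e = 2}" using edge by blast
  moreover have "finite {e. e \<subseteq> V \<and> card e = 2}" using finite_V by simp
  ultimately have "card E \<le> card {e. e \<subseteq> V \<and> card e = 2}" by (metis card_mono)
  then show ?thesis using n_subsets[OF finite_V] by simp
qed

lemma rho_eq: "\<rho> = 50700 / 19 * ln (card V) / \<epsilon>\<^sup>2"
  using eps by (simp add: rho rho_def field_simps)

lemma n2: "2 \<le> card V"
proof (rule ccontr)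
  assume "\<not> ?thesis"
  then have c: "card V = 0 \<or> card V = 1" by linarith
  then have "card E = 0" using card_E by (auto simp: choose_two)
  moreover have "\<rho> * real (card V) = 0" using c by (auto simp: rho_eq)
  ultimately show False using dense by simp
qed

lemma ln_n: "ln (card V) \<ge> 1 / 2"
proof -
  have "exp (1 / 2 :: real) \<le> 1 + 1 / 2 + (1 / 2)\<^sup>2" by (rule exp_bound) auto
  also have "\<dots> \<le> real (card V)" using n2 by (simp add: power2_eq_square)
  finally show ?thesis using n2 ln_ge_iff[of "real (card V)" "1 / 2"] by auto
qed

lemma rho_ge: "\<rho> \<ge> 1"
proof -
  have "\<epsilon>\<^sup>2 \<le> 1" using eps by (simp add: power_le_one)
  then have "\<epsilon>\<^sup>2 \<le> 50700 / 19 * ln (card V)" using ln_n by linarith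
  then show ?thesis using eps by (simp add: rho_eq)
qed

lemma E_nonempty: "E \<noteq> {}"
proof
  assume "E = {}"
  moreover have "0 \<le> 2 * \<rho> * real (card V)" using rho_ge by simp
  ultimately show False using dense by simp
qed

lemma card_subset_E: "Z \<subseteq> E \<Longrightarrow> real (card Z) \<le> real (card V) ^ 2"
proof -
  assume "Z \<subseteq> E"
  then have "card Z \<le> card E" using finite_E by (rule card_mono[rotated])
  also have "\<dots> \<le> card V ^ 2" using card_E by (metis binomial_le_pow2 le_trans binomial_le_pow n2)
  finally show ?thesis by (metis of_nat_le_iff of_nat_power)
qed

text \<open>Density forces \<open>2 * \<rho> < card V\<close>, and \<open>\<rho>\<close> is at least
  2. The value 4 turns the final \<open>16 / n ^ 2\<close> into \<open>4 / n\<close>.\<close>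

lemma n_ge: "card V \<ge> 4"
proof -
  have "2 * \<rho> * real (card V) < real (card V) ^ 2" using dense card_subset_E[OF order_refl] by linarith
  then have "2 * \<rho> < real (card V)" using n2 by (simp add: power2_eq_square)
  moreover have "\<rho> \<ge> 2"
  proof -
    have "\<epsilon>\<^sup>2 \<le> 1" using eps by (simp add: power_le_one)
    then have "2 * \<epsilon>\<^sup>2 \<le> 50700 / 19 * ln (card V)" using ln_n by linarith
    then show ?thesis using eps by (simp add: rho_eq field_simps)
  qed
  ultimately show ?thesis by linarith
qed

lemma delta_pos: "0 < \<delta> i" and delta_le: "\<delta> i \<le> 1 / 18"
proof -
  show "0 < \<delta> i" using eps by (simp add: \<delta>_def)
  have "\<epsilon> * (3 / 4) ^ i \<le> 1 * 1" using eps by (intro mult_mono power_le_one) auto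
  then show "\<delta> i \<le> 1 / 18" by (simp add: \<delta>_def)
qed

lemma k_pos: "0 < k i"
  using rho_ge by (simp add: k_def)

lemma valid_initial: "valid_run (initial_run ni V E \<rho>)"
  and faithful_initial: "faithful_run (initial_run ni V E \<rho>)"
proof -
  define F where "F = (\<Union>j\<in>{j. 1 \<le> j \<and> real j \<le> 2 * \<rho>}. ni (singleton_graph V E) j)"
  have F: "F \<noteq> {}" "F \<subseteq> E"
    unfolding F_def using NI_initial_nonempty[OF ni finite_V edge E_nonempty, of "2 * \<rho>"] rho_ge by auto
  have "k 0 \<le> card (cut_edges E A)" if "cut_edges (E - F) A \<noteq> {}" for A
    using NI_forest_heavy[OF ni finite_V edge, of E "2 * \<rho>" A] that by (simp add: F_def k_def)
  then show "valid_run (initial_run ni V E \<rho>)"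
    using F n2 unfolding initial_run_def F_def[symmetric] Let_def valid_run_def by auto
  show "faithful_run (initial_run ni V E \<rho>)" by (simp add: initial_run_def Let_def faithful_run_def)
qed

lemma valid_next:
  assumes r: "valid_run r" and Y: "Ys r (idx r) \<noteq> {}" and Z: "Z \<subseteq> Ys r (idx r)"
  shows "valid_run (next_run ni V \<rho> r Z)"
proof -
  define i where "i = Suc (idx r)"
  define F where "F = edges (contraction_phase ni (k i) (singleton_graph V Z))"
  have i_le: "i \<le> card V" using valid_runD(7)[OF r order_refl Y] by (simp add: i_def)
  have ZE: "Z \<subseteq> E" using valid_runD(3,5)[OF r order_refl] Z by blast
  have Zed: "e \<subseteq> V \<and> card e = 2" if "e \<in> Z" for e using ZE edge that by blast
  have k0: "0 \<le> k i" using k_pos[of i] by linarith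
  have sub: "F \<subseteq> Z" unfolding F_def by (rule contraction_phase_subset[OF ni finite_V Zed k0])
  have heavy: "k i \<le> card (cut_edges Z A)" if "cut_edges (Z - F) A \<noteq> {}" for A
    by (rule contraction_phase_heavy[OF ni finite_V Zed k0 that[unfolded F_def]])
  \<comment> \<open>If the contraction phase discarded an edge, its loop was entered, so
    \<open>Z\<close> has more than \<open>2 * k i * card V\<close> edges. It has at most
    \<open>card V ^ 2\<close>, hence \<open>2 ^ i\<close> and with it \<open>i\<close> stay below
    \<open>card V\<close>.\<close>
  have small: "i < card V" if "Z - F \<noteq> {}"
  proof -
    have "\<not> real (card Z) \<le> 2 * k i * real (card V)"
      using contraction_phase_trivial[OF finite_V, of Z "k i" ni] that by (auto simp: F_def)
    then have "2 * k i * card V < real (card V) ^ 2" using card_subset_E[OF ZE] by linarith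
    then have "2 * k i < card V" using n2 by (simp add: power2_eq_square)
    moreover have "real (2 ^ i) \<le> 2 * k i" using rho_ge by (simp add: k_def)
    moreover have "real i < real (2 ^ i)" by (metis less_exp of_nat_less_iff)
    ultimately show ?thesis by linarith
  qed
  have eq: "next_run ni V \<rho> r Z =
      \<lparr>idx = i, Xs = (Xs r)(i := Z), Fs = (Fs r)(i := F), Ys = (Ys r)(i := Z - F)\<rparr>"
    by (simp add: next_run_def Let_def i_def F_def k_def)
  show ?thesis
    unfolding eq valid_run_def run.simps
  proof (intro conjI allI impI)
    show "i \<le> card V" by fact
    show "((Fs r)(i := F)) 0 \<noteq> {}" using valid_runD(2)[OF r] by (simp add: i_def)
  next
    fix j assume "j < i"
    then show "((Xs r)(i := Z)) (Suc j) \<subseteq> ((Ys r)(i := Z - F)) j"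
      using valid_runD(8)[OF r, of j] Z by (auto simp: i_def less_Suc_eq)
  next
    fix j assume j: "j \<le> i"
    then consider "j = i" | "j \<le> idx r" "j \<noteq> i" unfolding i_def by linarith
    note cs = this
    show "((Xs r)(i := Z)) j \<subseteq> E" using cs by cases (use ZE valid_runD(3)[OF r] in simp_all)
    show "((Fs r)(i := F)) j \<subseteq> ((Xs r)(i := Z)) j"
      using cs by cases (use sub valid_runD(4)[OF r] in simp_all)
    show "((Ys r)(i := Z - F)) j = ((Xs r)(i := Z)) j - ((Fs r)(i := F)) j"
      using cs by cases (use valid_runD(5)[OF r] in simp_all)
    show "k j \<le> card (cut_edges (((Xs r)(i := Z)) j) A)" if "cut_edges (((Ys r)(i := Z - F)) j) A \<noteq> {}" for A
      using cs by cases (use that heavy valid_runD(6)[OF r] in simp_all)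
    show "j < card V" if "((Ys r)(i := Z - F)) j \<noteq> {}"
      using cs by cases (use that small valid_runD(7)[OF r] in simp_all)
  qed
qed

lemma faithful_next:
  assumes "faithful_run r" "faithful_sample (idx r) (Xs r (idx r)) (Ys r (idx r)) Z"
  shows "faithful_run (next_run ni V \<rho> r Z)"
  using assms by (auto simp: faithful_run_def next_run_def Let_def less_Suc_eq)

text \<open>In \<open>\<delta> i\<close> squared times \<open>k i\<close> the accuracy cancels and
  leaves at least \<open>50700 / 19 / 162\<close>, about 16.47, times \<open>ln (card V)\<close>;
  required is \<open>7 * 2.24\<close>, that is 15.68. This explains the constant 1/18 in
  \<open>\<delta>\<close>.\<close>

lemma sampling_exponent: "7 * ln (card V) / k i \<le> (\<delta> i)\<^sup>2 * 1 / 2.24"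
proof -
  have "(\<delta> i)\<^sup>2 * k i = \<epsilon>\<^sup>2 * \<rho> / 162 * ((3 / 4) ^ i * (3 / 4) ^ i * 2 ^ i)"
    by (simp add: \<delta>_def k_def power2_eq_square)
  also have "(3 / 4) ^ i * (3 / 4) ^ i * 2 ^ i = (9 / 8 :: real) ^ i"
    by (simp flip: power_mult_distrib)
  finally have eq: "(\<delta> i)\<^sup>2 * k i = 50700 / 19 * ln (card V) / 162 * (9 / 8) ^ i"
    using eps by (simp add: rho_eq)
  have "50700 / 19 * ln (card V) / 162 * 1 \<le> 50700 / 19 * ln (card V) / 162 * (9 / 8) ^ i"
    using ln_n by (intro mult_left_mono one_le_power) auto
  moreover have "7 * ln (card V) * 2.24 \<le> 50700 / 19 * ln (card V) / 162 * 1"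
    using ln_n by simp
  ultimately have "7 * ln (card V) * 2.24 \<le> (\<delta> i)\<^sup>2 * k i" unfolding eq by linarith
  then have "7 * ln (card V) \<le> (\<delta> i)\<^sup>2 * k i / 2.24" by simp
  then show ?thesis using k_pos[of i] by (simp add: field_simps)
qed

text \<open>Twice the sampled cut minus the cut in \<open>Y\<close> is a sum of independent fair
  signs, so the tail bound with \<open>v = 1\<close> feeds \<open>cut_union_bound\<close>.\<close>

lemma prob_unfaithful_sample:
  assumes "X \<subseteq> E" "Y \<subseteq> X" and heavy: "\<And>A. cut_edges Y A \<noteq> {} \<Longrightarrow> k i \<le> card (cut_edges X A)"
  shows "measure_pmf.prob (random_half Y) {Z. \<not> faithful_sample i X Y Z} \<le> 8 / real (card V) ^ 3"
proof -
  have finX: "finite X" by (rule finite_subset[OF assms(1) finite_E])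
  have finY: "finite Y" by (rule finite_subset[OF assms(2) finX])
  define M where "M = Pi_pmf Y False (\<lambda>_. bernoulli_pmf (1 / 2))"
  define dev :: "'v set set \<Rightarrow> ('v set \<Rightarrow> bool) \<Rightarrow> real"
    where "dev P \<omega> = \<bar>\<Sum>e\<in>P. 2 * of_bool (\<omega> e) - 1\<bar>" for P \<omega>
  have "measure_pmf.prob M {\<omega>. \<exists>A. cut_edges Y A \<noteq> {} \<and> dev (cut_edges Y A) \<omega> > \<delta> i * card (cut_edges X A)} \<le> 8 / real (card V) ^ 3"
  proof (rule cut_union_bound[OF finite_V n2 _ \<open>Y \<subseteq> X\<close> k_pos heavy])
    show "e \<subseteq> V \<and> card e = 2" if "e \<in> X" for e using edge that assms(1) by blast
    show "0 \<le> \<delta> i" using delta_pos[of i] by linarith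
    fix P and s :: real assume P: "P \<subseteq> Y" "real (card P) \<le> s"
    have "measure_pmf.prob M {\<omega>. dev P \<omega> > \<delta> i * 1 * s} \<le> 2 * exp (- ((\<delta> i)\<^sup>2 * 1 / 2.24) * s)"
      unfolding M_def dev_def
    proof (rule Pi_pmf_two_sided_tail[OF finY P(1) _ _ _ _ P(2)])
      show "\<delta> i \<le> 0.112" using delta_le[of i] by simp
    qed (use delta_pos mgf_fair_sign in auto)
    also have "\<dots> \<le> 2 * exp (- (7 * ln (card V) / k i) * s)"
    proof -
      have "0 \<le> s" using P(2) by linarith
      then have "7 * ln (card V) / k i * s \<le> (\<delta> i)\<^sup>2 * 1 / 2.24 * s"
        using sampling_exponent by (rule mult_right_mono[rotated])
      then show ?thesis by simp
    qed
    finally show "measure_pmf.prob M {\<omega>. dev P \<omega> > \<delta> i * s} \<le> 2 * exp (- (7 * ln (card V) / k i) * s)"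
      by simp
  qed
  moreover have "{\<omega>. \<not> faithful_sample i X Y {e \<in> Y. \<omega> e}} \<subseteq>
      {\<omega>. \<exists>A. cut_edges Y A \<noteq> {} \<and> dev (cut_edges Y A) \<omega> > \<delta> i * card (cut_edges X A)}"
  proof
    fix \<omega> assume "\<omega> \<in> {\<omega>. \<not> faithful_sample i X Y {e \<in> Y. \<omega> e}}"
    then obtain A where A: "\<bar>2 * real (card (cut_edges {e \<in> Y. \<omega> e} A)) - card (cut_edges Y A)\<bar> > \<delta> i * card (cut_edges X A)"
      unfolding faithful_sample_def by (auto simp: not_le)
    have fin: "finite (cut_edges Y A)" using finY by (rule finite_cut_edges)
    have "cut_edges {e \<in> Y. \<omega> e} A = {e \<in> cut_edges Y A. \<omega> e}" by (auto simp: cut_edges_def)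
    then have "real (card (cut_edges {e \<in> Y. \<omega> e} A)) = (\<Sum>e\<in>cut_edges Y A. of_bool (\<omega> e))"
      using fin by (simp add: of_nat_card_filter of_bool_def)
    then have "dev (cut_edges Y A) \<omega> = \<bar>2 * real (card (cut_edges {e \<in> Y. \<omega> e} A)) - card (cut_edges Y A)\<bar>"
      by (simp add: dev_def sum_subtractf flip: sum_distrib_left)
    then have dev: "dev (cut_edges Y A) \<omega> > \<delta> i * card (cut_edges X A)" using A by simp
    moreover have "0 \<le> \<delta> i * card (cut_edges X A)" using delta_pos[of i] by simp
    \<comment> \<open>A cut that misses \<open>Y\<close> has deviation 0 and cannot violate the
      bound.\<close>
    ultimately have "cut_edges Y A \<noteq> {}" by (auto simp: dev_def)
    then show "\<omega> \<in> {\<omega>. \<exists>A. cut_edges Y A \<noteq> {} \<and> dev (cut_edges Y A) \<omega> > \<delta> i * card (cut_edges X A)}" using dev by blast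
  qed
  then have "measure_pmf.prob M {\<omega>. \<not> faithful_sample i X Y {e \<in> Y. \<omega> e}} \<le>
      measure_pmf.prob M {\<omega>. \<exists>A. cut_edges Y A \<noteq> {} \<and> dev (cut_edges Y A) \<omega> > \<delta> i * card (cut_edges X A)}"
    by (intro measure_pmf.finite_measure_mono) auto
  ultimately show ?thesis by (simp add: random_half_def M_def vimage_def)
qed

text \<open>Induction on the number \<open>d\<close> of rounds still possible. Equality with
  \<open>spmf_of_pmf p\<close> expresses termination with probability 1; each round adds at most
  \<open>8 / n ^ 3\<close>, with \<open>n = card V\<close>, to the probability of becoming
  unfaithful.\<close>

lemma sampling_loop_pmf:
  assumes "valid_run r" "card V - idx r = d"
  shows "\<exists>p. sampling_loop ni V \<rho> r = spmf_of_pmf p \<and>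
     (faithful_run r \<longrightarrow> measure_pmf.prob p {r'. \<not> (valid_run r' \<and> faithful_run r')} \<le> d * (8 / real (card V) ^ 3))"
  using assms
proof (induction d arbitrary: r rule: less_induct)
  case (less d r)
  define \<eta> where "\<eta> = 8 / real (card V) ^ 3"
  have \<eta>0: "0 \<le> \<eta>" by (simp add: \<eta>_def)
  define Y where "Y = Ys r (idx r)"
  show ?case
  proof (cases "real (card Y) \<le> 2 * \<rho> * real (card V)")
    case True
    then have "sampling_loop ni V \<rho> r = spmf_of_pmf (return_pmf r)"
      by (subst sampling_loop.simps) (simp add: Y_def)
    then show ?thesis using less.prems(1) by (intro exI[of _ "return_pmf r"]) auto
  next
    case False
    have "0 \<le> 2 * \<rho> * real (card V)" using rho_ge by simp
    then have Y: "Y \<noteq> {}" using False by auto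
    have idx: "idx r < card V" using valid_runD(7)[OF less.prems(1) order_refl] Y by (simp add: Y_def)
    have YX: "Y \<subseteq> Xs r (idx r)" "Xs r (idx r) \<subseteq> E"
      using valid_runD(3,5)[OF less.prems(1) order_refl] by (auto simp: Y_def)
    have supp: "Z \<subseteq> Y" if "Z \<in> set_pmf (random_half Y)" for Z
      using that by (auto simp: random_half_def)
    \<comment> \<open>The recursive distributions are chosen on the support only, where
      \<open>Z\<close> is a subset of \<open>Y\<close> and the next run is valid.\<close>
    have "\<exists>P. \<forall>Z\<in>set_pmf (random_half Y). sampling_loop ni V \<rho> (next_run ni V \<rho> r Z) = spmf_of_pmf (P Z) \<and>
      (faithful_run (next_run ni V \<rho> r Z) \<longrightarrow>
        measure_pmf.prob (P Z) {r'. \<not> (valid_run r' \<and> faithful_run r')} \<le> real (d - 1) * \<eta>)"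
      unfolding \<eta>_def
    proof (intro bchoice ballI less.IH)
      fix Z assume "Z \<in> set_pmf (random_half Y)"
      then show "valid_run (next_run ni V \<rho> r Z)"
        using valid_next less.prems(1) Y supp unfolding Y_def by blast
      show "d - 1 < d" "card V - idx (next_run ni V \<rho> r Z) = d - 1"
        using idx less.prems(2) by (auto simp: next_run_def Let_def)
    qed
    then obtain P where P: "\<And>Z. Z \<in> set_pmf (random_half Y) \<Longrightarrow> sampling_loop ni V \<rho> (next_run ni V \<rho> r Z) = spmf_of_pmf (P Z)"
      "\<And>Z. Z \<in> set_pmf (random_half Y) \<Longrightarrow> faithful_run (next_run ni V \<rho> r Z) \<Longrightarrow>
        measure_pmf.prob (P Z) {r'. \<not> (valid_run r' \<and> faithful_run r')} \<le> real (d - 1) * \<eta>"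
      by blast
    have "sampling_loop ni V \<rho> r = bind_pmf (random_half Y) (\<lambda>Z. sampling_loop ni V \<rho> (next_run ni V \<rho> r Z))"
      using False by (subst sampling_loop.simps) (simp add: Y_def)
    also have "\<dots> = bind_pmf (random_half Y) (\<lambda>Z. spmf_of_pmf (P Z))"
      using P(1) by (intro bind_pmf_cong refl) auto
    also have "\<dots> = spmf_of_pmf (bind_pmf (random_half Y) P)" by (simp add: spmf_of_pmf_bind)
    finally have eq: "sampling_loop ni V \<rho> r = spmf_of_pmf (bind_pmf (random_half Y) P)" .
    have "measure_pmf.prob (bind_pmf (random_half Y) P) {r'. \<not> (valid_run r' \<and> faithful_run r')} \<le> real d * \<eta>"
      if r: "faithful_run r"
    proof -
      have "measure_pmf.prob (bind_pmf (random_half Y) P) {r'. \<not> (valid_run r' \<and> faithful_run r')} \<le> \<eta> + real (d - 1) * \<eta>"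
      proof (rule prob_bind_pmf_le)
        show "measure_pmf.prob (random_half Y) {Z. \<not> faithful_sample (idx r) (Xs r (idx r)) Y Z} \<le> \<eta>"
          unfolding \<eta>_def Y_def
          by (intro prob_unfaithful_sample YX[unfolded Y_def] valid_runD(6)[OF less.prems(1) order_refl])
        show "0 \<le> real (d - 1) * \<eta>" using \<eta>0 by simp
        fix Z assume "Z \<in> set_pmf (random_half Y)" "Z \<notin> {Z. \<not> faithful_sample (idx r) (Xs r (idx r)) Y Z}"
        then show "measure_pmf.prob (P Z) {r'. \<not> (valid_run r' \<and> faithful_run r')} \<le> real (d - 1) * \<eta>"
          using faithful_next[OF r] by (intro P(2)) (auto simp: Y_def)
      qed
      also have "\<dots> = real d * \<eta>"
        using idx less.prems(2) by (simp add: algebra_simps of_nat_diff)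
      finally show ?thesis .
    qed
    then show ?thesis using eq unfolding \<eta>_def by blast
  qed
qed

end

section \<open>Comparing cuts of the output with cuts of the intermediate graph\<close>

section \<open>The output graph\<close>

text \<open>Exchange of summation: \<open>f j\<close> occurs with the powers \<open>2 ^ i\<close>
  for \<open>i \<le> j + 1\<close>, which sum to at most \<open>2 ^ (j + 2)\<close>;
  \<open>y\<close> occurs for \<open>i \<le> K\<close>, with sum at most
  \<open>2 ^ (K + 1)\<close>.\<close>

lemma sum_tails_le:
  fixes f :: "nat \<Rightarrow> real" and y :: real
  assumes f: "\<And>j. 0 \<le> f j" and y: "0 \<le> y"
  shows "(\<Sum>i\<in>{2..K}. 2 ^ i * ((\<Sum>j\<in>{i - 1..K}. f j) + y)) \<le> 4 * ((\<Sum>j\<in>{0..K}. 2 ^ j * f j) + 2 ^ K * y)"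
proof -
  have geo: "(\<Sum>i\<in>{2..K}. if i \<le> m then 2 ^ i else 0) \<le> (2 :: real) ^ (m + 1)" for m
  proof -
    have "(\<Sum>i\<in>{2..K}. if i \<le> m then 2 ^ i else 0) = (\<Sum>i\<in>{i\<in>{2..K}. i \<le> m}. (2 :: real) ^ i)"
      by (rule sum.inter_filter[symmetric]) simp
    also have "\<dots> \<le> (\<Sum>i\<in>{..<Suc m}. (2 :: real) ^ i)" by (intro sum_mono2) auto
    also have "\<dots> \<le> 2 ^ (m + 1)" using geometric_sum[of "2 :: real" "Suc m"] by simp
    finally show ?thesis .
  qed
  have "(\<Sum>i\<in>{2..K}. 2 ^ i * (\<Sum>j\<in>{i - 1..K}. f j)) =
      (\<Sum>i\<in>{2..K}. \<Sum>j\<in>{0..K}. (if i \<le> j + 1 then 2 ^ i else 0) * f j)"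
  proof (intro sum.cong refl)
    fix i assume "i \<in> {2..K}"
    then have "{i - 1..K} = {j \<in> {0..K}. i \<le> j + 1}" by auto
    then have eq: "(\<Sum>j\<in>{i - 1..K}. f j) = (\<Sum>j\<in>{0..K}. if i \<le> j + 1 then f j else 0)"
      by (simp only: sum.inter_filter finite_atLeastAtMost)
    show "2 ^ i * (\<Sum>j\<in>{i - 1..K}. f j) = (\<Sum>j\<in>{0..K}. (if i \<le> j + 1 then 2 ^ i else 0) * f j)"
      unfolding eq sum_distrib_left by (intro sum.cong refl) simp
  qed
  also have "\<dots> = (\<Sum>j\<in>{0..K}. (\<Sum>i\<in>{2..K}. if i \<le> j + 1 then 2 ^ i else 0) * f j)"
    unfolding sum_distrib_right by (rule sum.swap)
  also have "\<dots> \<le> (\<Sum>j\<in>{0..K}. 2 ^ (j + 1 + 1) * f j)"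
    by (intro sum_mono mult_right_mono geo f)
  also have "\<dots> = 4 * (\<Sum>j\<in>{0..K}. 2 ^ j * f j)" by (simp add: sum_distrib_left mult.assoc)
  finally have 1: "(\<Sum>i\<in>{2..K}. 2 ^ i * (\<Sum>j\<in>{i - 1..K}. f j)) \<le> 4 * (\<Sum>j\<in>{0..K}. 2 ^ j * f j)" .
  have "(\<Sum>i\<in>{2..K}. 2 ^ i) = (\<Sum>i\<in>{2..K}. if i \<le> K then 2 ^ i else (0 :: real))"
    by (intro sum.cong) auto
  then have "(\<Sum>i\<in>{2..K}. 2 ^ i) * y \<le> 2 ^ (K + 1) * y" using geo[of K] y by (intro mult_right_mono) auto
  moreover have "(\<Sum>i\<in>{2..K}. 2 ^ i * y) = (\<Sum>i\<in>{2..K}. 2 ^ i) * y" by (simp add: sum_distrib_right)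
  moreover have "2 ^ (K + 1) * y = 2 * (2 ^ K * y)" by simp
  moreover have "0 \<le> 2 ^ K * y" using y by simp
  ultimately have 2: "(\<Sum>i\<in>{2..K}. 2 ^ i * y) \<le> 4 * (2 ^ K * y)" by linarith
  show ?thesis using 1 2 by (simp add: distrib_left sum.distrib)
qed

context dense_graph
begin

text \<open>The set \<open>F\<close> of index \<open>i - 1\<close> is included because a heavy cut
  of round \<open>i - 1\<close> may have most of its edges there rather than in the rest from which
  round \<open>i\<close> is sampled.\<close>

definition U :: "'v run \<Rightarrow> nat \<Rightarrow> 'v set set" where
  "U r i = (\<Union>j\<in>{i - 1..top_index r}. Fs r j) \<union> Ys r (top_index r)"

definition weight_S :: "'v run \<Rightarrow> 'v set \<Rightarrow> real" where
  "weight_S r A = (\<Sum>i\<in>{0..top_index r}. 2 ^ i * real (card (cut_edges (Fs r i) A))) +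
     2 ^ top_index r * real (card (cut_edges (Ys r (top_index r)) A))"

lemma top_index_le:
  assumes "valid_run r"
  shows "top_index r \<le> idx r"
    and "\<And>i. i \<le> idx r \<Longrightarrow> top_index r < i \<Longrightarrow> Fs r i = {}"
proof -
  define S where "S = {i. i \<le> idx r \<and> Fs r i \<noteq> {}}"
  have "0 \<in> S" using valid_runD(2)[OF assms] by (simp add: S_def)
  moreover have fin: "finite S" by (simp add: S_def)
  ultimately have "Max S \<in> S" by (intro Max_in) auto
  moreover have eq: "top_index r = Max S" by (simp add: top_index_def S_def)
  ultimately show "top_index r \<le> idx r" by (simp add: S_def)
  show "Fs r i = {}" if "i \<le> idx r" "top_index r < i" for i
  proof (rule ccontr)
    assume "Fs r i \<noteq> {}"
    then have "i \<in> S" using that by (simp add: S_def)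
    then have "i \<le> Max S" using fin by (rule Max_ge[rotated])
    then show False using that(2) eq by simp
  qed
qed

context
  fixes r
  assumes valid: "valid_run r" and faithful: "faithful_run r"
begin

private abbreviation "K \<equiv> top_index r"
private definition "x i A = real (card (cut_edges (Xs r i) A))"
private definition "f i A = real (card (cut_edges (Fs r i) A))"
private definition "y i A = real (card (cut_edges (Ys r i) A))"
private definition "u i A = real (card (cut_edges (U r i) A))"

lemmas K_le = top_index_le(1)[OF valid]

lemma finite_X: "i \<le> idx r \<Longrightarrow> finite (Xs r i)"
  using valid_runD(3)[OF valid] finite_E finite_subset by blast

lemma finite_F: "i \<le> idx r \<Longrightarrow> finite (Fs r i)"
  using valid_runD(4)[OF valid] finite_X finite_subset by blast

lemma finite_Y: "i \<le> idx r \<Longrightarrow> finite (Ys r i)"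
  using valid_runD(5)[OF valid] finite_X by simp

lemma x_eq: "i \<le> idx r \<Longrightarrow> x i A = f i A + y i A"
proof -
  assume i: "i \<le> idx r"
  have "Xs r i = Fs r i \<union> Ys r i" "Fs r i \<inter> Ys r i = {}"
    using valid_runD(4,5)[OF valid i] by auto
  then have "cut_edges (Xs r i) A = cut_edges (Fs r i) A \<union> cut_edges (Ys r i) A" "cut_edges (Fs r i) A \<inter> cut_edges (Ys r i) A = {}"
    by (auto simp: cut_edges_def)
  then show ?thesis
    using finite_cut_edges[OF finite_F[OF i]] finite_cut_edges[OF finite_Y[OF i]]
    by (simp add: x_def f_def y_def card_Un_disjoint)
qed

lemma nonneg: "0 \<le> x i A" "0 \<le> f i A" "0 \<le> y i A"
  by (simp_all add: x_def f_def y_def)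

lemma sample: "i < idx r \<Longrightarrow> \<bar>2 * x (Suc i) A - y i A\<bar> \<le> \<delta> i * x i A"
  using faithful by (simp add: faithful_run_def faithful_sample_def x_def y_def)

lemma finite_U: "finite (U r i)"
  unfolding U_def using K_le by (auto intro!: finite_F finite_Y)

lemma U_subset: "U r i \<subseteq> E"
proof -
  have F: "Fs r j \<subseteq> E" if "j \<le> idx r" for j using valid_runD(3,4)[OF valid that] by blast
  have Y: "Ys r j \<subseteq> E" if "j \<le> idx r" for j using valid_runD(3,5)[OF valid that] by blast
  show ?thesis unfolding U_def using K_le by (intro Un_least UN_least F Y) auto
qed

lemma u_ge: "cut_edges Z A \<subseteq> cut_edges (U r i) A \<Longrightarrow> real (card (cut_edges Z A)) \<le> u i A"
  unfolding u_def using finite_cut_edges[OF finite_U] by (simp add: card_mono)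

lemma card_cut_edges_Un:
  assumes "finite Y" "finite Z" "Y \<inter> Z = {}"
  shows "card (cut_edges (Y \<union> Z) A) = card (cut_edges Y A) + card (cut_edges Z A)"
  unfolding cut_edges_Un using assms finite_cut_edges by (intro card_Un_disjoint) (auto simp: cut_edges_def)

text \<open>Downward induction from \<open>K\<close>. The cut has at least \<open>k (i - 1)\<close>
  edges in round \<open>i - 1\<close>, which lie in \<open>F\<close> of that round or are halved
  into \<open>X\<close> of round \<open>i\<close>; together these two sets have at least
  \<open>17 / 18 * \<rho> * 2 ^ (i - 1)\<close> cut edges. For \<open>i = K\<close> both lie in
  \<open>U r i\<close>. If the cut dies out in round \<open>i + 1\<close>, faithfulness puts all but
  1/18 of it into \<open>F\<close> of round \<open>i\<close>, at the price of a second factor 17/18.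
  Otherwise the subset \<open>U r (i + 1)\<close> is already heavy enough.\<close>

lemma heavy_from_top:
  assumes "1 \<le> i" "i \<le> K" "cut_edges (Xs r i) A \<noteq> {}"
  shows "(17 / 18)\<^sup>2 * \<rho> * 2 ^ (i - 1) \<le> u i A"
  using assms
proof (induction "K - i" arbitrary: i rule: less_induct)
  case (less i)
  note i = less.prems
  have i_idx: "i \<le> idx r" "i - 1 < idx r" using i K_le by auto
  have Si: "Suc (i - 1) = i" using i by simp
  have XY: "Xs r i \<subseteq> Ys r (i - 1)" using valid_runD(8)[OF valid i_idx(2)] Si by simp
  have "cut_edges (Ys r (i - 1)) A \<noteq> {}" using i(3) cut_edges_mono[OF XY, of A] by auto
  then have "k (i - 1) \<le> x (i - 1) A"
    using valid_runD(6)[OF valid, of "i - 1" A] i_idx(2) by (simp add: x_def)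
  then have x1: "\<rho> * 2 * 2 ^ (i - 1) \<le> x (i - 1) A" by (simp add: k_def mult_ac)
  have smp: "\<bar>2 * x i A - y (i - 1) A\<bar> \<le> \<delta> (i - 1) * x (i - 1) A"
    using sample[OF i_idx(2), of A] Si by simp
  have d1: "\<delta> (i - 1) * x (i - 1) A \<le> 1 / 18 * x (i - 1) A"
    by (intro mult_right_mono delta_le nonneg)
  have xe: "x (i - 1) A = f (i - 1) A + y (i - 1) A" using x_eq[of "i - 1"] i_idx(2) by simp
  have pos: "0 \<le> \<rho> * 2 ^ (i - 1)" using rho_ge by simp
  have disj: "Fs r (i - 1) \<inter> Xs r i = {}"
    using XY valid_runD(5)[OF valid, of "i - 1"] i_idx(2) by auto
  have sum_le: "f (i - 1) A + real (card (cut_edges Z A)) \<le> u i A" if Z: "Z \<subseteq> Xs r i" "Z \<subseteq> U r i" for Z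
  proof -
    have "Fs r (i - 1) \<subseteq> U r i" using i unfolding U_def by force
    then have sub: "cut_edges (Fs r (i - 1) \<union> Z) A \<subseteq> cut_edges (U r i) A" using Z(2) by (intro cut_edges_mono) blast
    have "card (cut_edges (Fs r (i - 1) \<union> Z) A) = card (cut_edges (Fs r (i - 1)) A) + card (cut_edges Z A)"
      using Z(1) disj i_idx finite_F[of "i - 1"] finite_subset[OF Z(1) finite_X]
      by (intro card_cut_edges_Un) auto
    then show ?thesis using u_ge[OF sub] by (simp add: f_def)
  qed
  show ?case
  proof (cases "i = K")
    case True
    have "Xs r i = Fs r i \<union> Ys r i" using valid_runD(4,5)[OF valid i_idx(1)] by auto
    then have "Xs r i \<subseteq> U r i" unfolding U_def True using i by force
    then have "f (i - 1) A + x i A \<le> u i A" using sum_le[of "Xs r i"] by (simp add: x_def)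
    moreover have "0 \<le> f (i - 1) A" by (rule nonneg)
    ultimately have "17 / 18 * (\<rho> * 2 ^ (i - 1)) \<le> u i A" using smp d1 xe x1 by linarith
    moreover have "(17 / 18)\<^sup>2 * (\<rho> * 2 ^ (i - 1)) \<le> 17 / 18 * (\<rho> * 2 ^ (i - 1))"
      using pos by (intro mult_right_mono) (auto simp: power2_eq_square)
    ultimately show ?thesis by (simp add: mult.assoc)
  next
    case False
    then have iK: "i < K" using i by simp
    show ?thesis
    proof (cases "cut_edges (Xs r (Suc i)) A = {}")
      case True
      then have "x (Suc i) A = 0" by (simp add: x_def)
      moreover have "i < idx r" using iK K_le by simp
      ultimately have "y i A \<le> \<delta> i * x i A" using sample[of i A] nonneg(3)[of i A] by simp
      moreover have "\<delta> i * x i A \<le> 1 / 18 * x i A" by (intro mult_right_mono delta_le nonneg)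
      moreover have "x i A = f i A + y i A" using x_eq[OF i_idx(1)] .
      ultimately have fi: "17 / 18 * x i A \<le> f i A" by linarith
      have "Fs r i \<subseteq> U r i" unfolding U_def using i by force
      then have "f (i - 1) A + f i A \<le> u i A"
        using sum_le[of "Fs r i"] valid_runD(4)[OF valid i_idx(1)] by (simp add: f_def)
      moreover have "0 \<le> f (i - 1) A" by (rule nonneg)
      ultimately have "17 / 18 * (17 / 18 * (\<rho> * 2 ^ (i - 1))) \<le> u i A"
        using fi smp d1 xe x1 by linarith
      then show ?thesis by (simp add: power2_eq_square mult.assoc)
    next
      case False
      then have "(17 / 18)\<^sup>2 * \<rho> * 2 ^ (Suc i - 1) \<le> u (Suc i) A"
        using iK by (intro less.hyps) auto
      moreover have "(17 / 18)\<^sup>2 * \<rho> * 2 ^ (i - 1) \<le> (17 / 18)\<^sup>2 * \<rho> * 2 ^ (Suc i - 1)"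
        using rho_ge by (intro mult_left_mono power_increasing) auto
      moreover have "U r (Suc i) \<subseteq> U r i" unfolding U_def by (intro Un_mono UN_mono) auto
      then have "u (Suc i) A \<le> u i A" using u_ge cut_edges_mono unfolding u_def by blast
      ultimately show ?thesis by linarith
    qed
  qed
qed

lemma u_heavy:
  assumes "1 \<le> i" "i \<le> K" "cut_edges (Fs r i) A \<noteq> {}"
  shows "(17 / 18)\<^sup>2 * \<rho> * 2 ^ (i - 1) \<le> real (card (cut_edges (U r i) A))"
proof -
  have "Fs r i \<subseteq> Xs r i" using valid_runD(4)[OF valid] assms K_le by simp
  then have "cut_edges (Xs r i) A \<noteq> {}" using assms(3) cut_edges_mono[of "Fs r i" "Xs r i" A] by auto
  then show ?thesis using heavy_from_top[OF assms(1,2)] by (simp add: u_def)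
qed

lemma U_contains: "1 \<le> i \<Longrightarrow> i \<le> K \<Longrightarrow> Fs r i \<subseteq> U r i"
  unfolding U_def by force

lemma sum_U_le: "(\<Sum>i\<in>{2..K}. 2 ^ i * real (card (cut_edges (U r i) A))) \<le> 4 * weight_S r A"
proof -
  have "real (card (cut_edges (U r i) A)) \<le> (\<Sum>j\<in>{i - 1..K}. f j A) + y K A" for i
  proof -
    have "cut_edges (U r i) A = (\<Union>j\<in>{i - 1..K}. cut_edges (Fs r j) A) \<union> cut_edges (Ys r K) A" by (auto simp: U_def cut_edges_def)
    then have "card (cut_edges (U r i) A) \<le> card (\<Union>j\<in>{i - 1..K}. cut_edges (Fs r j) A) + card (cut_edges (Ys r K) A)"
      by (simp add: card_Un_le)
    also have "\<dots> \<le> (\<Sum>j\<in>{i - 1..K}. card (cut_edges (Fs r j) A)) + card (cut_edges (Ys r K) A)"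
      by (intro add_right_mono card_UN_le) simp
    finally show ?thesis unfolding f_def y_def by (simp flip: of_nat_sum of_nat_add)
  qed
  then have "(\<Sum>i\<in>{2..K}. 2 ^ i * real (card (cut_edges (U r i) A))) \<le>
      (\<Sum>i\<in>{2..K}. 2 ^ i * ((\<Sum>j\<in>{i - 1..K}. f j A) + y K A))"
    by (intro sum_mono mult_left_mono) auto
  also have "\<dots> \<le> 4 * ((\<Sum>j\<in>{0..K}. 2 ^ j * f j A) + 2 ^ K * y K A)"
    by (intro sum_tails_le nonneg)
  finally show ?thesis by (simp add: weight_S_def f_def y_def)
qed

text \<open>The sum telescopes, as \<open>\<delta> l\<close> is \<open>2 / 9 * \<epsilon>\<close>
  times the difference of consecutive powers of 3/4.\<close>

lemma sum_delta_le: "(\<Sum>l\<in>{K..<m}. \<delta> l) \<le> 2 / 9 * \<epsilon> * (3 / 4) ^ K"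
proof (cases "K \<le> m")
  case True
  have "(\<Sum>l\<in>{K..<m}. \<delta> l) = 2 / 9 * \<epsilon> * ((3 / 4) ^ K - (3 / 4) ^ m)"
    using True by (induction m rule: dec_induct) (simp_all add: \<delta>_def algebra_simps)
  also have "\<dots> \<le> 2 / 9 * \<epsilon> * (3 / 4) ^ K" using eps by (intro mult_left_mono) auto
  finally show ?thesis .
qed (use eps in simp)

text \<open>After round \<open>K\<close> every \<open>F\<close> is empty, so \<open>2 ^ m\<close>
  times the cut in \<open>Y\<close> only drifts, in each round by at most \<open>\<delta> m\<close>
  times the scaled cut in \<open>X\<close>. That cut stays below \<open>13 / 10\<close> of its
  scaled value at \<open>K\<close>, because
  \<open>1 + 13 / 10 * 2 / 9 \<le> 13 / 10\<close>.\<close>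

lemma tail_error:
  "\<bar>2 ^ idx r * real (card (cut_edges (Ys r (idx r)) A)) - 2 ^ K * real (card (cut_edges (Ys r K) A))\<bar> \<le>
     13 / 45 * \<epsilon> * (3 / 4) ^ K * weight_S r A"
proof -
  define S where "S m = (\<Sum>l\<in>{K..<m}. \<delta> l)" for m
  define X where "X = 2 ^ K * x K A"
  have X0: "0 \<le> X" using nonneg(1) by (simp add: X_def)
  have S_le: "S m \<le> 2 / 9 * \<epsilon> * (3 / 4) ^ K" for m unfolding S_def by (rule sum_delta_le)
  have S_le': "S m \<le> 2 / 9" for m
  proof -
    have "2 / 9 * \<epsilon> * (3 / 4) ^ K \<le> 2 / 9 * 1 * 1"
      using eps by (intro mult_mono power_le_one) auto
    then show ?thesis using S_le[of m] by linarith
  qed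
  have "\<bar>2 ^ m * y m A - 2 ^ K * y K A\<bar> \<le> 13 / 10 * S m * X" if "K \<le> m" "m \<le> idx r" for m
    using that
  proof (induction m rule: dec_induct)
    case base
    then show ?case by (simp add: S_def)
  next
    case (step m)
    then have m: "m < idx r" and IH: "\<bar>2 ^ m * y m A - 2 ^ K * y K A\<bar> \<le> 13 / 10 * S m * X" by auto
    have "2 ^ m * x m A \<le> 13 / 10 * X"
    proof (cases "m = K")
      case True
      then show ?thesis using nonneg(1)[of K A] by (simp add: X_def)
    next
      case False
      then have "Fs r m = {}" using top_index_le(2)[OF valid, of m] step m by simp
      then have "2 ^ m * x m A = 2 ^ m * y m A" using x_eq[of m A] m by (simp add: f_def cut_edges_def)
      moreover have "2 ^ K * y K A \<le> X" unfolding X_def using x_eq[OF K_le, of A] nonneg(2)[of K A] by simp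
      moreover have "13 / 10 * S m * X \<le> 3 / 10 * X"
        using S_le'[of m] X0 by (intro mult_right_mono) auto
      ultimately show ?thesis using IH X0 by linarith
    qed
    then have "\<delta> m * (2 ^ m * x m A) \<le> \<delta> m * (13 / 10 * X)"
      using delta_pos[of m] by (intro mult_left_mono) auto
    moreover have "Fs r (Suc m) = {}" using top_index_le(2)[OF valid, of "Suc m"] step m by simp
    then have "y (Suc m) A = x (Suc m) A" using x_eq[of "Suc m" A] m by (simp add: f_def cut_edges_def)
    then have "2 ^ Suc m * y (Suc m) A - 2 ^ m * y m A = 2 ^ m * (2 * x (Suc m) A - y m A)"
      by (simp add: algebra_simps)
    then have "\<bar>2 ^ Suc m * y (Suc m) A - 2 ^ m * y m A\<bar> = 2 ^ m * \<bar>2 * x (Suc m) A - y m A\<bar>"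
      by (simp add: abs_mult)
    moreover have "2 ^ m * \<bar>2 * x (Suc m) A - y m A\<bar> \<le> 2 ^ m * (\<delta> m * x m A)"
      by (intro mult_left_mono sample m) simp
    moreover have "2 ^ m * (\<delta> m * x m A) = \<delta> m * (2 ^ m * x m A)" by simp
    ultimately have "\<bar>2 ^ Suc m * y (Suc m) A - 2 ^ m * y m A\<bar> \<le> \<delta> m * (13 / 10 * X)"
      by linarith
    moreover have "13 / 10 * S (Suc m) * X = 13 / 10 * S m * X + \<delta> m * (13 / 10 * X)"
      using step by (simp add: S_def algebra_simps)
    ultimately show ?case using IH by linarith
  qed
  from this[OF K_le order_refl]
  have "\<bar>2 ^ idx r * y (idx r) A - 2 ^ K * y K A\<bar> \<le> 13 / 10 * S (idx r) * X" .
  also have "\<dots> \<le> 13 / 10 * (2 / 9 * \<epsilon> * (3 / 4) ^ K) * X"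
    using X0 S_le by (intro mult_right_mono mult_left_mono) auto
  also have "\<dots> \<le> 13 / 10 * (2 / 9 * \<epsilon> * (3 / 4) ^ K) * weight_S r A"
  proof (rule mult_left_mono)
    have "2 ^ K * f K A \<le> (\<Sum>i\<in>{0..K}. 2 ^ i * f i A)"
      using nonneg by (intro member_le_sum) auto
    then show "X \<le> weight_S r A"
      using x_eq[OF K_le, of A] by (simp add: X_def weight_S_def f_def y_def distrib_left)
  qed (use eps in simp)
  finally show ?thesis by (simp add: y_def)
qed


section \<open>Accuracy of the binomial draws in the final phase\<close>

lemma sample_prob_1: "sample_prob 1 = 1"
  \<comment> \<open>The exponent is -7 and the quotient 384/169 exceeds 1, so the minimum is 1 and a
    draw in round 1 always returns 2.\<close>
  by (simp add: sample_prob_def power_int_minus)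

text \<open>From \<open>i = 2\<close> on, where the quotient is 96/169, the minimum is attained by
  the quotient.\<close>

lemma sample_prob_ge_2:
  assumes "2 \<le> i"
  shows "sample_prob i = 1536 / (169 * 4 ^ i)" "0 < sample_prob i" "sample_prob i \<le> 1"
proof -
  have "(2 :: real) powi (2 * int i - 9) = 2 powi (int (2 * i)) / 2 powi 9"
    by (subst power_int_diff) auto
  also have "\<dots> = 4 ^ i / 512" by (simp only: power_int_of_nat power_mult) simp
  finally have "(2 :: real) powi (2 * int i - 9) = 4 ^ i / 512" .
  then have eq: "3 / (169 * (2 :: real) powi (2 * int i - 9)) = 1536 / (169 * 4 ^ i)" by (simp only:) simp
  have "(4 :: real) ^ 2 \<le> 4 ^ i" using assms by (intro power_increasing) auto
  then have "1536 / (169 * (4 :: real) ^ i) \<le> 1" by simp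
  then show *: "sample_prob i = 1536 / (169 * 4 ^ i)" unfolding sample_prob_def eq by simp
  show "0 < sample_prob i" "sample_prob i \<le> 1" using \<open>1536 / (169 * (4 :: real) ^ i) \<le> 1\<close> unfolding * by simp_all
qed

text \<open>The product \<open>sample_prob i * 2 ^ i * 2 ^ (i - 1)\<close> is 768/169 for every such
  \<open>i\<close>, so all rounds have the same exponent. With accuracy
  \<open>\<epsilon> / 25\<close> it leaves about 17.3 times \<open>ln (card V)\<close> against the
  required \<open>7 * 2.24\<close>.\<close>

lemma compression_exponent:
  assumes "2 \<le> i"
  shows "7 * ln (card V) / ((17 / 18)\<^sup>2 * \<rho> * 2 ^ (i - 1)) \<le> (\<epsilon> / 25)\<^sup>2 * (sample_prob i * 2 ^ i) / 2.24"
proof -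
  define m where "m = (17 / 18)\<^sup>2 * \<rho> * 2 ^ (i - 1)"
  have m: "0 < m" using rho_ge by (simp add: m_def)
  have "(4 :: real) ^ i = 2 ^ i * 2 ^ i" by (simp flip: power_mult_distrib)
  also have "\<dots> = 2 ^ i * (2 * 2 ^ (i - 1))" using assms by (cases i) auto
  finally have "sample_prob i * 2 ^ i * 2 ^ (i - 1) = 768 / 169"
    using sample_prob_ge_2(1)[OF assms] by simp
  then have "(\<epsilon> / 25)\<^sup>2 * (sample_prob i * 2 ^ i) * m = (\<epsilon> / 25)\<^sup>2 * (17 / 18)\<^sup>2 * \<rho> * (768 / 169)"
    by (simp add: m_def mult_ac)
  also have "\<dots> = 50700 / 19 * ln (card V) / 625 * (17 / 18)\<^sup>2 * (768 / 169)"
    using eps by (simp add: rho_eq power_divide)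
  also have "\<dots> \<ge> 7 * ln (card V) * 2.24" using ln_n by (simp add: power2_eq_square)
  finally show ?thesis unfolding m_def[symmetric] using m by (simp add: field_simps)
qed

text \<open>Stated before division by \<open>sample_prob i\<close>. The error is relative to the cut
  in \<open>U r i\<close>, which is heavy by \<open>u_heavy\<close> even where the cut in
  \<open>F\<close> is small.\<close>

definition bad_draws :: "nat \<Rightarrow> (nat \<times> 'v set \<Rightarrow> nat) set" where
  "bad_draws i = {d. \<exists>A. cut_edges (Fs r i) A \<noteq> {} \<and>
     \<bar>\<Sum>e\<in>cut_edges (Fs r i) A. real (d (i, e)) - sample_prob i * 2 ^ i\<bar> >
       \<epsilon> / 25 * (sample_prob i * 2 ^ i) * card (cut_edges (U r i) A)}"

text \<open>An instance of \<open>cut_union_bound\<close> with \<open>U r i\<close> and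
  \<open>Fs r i\<close> for \<open>X\<close> and \<open>Y\<close>, the threshold of
  \<open>u_heavy\<close>, and variance proxy \<open>sample_prob i * 2 ^ i\<close>.\<close>

lemma prob_bad_draws:
  assumes i: "2 \<le> i" "i \<le> K"
  shows "measure_pmf.prob (draws r) (bad_draws i) \<le> 8 / real (card V) ^ 3"
proof -
  define A0 where "A0 = (SIGMA i:{1..idx r}. Fs r i)"
  define p where "p = sample_prob i"
  have p: "0 < p" "p \<le> 1" using sample_prob_ge_2[OF i(1)] by (simp_all add: p_def)
  have i_idx: "i \<le> idx r" using i K_le by simp
  have draws: "draws r = Pi_pmf A0 0 (\<lambda>(i, e). binomial_pmf (2 ^ i) (sample_prob i))"
    unfolding draws_def A0_def ..
  have finA0: "finite A0" unfolding A0_def by (intro finite_SigmaI finite_F) auto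
  define dev :: "'v set set \<Rightarrow> (nat \<times> 'v set \<Rightarrow> nat) \<Rightarrow> real"
    where "dev P d = \<bar>\<Sum>e\<in>P. real (d (i, e)) - p * 2 ^ i\<bar>" for P d
  have "measure_pmf.prob (draws r)
      {d. \<exists>A. cut_edges (Fs r i) A \<noteq> {} \<and> dev (cut_edges (Fs r i) A) d > \<epsilon> / 25 * (p * 2 ^ i) * card (cut_edges (U r i) A)} \<le> 8 / real (card V) ^ 3"
  proof (rule cut_union_bound[OF finite_V n2])
    show "e \<subseteq> V \<and> card e = 2" if "e \<in> U r i" for e using edge U_subset that by blast
    show "Fs r i \<subseteq> U r i" using U_contains i by simp
    show "0 < (17 / 18)\<^sup>2 * \<rho> * 2 ^ (i - 1)" using rho_ge by simp
    show "(17 / 18)\<^sup>2 * \<rho> * 2 ^ (i - 1) \<le> real (card (cut_edges (U r i) A))" if "cut_edges (Fs r i) A \<noteq> {}" for A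
      using u_heavy that i by simp
    show "0 \<le> \<epsilon> / 25 * (p * 2 ^ i)" using eps p by simp
    fix P and s :: real assume P: "P \<subseteq> Fs r i" "real (card P) \<le> s"
    have inj: "inj_on (Pair i) P" by (auto simp: inj_on_def)
    have sub: "Pair i ` P \<subseteq> A0" using P(1) i i_idx by (auto simp: A0_def)
    \<comment> \<open>The draws of all rounds form one product distribution, so the edges of
      \<open>P\<close> enter as pairs with first component \<open>i\<close>.\<close>
    have "measure_pmf.prob (Pi_pmf A0 0 (\<lambda>(i, e). binomial_pmf (2 ^ i) (sample_prob i)))
        {d. \<bar>\<Sum>z\<in>Pair i ` P. real (d z) - p * real (2 ^ i)\<bar> > \<epsilon> / 25 * (p * real (2 ^ i)) * s} \<le>
        2 * exp (- ((\<epsilon> / 25)\<^sup>2 * (p * real (2 ^ i)) / 2.24) * s)"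
    proof (rule Pi_pmf_two_sided_tail[OF finA0 sub])
      fix z assume "z \<in> Pair i ` P"
      then obtain e where z: "z = (i, e)" by blast
      show "finite (set_pmf (case z of (i, e) \<Rightarrow> binomial_pmf (2 ^ i) (sample_prob i)))"
        using p by (simp add: z finite_set_pmf_binomial_pmf flip: p_def)
      show "measure_pmf.expectation (case z of (i, e) \<Rightarrow> binomial_pmf (2 ^ i) (sample_prob i))
          (\<lambda>y. exp (l * (real y - p * real (2 ^ i)))) \<le> exp (0.56 * (p * real (2 ^ i)) * l\<^sup>2)"
        if "\<bar>l\<bar> \<le> 1 / 10" for l
        using mgf_centered_binomial[OF that, of p "2 ^ i"] p by (simp add: z flip: p_def)
    next
      show "real (card (Pair i ` P)) \<le> s" using P(2) inj by (simp add: card_image)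
    qed (use eps p in auto)
    moreover have "(\<Sum>z\<in>Pair i ` P. real (d z) - p * real (2 ^ i)) = (\<Sum>e\<in>P. real (d (i, e)) - p * 2 ^ i)" for d
      using inj by (simp add: sum.reindex)
    ultimately have "measure_pmf.prob (draws r) {d. dev P d > \<epsilon> / 25 * (p * 2 ^ i) * s} \<le>
        2 * exp (- ((\<epsilon> / 25)\<^sup>2 * (p * 2 ^ i) / 2.24) * s)"
      unfolding draws dev_def by simp
    also have "\<dots> \<le> 2 * exp (- (7 * ln (card V) / ((17 / 18)\<^sup>2 * \<rho> * 2 ^ (i - 1))) * s)"
    proof -
      have "0 \<le> s" using P(2) by linarith
      then have "7 * ln (card V) / ((17 / 18)\<^sup>2 * \<rho> * 2 ^ (i - 1)) * s \<le> (\<epsilon> / 25)\<^sup>2 * (p * 2 ^ i) / 2.24 * s"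
        using compression_exponent[OF i(1), folded p_def] by (rule mult_right_mono[rotated])
      then show ?thesis by simp
    qed
    finally show "measure_pmf.prob (draws r) {d. dev P d > \<epsilon> / 25 * (p * 2 ^ i) * s} \<le>
        2 * exp (- (7 * ln (card V) / ((17 / 18)\<^sup>2 * \<rho> * 2 ^ (i - 1))) * s)" .
  qed
  then show ?thesis by (simp add: bad_draws_def dev_def p_def)
qed

section \<open>Cut weights of the output and of the intermediate graph\<close>

lemma cut_edges_restrict:
  defines "C \<equiv> \<lambda>A. {e. e \<subseteq> V \<and> card e = 2 \<and> e \<inter> A \<noteq> {} \<and> e \<inter> (V - A) \<noteq> {}}"
  shows "finite (C A)" and "Z \<subseteq> E \<Longrightarrow> {e \<in> C A. e \<in> Z} = cut_edges Z A"
proof -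
  have "C A \<subseteq> Pow V" by (auto simp: C_def)
  then show "finite (C A)" using finite_V finite_subset by blast
  assume Z: "Z \<subseteq> E"
  show "{e \<in> C A. e \<in> Z} = cut_edges Z A"
  proof
    show "{e \<in> C A. e \<in> Z} \<subseteq> cut_edges Z A" by (auto simp: C_def cut_edges_def)
    show "cut_edges Z A \<subseteq> {e \<in> C A. e \<in> Z}"
    proof
      fix e assume e: "e \<in> cut_edges Z A"
      then have "e \<subseteq> V \<and> card e = 2" using edge Z by (auto simp: cut_edges_def)
      then show "e \<in> {e \<in> C A. e \<in> Z}" using e by (auto simp: C_def cut_edges_def)
    qed
  qed
qed

lemma cut_sum_restrict:
  assumes "Z \<subseteq> E"
  shows "(\<Sum>e | e \<subseteq> V \<and> card e = 2 \<and> e \<inter> A \<noteq> {} \<and> e \<inter> (V - A) \<noteq> {}. if e \<in> Z then g e else 0) =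
    (\<Sum>e\<in>cut_edges Z A. g e :: real)"
  using cut_edges_restrict(2)[OF assms, of A] sum.inter_filter[OF cut_edges_restrict(1)[of A], of g "\<lambda>e. e \<in> Z"] by simp

lemma cut_weight_add: "cut_weight V (\<lambda>e. g e + h e) A = cut_weight V g A + cut_weight V h A"
  by (simp add: cut_weight_def sum.distrib)

lemma cut_weight_sum: "cut_weight V (\<lambda>e. \<Sum>i\<in>I. g i e) A = (\<Sum>i\<in>I. cut_weight V (g i) A)"
  unfolding cut_weight_def by (rule sum.swap)

lemma cut_weight_scaled: "Z \<subseteq> E \<Longrightarrow> cut_weight V (scaled c Z) A = c * card (cut_edges Z A)"
  using cut_sum_restrict[of Z "\<lambda>_. c" A] by (simp add: cut_weight_def scaled_def mult.commute)

lemma F_subset: "i \<le> idx r \<Longrightarrow> Fs r i \<subseteq> E" and Y_subset: "i \<le> idx r \<Longrightarrow> Ys r i \<subseteq> E"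
  using valid_runD(3,4,5)[OF valid, of i] by auto

lemma cut_weight_graph_S: "cut_weight V (graph_S r) A = weight_S r A"
proof -
  have "cut_weight V (graph_S r) A =
      cut_weight V (\<lambda>e. (\<Sum>i\<in>{0..K}. scaled (2 ^ i) (Fs r i) e) + scaled (2 ^ K) (Ys r K) e) A"
    by (simp add: cut_weight_def graph_S_def Let_def)
  also have "\<dots> = (\<Sum>i\<in>{0..K}. cut_weight V (scaled (2 ^ i) (Fs r i)) A) + cut_weight V (scaled (2 ^ K) (Ys r K)) A"
    by (simp only: cut_weight_add cut_weight_sum)
  also have "\<dots> = weight_S r A"
    unfolding weight_S_def using K_le
    by (intro arg_cong2[where f = "(+)"] sum.cong refl cut_weight_scaled F_subset Y_subset) auto
  finally show ?thesis .
qed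

lemma cut_weight_output:
  "cut_weight V (output_graph r d) A = f 0 A + 2 ^ idx r * y (idx r) A +
     (\<Sum>i\<in>{1..idx r}. \<Sum>e\<in>cut_edges (Fs r i) A. real (d (i, e)) / sample_prob i)"
proof -
  \<comment> \<open>A draw of 0 contributes weight 0, so \<open>g\<close> covers both outcomes of
    the positivity test in \<open>output_graph\<close>.\<close>
  define g where "g i e = (if e \<in> Fs r i then real (d (i, e)) / sample_prob i else 0)" for i e
  have "output_graph r d = (\<lambda>e. (scaled 1 (Fs r 0) e + scaled (2 ^ idx r) (Ys r (idx r)) e) + (\<Sum>i\<in>{1..idx r}. g i e))"
    unfolding output_graph_def g_def
    by (intro ext arg_cong2[where f = "(+)"] sum.cong refl) auto
  then have "cut_weight V (output_graph r d) A = cut_weight V (scaled 1 (Fs r 0)) A +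
      cut_weight V (scaled (2 ^ idx r) (Ys r (idx r))) A + (\<Sum>i\<in>{1..idx r}. cut_weight V (g i) A)"
    by (simp only: cut_weight_add cut_weight_sum)
  also have "(\<Sum>i\<in>{1..idx r}. cut_weight V (g i) A) =
      (\<Sum>i\<in>{1..idx r}. \<Sum>e\<in>cut_edges (Fs r i) A. real (d (i, e)) / sample_prob i)"
    unfolding cut_weight_def g_def by (intro sum.cong refl cut_sum_restrict F_subset) auto
  finally show ?thesis
    using cut_weight_scaled[OF F_subset[of 0], of 1 A] cut_weight_scaled[OF Y_subset[of "idx r"], of "2 ^ idx r" A]
    by (simp add: f_def y_def)
qed

text \<open>The error splits into the drift after round \<open>K\<close> and the draws of rounds 1
  to \<open>K\<close>, of which round 1 is exact. For \<open>K \<ge> 2\<close> the parts add up to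
  \<open>13 / 45 * 9 / 16 + 4 / 25\<close>, about 0.3225, times \<epsilon>; for smaller
  \<open>K\<close> only \<open>13 / 45\<close> times \<epsilon> remains. Both are below
  \<open>\<epsilon> / 3\<close>.\<close>

lemma cut_error:
  assumes d1: "\<And>e. 1 \<le> idx r \<Longrightarrow> e \<in> Fs r 1 \<Longrightarrow> d (1, e) = 2"
    and good: "\<And>i. 2 \<le> i \<Longrightarrow> i \<le> K \<Longrightarrow> d \<notin> bad_draws i"
  shows "\<bar>cut_weight V (output_graph r d) A - cut_weight V (graph_S r) A\<bar> \<le> \<epsilon> / 3 * cut_weight V (graph_S r) A"
proof -
  define D where "D i = (\<Sum>e\<in>cut_edges (Fs r i) A. real (d (i, e)) / sample_prob i)" for i
  define w where "w = weight_S r A"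
  have w0: "0 \<le> w" by (simp add: w_def weight_S_def sum_nonneg)
  have "(\<Sum>i\<in>{1..idx r}. D i) = (\<Sum>i\<in>{1..K}. D i)"
    using K_le top_index_le(2)[OF valid] by (intro sum.mono_neutral_right) (auto simp: D_def cut_edges_def)
  then have out: "cut_weight V (output_graph r d) A = f 0 A + 2 ^ idx r * y (idx r) A + (\<Sum>i\<in>{1..K}. D i)"
    by (simp add: cut_weight_output flip: D_def)
  have "{0..K} = insert 0 {1..K}" by auto
  then have "w = f 0 A + (\<Sum>i\<in>{1..K}. 2 ^ i * f i A) + 2 ^ K * y K A"
    by (simp add: w_def weight_S_def f_def y_def)
  then have diff: "cut_weight V (output_graph r d) A - w =
      (2 ^ idx r * y (idx r) A - 2 ^ K * y K A) + (\<Sum>i\<in>{1..K}. D i - 2 ^ i * f i A)"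
    unfolding out by (simp add: sum_subtractf)
  have D1: "D 1 - 2 ^ 1 * f 1 A = 0" if "1 \<le> K"
  proof -
    have "D 1 = (\<Sum>e\<in>cut_edges (Fs r 1) A. 2)"
      unfolding D_def
    proof (intro sum.cong refl)
      fix e assume "e \<in> cut_edges (Fs r 1) A"
      then have "d (1, e) = 2" using that K_le by (intro d1) (auto simp: cut_edges_def)
      then show "real (d (1, e)) / sample_prob 1 = 2" by (simp only: sample_prob_1)
    qed
    then show ?thesis by (simp add: f_def)
  qed
  have D2: "\<bar>D i - 2 ^ i * f i A\<bar> \<le> \<epsilon> / 25 * (2 ^ i * real (card (cut_edges (U r i) A)))" if i: "2 \<le> i" "i \<le> K" for i
  proof (cases "cut_edges (Fs r i) A = {}")
    case True
    then show ?thesis using eps by (simp add: D_def f_def)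
  next
    case False
    define p where "p = sample_prob i"
    have p: "0 < p" using sample_prob_ge_2[OF i(1)] by (simp add: p_def)
    have "\<bar>\<Sum>e\<in>cut_edges (Fs r i) A. real (d (i, e)) - p * 2 ^ i\<bar> \<le> \<epsilon> / 25 * (p * 2 ^ i) * card (cut_edges (U r i) A)"
      using good[OF i] False unfolding bad_draws_def p_def by (auto simp: not_less)
    moreover have "(\<Sum>e\<in>cut_edges (Fs r i) A. real (d (i, e)) - p * 2 ^ i) = p * (D i - 2 ^ i * f i A)"
      using p by (simp add: D_def f_def sum_subtractf right_diff_distrib sum_distrib_left flip: p_def)
    ultimately have "p * \<bar>D i - 2 ^ i * f i A\<bar> \<le> p * (\<epsilon> / 25 * (2 ^ i * real (card (cut_edges (U r i) A))))"
      using p by (simp add: abs_mult mult_ac)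
    then show ?thesis using p by simp
  qed
  have "\<bar>\<Sum>i\<in>{1..K}. D i - 2 ^ i * f i A\<bar> \<le> (\<Sum>i\<in>{1..K}. \<bar>D i - 2 ^ i * f i A\<bar>)"
    by (rule sum_abs)
  also have "\<dots> = (\<Sum>i\<in>{2..K}. \<bar>D i - 2 ^ i * f i A\<bar>)"
  proof (intro sum.mono_neutral_right ballI)
    fix i assume i: "i \<in> {1..K} - {2..K}"
    then have "i = 1" "1 \<le> K" by auto
    then show "\<bar>D i - 2 ^ i * f i A\<bar> = 0" using D1 by simp
  qed auto
  also have "\<dots> \<le> (\<Sum>i\<in>{2..K}. \<epsilon> / 25 * (2 ^ i * real (card (cut_edges (U r i) A))))"
    using D2 by (intro sum_mono) auto
  finally have comp: "\<bar>\<Sum>i\<in>{1..K}. D i - 2 ^ i * f i A\<bar> \<le> (\<Sum>i\<in>{2..K}. \<epsilon> / 25 * (2 ^ i * real (card (cut_edges (U r i) A))))" .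
  have "\<bar>2 ^ idx r * y (idx r) A - 2 ^ K * y K A\<bar> \<le> 13 / 45 * \<epsilon> * (3 / 4) ^ K * w"
    using tail_error[of A] by (simp add: y_def w_def)
  then have tail: "\<bar>2 ^ idx r * y (idx r) A - 2 ^ K * y K A\<bar> \<le> 13 / 45 * (\<epsilon> * w) * (3 / 4) ^ K"
    by (simp add: mult_ac)
  have w\<epsilon>: "0 \<le> \<epsilon> * w" using w0 eps by simp
  have "\<bar>cut_weight V (output_graph r d) A - w\<bar> \<le> 1 / 3 * (\<epsilon> * w)"
  proof (cases "2 \<le> K")
    case True
    have "(3 / 4) ^ K \<le> (3 / 4 :: real) ^ 2" using True by (intro power_decreasing) auto
    then have "13 / 45 * (\<epsilon> * w) * (3 / 4) ^ K \<le> 13 / 45 * (\<epsilon> * w) * (9 / 16)"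
      using w\<epsilon> by (intro mult_left_mono) (auto simp: power2_eq_square)
    moreover have "(\<Sum>i\<in>{2..K}. \<epsilon> / 25 * (2 ^ i * real (card (cut_edges (U r i) A)))) \<le> \<epsilon> / 25 * (4 * w)"
      unfolding sum_distrib_left[symmetric] w_def using eps by (intro mult_left_mono sum_U_le) auto
    moreover have "\<epsilon> / 25 * (4 * w) = 4 / 25 * (\<epsilon> * w)" by simp
    ultimately show ?thesis unfolding diff using tail comp w\<epsilon> by linarith
  next
    case False
    then have "{2..K} = {}" by simp
    then have "(\<Sum>i\<in>{1..K}. D i - 2 ^ i * f i A) = 0" using comp by simp
    moreover have "13 / 45 * (\<epsilon> * w) * (3 / 4) ^ K \<le> 13 / 45 * (\<epsilon> * w) * 1"
      using w\<epsilon> by (intro mult_left_mono power_le_one) auto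
    ultimately show ?thesis unfolding diff using tail w\<epsilon> by linarith
  qed
  then show ?thesis by (simp add: cut_weight_graph_S w_def)
qed

lemma prob_not_cut_approx:
  "measure_pmf.prob (draws r) {d. \<not> cut_approx V (\<epsilon> / 3) (output_graph r d) (graph_S r)} \<le>
     card V * (8 / real (card V) ^ 3)"
proof -
  let ?B = "{d. \<not> cut_approx V (\<epsilon> / 3) (output_graph r d) (graph_S r)}"
  have sub: "?B \<inter> set_pmf (draws r) \<subseteq> (\<Union>i\<in>{2..K}. bad_draws i)"
  proof (rule subsetI, rule ccontr)
    fix d assume d: "d \<in> ?B \<inter> set_pmf (draws r)" and good: "d \<notin> (\<Union>i\<in>{2..K}. bad_draws i)"
    have fin: "finite (SIGMA i:{1..idx r}. Fs r i)" by (intro finite_SigmaI finite_F) auto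
    \<comment> \<open>This holds on the support only, where two trials of success probability 1 both
      succeed; hence the restriction of the bad event to the support.\<close>
    have "d (1, e) = 2" if "1 \<le> idx r" "e \<in> Fs r 1" for e
    proof -
      have "d (1, e) \<in> set_pmf (binomial_pmf (2 ^ 1) (sample_prob 1))"
      proof -
        have "d \<in> set_pmf (draws r)" using d by blast
        then have "\<forall>z\<in>SIGMA i:{1..idx r}. Fs r i. d z \<in> set_pmf (case z of (i, e) \<Rightarrow> binomial_pmf (2 ^ i) (sample_prob i))"
          unfolding draws_def set_Pi_pmf[OF fin] by (simp add: PiE_dflt_def)
        moreover have "(1, e) \<in> (SIGMA i:{1..idx r}. Fs r i)" using that by simp
        ultimately show ?thesis by fastforce
      qed
      then have "d (1, e) \<in> set_pmf (binomial_pmf 2 1)"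
        by (simp only: sample_prob_1 power_one_right)
      then show ?thesis by simp
    qed
    then have err: "\<bar>cut_weight V (output_graph r d) A - cut_weight V (graph_S r) A\<bar> \<le>
        \<epsilon> / 3 * cut_weight V (graph_S r) A" for A
      using good by (intro cut_error) auto
    have "cut_approx V (\<epsilon> / 3) (output_graph r d) (graph_S r)"
      unfolding cut_approx_def
    proof (intro allI impI conjI)
      fix A
      show "(1 - \<epsilon> / 3) * cut_weight V (graph_S r) A \<le> cut_weight V (output_graph r d) A"
        using err[of A] unfolding left_diff_distrib by linarith
      show "cut_weight V (output_graph r d) A \<le> (1 + \<epsilon> / 3) * cut_weight V (graph_S r) A"
        using err[of A] unfolding distrib_right by linarith
    qed
    then show False using d by simp
  qed
  have "measure_pmf.prob (draws r) ?B = measure_pmf.prob (draws r) (?B \<inter> set_pmf (draws r))"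
    by (simp add: measure_Int_set_pmf)
  also have "\<dots> \<le> measure_pmf.prob (draws r) (\<Union>i\<in>{2..K}. bad_draws i)"
    by (intro measure_pmf.finite_measure_mono sub) auto
  also have "\<dots> \<le> (\<Sum>i\<in>{2..K}. measure_pmf.prob (draws r) (bad_draws i))"
    by (intro measure_pmf.finite_measure_subadditive_finite) auto
  also have "\<dots> \<le> (\<Sum>i\<in>{2..K}. 8 / real (card V) ^ 3)" by (intro sum_mono prob_bad_draws) auto
  also have "\<dots> = real (K - 1) * (8 / real (card V) ^ 3)" by simp
  also have "\<dots> \<le> card V * (8 / real (card V) ^ 3)"
    using K_le valid_runD(1)[OF valid] by (intro mult_right_mono) auto
  finally show ?thesis .
qed

end

text \<open>The sampling loop and the final draws each contribute at most \<open>8 / n ^ 2\<close>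
  to the failure probability, and \<open>16 / n ^ 2 \<le> 4 / n\<close> because
  \<open>n \<ge> 4\<close>.\<close>

lemma sparsify_prob:
  "measure (measure_spmf (sparsify ni V E \<epsilon>)) {(r, g). cut_approx V (\<epsilon> / 3) g (graph_S r)} \<ge>
     1 - 4 / real (card V)"
proof -
  define n where "n = real (card V)"
  have n4: "4 \<le> n" using n_ge by (simp add: n_def)
  let ?r0 = "initial_run ni V E \<rho>"
  have "idx ?r0 = 0" by (simp add: initial_run_def Let_def)
  then obtain p where p: "sampling_loop ni V \<rho> ?r0 = spmf_of_pmf p"
    and unfaithful: "measure_pmf.prob p {r. \<not> (valid_run r \<and> faithful_run r)} \<le> card V * (8 / real (card V) ^ 3)"
    using sampling_loop_pmf[OF valid_initial, of "card V"] faithful_initial by auto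
  define q where "q = bind_pmf p (\<lambda>r. map_pmf (\<lambda>d. (r, output_graph r d)) (draws r))"
  have sp: "sparsify ni V E \<epsilon> = spmf_of_pmf q"
    unfolding sparsify_def Let_def rho[symmetric] p q_def by (simp add: spmf_of_pmf_bind)
  define G where "G = {(r, g). cut_approx V (\<epsilon> / 3) g (graph_S r)}"
  have "measure_pmf.prob q (- G) \<le> n * (8 / n ^ 3) + n * (8 / n ^ 3)"
    unfolding q_def
  proof (rule prob_bind_pmf_le)
    show "measure_pmf.prob p {r. \<not> (valid_run r \<and> faithful_run r)} \<le> n * (8 / n ^ 3)"
      using unfaithful by (simp add: n_def)
    show "0 \<le> n * (8 / n ^ 3)" using n4 by simp
    fix r assume "r \<notin> {r. \<not> (valid_run r \<and> faithful_run r)}"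
    then have "measure_pmf.prob (draws r) {d. \<not> cut_approx V (\<epsilon> / 3) (output_graph r d) (graph_S r)} \<le> n * (8 / n ^ 3)"
      unfolding n_def by (intro prob_not_cut_approx) auto
    then show "measure_pmf.prob (map_pmf (\<lambda>d. (r, output_graph r d)) (draws r)) (- G) \<le> n * (8 / n ^ 3)"
      by (simp add: G_def vimage_def)
  qed
  also have "\<dots> = 16 / (n * n)" using n4 by (simp add: power3_eq_cube)
  also have "\<dots> \<le> 4 / n" using n4 by (simp add: field_simps)
  finally have "measure_pmf.prob q (- G) \<le> 4 / n" .
  moreover have "measure_pmf.prob q (- G) = 1 - measure_pmf.prob q G"
    using measure_pmf.prob_compl[of G q] by (simp add: Compl_eq_Diff_UNIV)
  ultimately show ?thesis unfolding sp by (simp add: G_def n_def)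
qed

end

theorem mainTheorem3:
  fixes V :: "'v set" and E :: "'v set set" and \<epsilon> :: real
    and ni :: "('v set, 'v set) multigraph \<Rightarrow> nat \<Rightarrow> 'v set set"
  assumes "simple_graph V E"
    and "0 < \<epsilon>" and "\<epsilon> \<le> 1"
    and "real (card E) > 2 * rho (card V) \<epsilon> * real (card V)"
    and "NI_subroutine ni"
  shows "measure (measure_spmf (sparsify ni V E \<epsilon>))
           {(r, g). cut_approx V (\<epsilon> / 3) g (graph_S r)} \<ge> 1 - 4 / real (card V)"
proof -
  interpret dense_graph V E \<epsilon> "rho (card V) \<epsilon>" ni
    using assms by unfold_locales auto
  show ?thesis by (rule sparsify_prob)
qed

end
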